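(* Let $p,q,r$ denote prime numbers with $p<q<r$ and let $k$ denote a positive integer. A positive integer $N>1$ is small recurrent if and only if $N$ belongs to one of the following forms. (1) $N=p^k$ for some $k\ge 1$. In this case $S'_N=\{p,p^2,\ldots,p^{\lfloor (k-1)/2\rfloor}\}$ satisfies $U(p,p^2,p,0)$. (2) $N=p^kq$ or $N=pq^k$ for some $1\le k\le 3$, where for $N=p^3q$ one requires that either $p<q<p^2$ or $p^3<q$. (3) $N=p^kq$ for some $k\ge 4$ and $q>p^k$. In this case $S'_N=\{p,p^2,\ldots,p^k\}$ satisfies $U(p,p^2,p,0)$. (4) $N=p^kq$ for some $k\ge 4$ and $\sqrt{q}<p<q$. In this case $S'_N=\{p,q,p^2,pq,\ldots\}$ satisfies $U(p,q,0,p)$. (5) $N=pq^k$ for some $k\ge 4$ and $p<q$. In this case $S'_N=\{p,q,pq,q^2,\ldots\}$ satisfies $U(p,q,0,q)$. (6) $N=pq^kr$ for some $k\ge 2$, $p<q$, and $r>pq^k$. In this case $S'_N=\{p,q,pq,q^2,\ldots,pq^{k-1},q^k,pq^k\}$ satisfies $U(p,q,0,q)$. (7) $N=p^2q^2$ for some $p<q<p^2$. In this case $S'_N=\{p,q,p^2\}$. (8) $N=pqr$ for some $p<q<r$. If $r<pq$ then $S'_N=\{p,q,r\}$; if $r>pq$ then $S'_N=\{p,q,pq\}$. (9) $N=p^3q^2$ for some $p^{3/2}<q<p^2$. In this case $S'_N=\{p,q,p^2,pq,p^3\}$ satisfies $U(p,q,0,p)$. (10) $N=p^2qr$, where $p<q<p^2<r<pq$,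 $(q^2-p^3)\mid(pq-r)$, $(q^2-p^3)\mid(rq-p^4)$, and $r=pq-\sqrt{(q^2-p^3)(p^2-q)}$. In this case $S'_N=\{p,q,p^2,r,pq\}$ satisfies $U\!\left(p,q,\frac{p(pq-r)}{q^2-p^3},\frac{rq-p^4}{q^2-p^3}\right)$.
   Context: For an integer $N>1$ let $S'_N=\{d: 1<d<\sqrt{N},\ d\mid N\}$. For $(u,v,a,b)\in\mathbb{Z}^4$, $U(u,v,a,b)$ denotes the integer sequence $n_1=u$, $n_2=v$, $n_i=an_{i-1}+bn_{i-2}$ for $i\ge 3$. A finite set of integers satisfies $U(u,v,a,b)$ if its elements, listed in increasing order, are the first terms $n_1,n_2,\ldots$ of this sequence. $N$ is called small recurrent if $S'_N$ satisfies a linear recurrence of order at most two, i.e. there are integers $a,b$ such that the elements $x_1<x_2<\cdots$ of $S'_N$ satisfy $x_i=ax_{i-1}+bx_{i-2}$ for all $i\ge 3$; when $|S'_N|\le 2$, $N$ is vacuously small recurrent. *)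

theory Defs
  imports Complex_Main "HOL-Computational_Algebra.Primes"
begin

(* The set S'_N. *)
definition small_divisors :: "int \<Rightarrow> int set" where
  "small_divisors N = {d. 1 < d \<and> real_of_int d < sqrt (real_of_int N) \<and> d dvd N}"

(* The sequence U(u,v,a,b), indexed from 0: rec_seq u v a b i is the term n_{i+1}. *)
fun rec_seq :: "int \<Rightarrow> int \<Rightarrow> int \<Rightarrow> int \<Rightarrow> nat \<Rightarrow> int" where
  "rec_seq u v a b 0 = u"
| "rec_seq u v a b (Suc 0) = v"
| "rec_seq u v a b (Suc (Suc i)) = a * rec_seq u v a b (Suc i) + b * rec_seq u v a b i"

definition satisfies_U :: "int set \<Rightarrow> int \<Rightarrow> int \<Rightarrow> int \<Rightarrow> int \<Rightarrow> bool" where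
  "satisfies_U A u v a b \<longleftrightarrow>
     finite A \<and> sorted_list_of_set A = map (rec_seq u v a b) [0..<card A]"

(* Positions of the sorted list are counted from 0, so x_i with i >= 3 is xs ! j with j >= 2. *)
definition small_recurrent :: "int \<Rightarrow> bool" where
  "small_recurrent N \<longleftrightarrow>
     (let xs = sorted_list_of_set (small_divisors N) in
      \<exists>a b :: int. \<forall>j. 2 \<le> j \<and> j < length xs \<longrightarrow>
        xs ! j = a * xs ! (j - 1) + b * xs ! (j - 2))"

definition form1 :: "int \<Rightarrow> int \<Rightarrow> nat \<Rightarrow> bool" where
  "form1 N p k \<longleftrightarrow> prime p \<and> k \<ge> 1 \<and> N = p ^ k"

definition form2 :: "int \<Rightarrow> int \<Rightarrow> int \<Rightarrow> nat \<Rightarrow> bool" where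
  "form2 N p q k \<longleftrightarrow>
     prime p \<and> prime q \<and> p < q \<and> 1 \<le> k \<and> k \<le> 3 \<and>
     (N = p ^ k * q \<and> (k = 3 \<longrightarrow> (p < q \<and> q < p\<^sup>2) \<or> p ^ 3 < q) \<or> N = p * q ^ k)"

definition form3 :: "int \<Rightarrow> int \<Rightarrow> int \<Rightarrow> nat \<Rightarrow> bool" where
  "form3 N p q k \<longleftrightarrow>
     prime p \<and> prime q \<and> p < q \<and> k \<ge> 4 \<and> q > p ^ k \<and> N = p ^ k * q"

definition form4 :: "int \<Rightarrow> int \<Rightarrow> int \<Rightarrow> nat \<Rightarrow> bool" where
  "form4 N p q k \<longleftrightarrow>
     prime p \<and> prime q \<and> k \<ge> 4 \<and>
     sqrt (real_of_int q) < real_of_int p \<and> p < q \<and> N = p ^ k * q"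

definition form5 :: "int \<Rightarrow> int \<Rightarrow> int \<Rightarrow> nat \<Rightarrow> bool" where
  "form5 N p q k \<longleftrightarrow> prime p \<and> prime q \<and> p < q \<and> k \<ge> 4 \<and> N = p * q ^ k"

definition form6 :: "int \<Rightarrow> int \<Rightarrow> int \<Rightarrow> int \<Rightarrow> nat \<Rightarrow> bool" where
  "form6 N p q r k \<longleftrightarrow>
     prime p \<and> prime q \<and> prime r \<and> p < q \<and> q < r \<and> k \<ge> 2 \<and> r > p * q ^ k \<and>
     N = p * q ^ k * r"

definition form7 :: "int \<Rightarrow> int \<Rightarrow> int \<Rightarrow> bool" where
  "form7 N p q \<longleftrightarrow> prime p \<and> prime q \<and> p < q \<and> q < p\<^sup>2 \<and> N = p\<^sup>2 * q\<^sup>2"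

definition form8 :: "int \<Rightarrow> int \<Rightarrow> int \<Rightarrow> int \<Rightarrow> bool" where
  "form8 N p q r \<longleftrightarrow>
     prime p \<and> prime q \<and> prime r \<and> p < q \<and> q < r \<and> N = p * q * r"

definition form9 :: "int \<Rightarrow> int \<Rightarrow> int \<Rightarrow> bool" where
  "form9 N p q \<longleftrightarrow>
     prime p \<and> prime q \<and> p < q \<and>
     real_of_int p powr (3/2) < real_of_int q \<and> q < p\<^sup>2 \<and> N = p ^ 3 * q\<^sup>2"

(* Were q^2 < p^3, the radicand below would be negative (as q < p^2).  HOL's sqrt is odd, so the
   last equation would then give r > p * q, contradicting r < p * q: the junk values of sqrt
   admit no extra solutions. The two divisibility conditions make the quotients by q^2 - p^3
   (nonzero, as p and q are distinct primes) exact, so they may be written with div. *)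
definition form10 :: "int \<Rightarrow> int \<Rightarrow> int \<Rightarrow> int \<Rightarrow> bool" where
  "form10 N p q r \<longleftrightarrow>
     prime p \<and> prime q \<and> prime r \<and>
     p < q \<and> q < p\<^sup>2 \<and> p\<^sup>2 < r \<and> r < p * q \<and>
     (q\<^sup>2 - p ^ 3) dvd (p * q - r) \<and> (q\<^sup>2 - p ^ 3) dvd (r * q - p ^ 4) \<and>
     real_of_int r = real_of_int (p * q) - sqrt (real_of_int ((q\<^sup>2 - p ^ 3) * (p\<^sup>2 - q))) \<and>
     N = p\<^sup>2 * q * r"

end

theory Submission
  imports Defs
begin

text \<open>Extend the small divisors to an infinite sequence \<open>X\<close> by the recurrence. If two consecutive terms
  share a prime factor, it divides everything that follows, which leaves room for at most one other
  prime; this settles the lists that start with \<open>p, p\<^sup>2\<close> or \<open>p, q, p q\<close> or \<open>p, q, p\<^sup>2, p q\<close>. If the list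
  contains \<open>p q\<close> and starts with three primes \<open>p, q, r\<close> or with \<open>p, q, p\<^sup>2, r\<close>, then for suitable primes
  \<open>l\<close> no two consecutive terms are multiples of \<open>l\<close>, hence the multiples of \<open>l\<close> occur at equidistant indices.
  Divided by \<open>l\<close> they begin with \<open>1, X 0, X 1, \<dots>\<close> and satisfy another recurrence of order two.
  Comparing these index gaps and recurrences leaves only \<open>N = p\<^sup>2 q r\<close>.\<close>

section \<open>Increasing recurrence sequences\<close>

text \<open>Lists starting with \<open>p, p^2\<close> aside, the product \<open>p * q\<close> of the
  two smallest primes is the yardstick. If it is not a small divisor, \<open>N\<close> is at most
  its square and size puts \<open>N\<close> on the list. Otherwise every small divisor below it is
  \<open>p\<close>, \<open>p * p\<close> or a prime, so the start of the list can be read off. Gaps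
  are equal because, at two indices where \<open>l\<close> divides \<open>X\<close>, the pairs of
  consecutive terms are \<open>(0, u)\<close> and \<open>(0, u')\<close> modulo \<open>l\<close>,
  hence proportional, and the same pattern of zeros follows both. With gap \<open>s\<close>, the
  subsequence of step \<open>s\<close> has coefficients \<open>alpha^s + beta^s\<close> and
  \<open>- (alpha * beta)^s\<close>, where \<open>alpha\<close>, \<open>beta\<close> are the roots
  of \<open>x^2 - a x - b\<close>. For lists \<open>p, q, r\<close> the quotient recurrence
  coincides with the original one because \<open>q^2 - p r\<close> is nonzero. It fails at the exact
  power \<open>l^e\<close> in \<open>N\<close>: \<open>l\<close> times it no longer divides
  \<open>N\<close>, so the quotients skip it. For this skip to occur inside the list,
  \<open>p * l^(e+1)\<close> should lie below the square root of \<open>N\<close>; hence the search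
  for three primes and the choice of the one with the least exact power.\<close>

lemma small_divisors_iff: "d \<in> small_divisors N \<longleftrightarrow> 1 < d \<and> d * d < N \<and> d dvd N"
proof -
  have "real_of_int d < sqrt (real_of_int N) \<longleftrightarrow> d * d < N" if "1 < d"
  proof -
    have "real_of_int d = sqrt (real_of_int (d * d))" using that by simp
    then have "real_of_int d < sqrt (real_of_int N) \<longleftrightarrow> real_of_int (d * d) < real_of_int N"
      by (metis real_sqrt_less_iff)
    then show ?thesis by linarith
  qed
  then show ?thesis by (auto simp: small_divisors_def)
qed

lemma finite_small_divisors: "finite (small_divisors N)"
proof (rule finite_subset)
  show "small_divisors N \<subseteq> {1..N}"
  proof
    fix d assume "d \<in> small_divisors N"
    then have "1 < d" "d * d < N" by (auto simp: small_divisors_iff)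
    moreover from this have "d * 1 \<le> d * d" by (intro mult_left_mono) auto
    ultimately have "1 \<le> d \<and> d \<le> N" by linarith
    then show "d \<in> {1..N}" by simp
  qed
qed simp

lemma sorted_list_of_increasing:
  fixes Y :: "nat \<Rightarrow> int"
  assumes "\<And>i. Suc i < m \<Longrightarrow> Y i < Y (Suc i)"
  shows "sorted_list_of_set (Y ` {..<m}) = map Y [0..<m]"
proof -
  have "sorted_wrt (<) (map Y [0..<m])"
    by (subst sorted_wrt_iff_nth_Suc_transp) (use assms in \<open>auto intro: transpI\<close>)
  then have "sorted_list_of_set (set (map Y [0..<m])) = map Y [0..<m]"
    by (simp only: strict_sorted_iff sorted_list_of_set.idem_if_sorted_distinct)
  then show ?thesis by (simp add: atLeast0LessThan)
qed

lemma satisfies_U_of_increasing: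
  fixes Y :: "nat \<Rightarrow> int"
  assumes A: "A = Y ` {..<m}" and mono: "\<And>i. Suc i < m \<Longrightarrow> Y i < Y (Suc i)"
    and rec: "\<And>i. i < m \<Longrightarrow> Y i = rec_seq u v a b i"
  shows "satisfies_U A u v a b"
proof -
  have l: "sorted_list_of_set A = map Y [0..<m]"
    unfolding A by (rule sorted_list_of_increasing) (rule mono)
  moreover have "finite A" using A by simp
  ultimately have "card A = m"
    by (metis length_map length_upt diff_zero length_sorted_list_of_set)
  with l \<open>finite A\<close> rec show ?thesis by (simp add: satisfies_U_def)
qed

lemma satisfies_U_insert3:
  assumes "u < v" "v < w" "w = a * v + b * u"
  shows "satisfies_U {u, v, w :: int} u v a b"
proof -
  define Y where "Y = (\<lambda>i::nat. [u, v, w] ! i)"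
  have "{u, v, w} = Y ` {..<3}" by (auto simp: Y_def lessThan_Suc numeral_eq_Suc)
  moreover have "Y i < Y (Suc i)" if "Suc i < 3" for i
    using that assms by (auto simp: Y_def less_Suc_eq numeral_eq_Suc)
  moreover have "Y i = rec_seq u v a b i" if "i < 3" for i
    using that assms by (auto simp: Y_def less_Suc_eq numeral_eq_Suc)
  ultimately show ?thesis by (rule satisfies_U_of_increasing)
qed

lemma satisfies_U_insert5:
  assumes "x < y" "y < z" "z < t" "t < w"
    and "z = a * y + b * x" "t = a * z + b * y" "w = a * t + b * z"
  shows "satisfies_U {x, y, z, t, w :: int} x y a b"
proof -
  define Y where "Y = (\<lambda>i::nat. [x, y, z, t, w] ! i)"
  have "{x, y, z, t, w} = Y ` {..<5}" by (auto simp: Y_def lessThan_Suc numeral_eq_Suc)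
  moreover have "Y i < Y (Suc i)" if "Suc i < 5" for i
    using that assms by (auto simp: Y_def less_Suc_eq numeral_eq_Suc)
  moreover have "Y i = rec_seq x y a b i" if "i < 5" for i
  proof -
    have "i = 0 \<or> i = 1 \<or> i = 2 \<or> i = 3 \<or> i = 4" using that by auto
    then show ?thesis using assms by (elim disjE) (simp_all add: Y_def numeral_eq_Suc)
  qed
  ultimately show ?thesis by (rule satisfies_U_of_increasing)
qed

lemma small_recurrent_of_satisfies_U:
  assumes "satisfies_U (small_divisors N) u v a b"
  shows "small_recurrent N"
  unfolding small_recurrent_def Let_def
proof (intro exI allI impI)
  fix j assume j: "2 \<le> j \<and> j < length (sorted_list_of_set (small_divisors N))"
  then obtain i where i: "j = Suc (Suc i)" by (metis add_2_eq_Suc le_Suc_ex)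
  show "sorted_list_of_set (small_divisors N) ! j =
    a * sorted_list_of_set (small_divisors N) ! (j - 1) +
    b * sorted_list_of_set (small_divisors N) ! (j - 2)"
    using assms j i by (auto simp: satisfies_U_def nth_append)
qed

lemma dvd_prime_power_mult_cases:
  fixes p :: int
  assumes "prime p" "d dvd p ^ k * M" "0 < d" "0 < M"
  obtains i e where "i \<le> k" "0 < e" "e dvd M" "d = p ^ i * e"
proof -
  obtain x y where xy: "d = x * y" "x dvd p ^ k" "y dvd M"
    using division_decomp[OF assms(2)] by blast
  obtain i where i: "i \<le> k" "normalize x = p ^ i"
    using divides_primepow[OF assms(1) xy(2)] by blast
  have "\<bar>x\<bar> = p ^ i" using i(2) by simp
  moreover have "d = \<bar>x\<bar> * \<bar>y\<bar>" using assms(3) xy(1) by (simp add: abs_mult [symmetric])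
  moreover have "\<bar>y\<bar> > 0" using assms(3) xy(1) by auto
  ultimately show thesis using i(1) xy(3) that[of i "\<bar>y\<bar>"] by simp
qed

lemma dvd_prime_cases:
  fixes p :: int
  assumes "prime p" "d dvd p" "0 < d"
  shows "d = 1 \<or> d = p"
  using assms prime_int_iff by auto

lemma prime_power_cmp:
  fixes p :: int
  assumes "prime p"
  shows "p ^ i < p ^ j \<longleftrightarrow> i < j"
  using prime_gt_1_int[OF assms] by simp

section \<open>Small divisors of the listed forms\<close>

lemma rec_seq_geometric: "rec_seq u (c * u) c 0 i = c ^ i * u"
  by (induction u "c * u" c "0::int" i rule: rec_seq.induct) auto

text \<open>With \<open>a = 0\<close> the recurrence does not mix even and odd indices, so it splits
  into two geometric progressions of ratio \<open>c\<close>.\<close>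

lemma rec_seq_interlaced:
  "rec_seq u v 0 c (2 * t) = c ^ t * u" "rec_seq u v 0 c (Suc (2 * t)) = c ^ t * v"
  by (induction t) auto

lemma rec_seq_interlaced_increasing:
  assumes "0 < c" "u < v" "v < c * u"
  shows "rec_seq u v 0 c i < rec_seq u v 0 c (Suc i)"
proof (cases "even i")
  case True
  then obtain t where "i = 2 * t" by blast
  then show ?thesis using assms by (simp add: rec_seq_interlaced)
next
  case False
  then obtain t where t: "i = Suc (2 * t)" using oddE by fastforce
  have "rec_seq u v 0 c (Suc i) = c ^ t * (c * u)"
    using rec_seq_interlaced(1)[of u v c "Suc t"] t by (simp add: mult_ac)
  then show ?thesis using assms t by (simp add: rec_seq_interlaced)
qed

lemma image_rec_seq_interlaced:
  "rec_seq u v 0 c ` {..<m} = {c ^ t * u | t. 2 * t < m} \<union> {c ^ t * v | t. Suc (2 * t) < m}"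
  (is "?L = ?R")
proof
  show "?L \<subseteq> ?R"
  proof
    fix x assume "x \<in> ?L"
    then obtain i where i: "i < m" "x = rec_seq u v 0 c i" by blast
    show "x \<in> ?R"
    proof (cases "even i")
      case True
      then obtain t where "i = 2 * t" by blast
      then show ?thesis using i by (auto simp: rec_seq_interlaced)
    next
      case False
      then obtain t where "i = Suc (2 * t)" using oddE by fastforce
      then show ?thesis using i by (auto simp: rec_seq_interlaced)
    qed
  qed
  show "?R \<subseteq> ?L" using rec_seq_interlaced[of u v c] by (force intro: rev_image_eqI)
qed

lemma satisfies_U_interlaced:
  assumes "A = {c ^ t * u | t. 2 * t < m} \<union> {c ^ t * v | t. Suc (2 * t) < m}"
    and "0 < c" "u < v" "v < c * u"
  shows "satisfies_U A u v 0 c" "sorted_list_of_set A = map (rec_seq u v 0 c) [0..<m]"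
proof -
  have A: "A = rec_seq u v 0 c ` {..<m}" using assms(1) image_rec_seq_interlaced by simp
  show "satisfies_U A u v 0 c"
    by (rule satisfies_U_of_increasing[OF A]) (auto intro: rec_seq_interlaced_increasing assms)
  show "sorted_list_of_set A = map (rec_seq u v 0 c) [0..<m]" unfolding A
    by (rule sorted_list_of_increasing) (auto intro: rec_seq_interlaced_increasing assms)
qed

lemma satisfies_U_powers:
  assumes "p > 1"
  shows "satisfies_U {p ^ i | i. 1 \<le> i \<and> i \<le> k} p (p\<^sup>2) p 0"
proof (rule satisfies_U_of_increasing[where Y = "\<lambda>i. p ^ Suc i" and m = k])
  show "{p ^ i | i. 1 \<le> i \<and> i \<le> k} = (\<lambda>i. p ^ Suc i) ` {..<k}"
  proof (intro equalityI subsetI)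
    fix x assume "x \<in> {p ^ i | i. 1 \<le> i \<and> i \<le> k}"
    then obtain i where "x = p ^ i" "1 \<le> i" "i \<le> k" by blast
    then show "x \<in> (\<lambda>i. p ^ Suc i) ` {..<k}" by (intro image_eqI[of _ _ "i - 1"]) auto
  qed (auto intro: exI[of _ "Suc _"] simp del: power_Suc)
  show "p ^ Suc i = rec_seq p (p\<^sup>2) p 0 i" for i
    using rec_seq_geometric[of p p i] by (simp add: power2_eq_square mult.commute)
qed (use assms in auto)

lemma small_divisors_prime_power:
  fixes p :: int
  assumes p: "prime p"
  shows "small_divisors (p ^ k) = {p ^ i | i. 1 \<le> i \<and> i \<le> (k - 1) div 2}" (is "?L = ?R")
proof -
  note p1 = prime_gt_1_int[OF p]
  have *: "p ^ i * p ^ i < p ^ k \<longleftrightarrow> i + i < k" for i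
    using p1 by (simp add: power_add [symmetric])
  show ?thesis
  proof
    show "?L \<subseteq> ?R"
    proof
      fix d assume "d \<in> ?L"
      then have d: "1 < d" "d * d < p ^ k" "d dvd p ^ k * 1" by (auto simp: small_divisors_iff)
      obtain i e where i: "i \<le> k" "0 < e" "e dvd 1" "d = p ^ i * e"
        using dvd_prime_power_mult_cases[OF p d(3)] d(1) by auto
      then have "d = p ^ i" by simp
      with d(1,2) *[of i] have "i + i < k" "i \<noteq> 0" by (auto intro!: gr0I)
      then have "1 \<le> i \<and> i \<le> (k - 1) div 2" by auto
      then show "d \<in> ?R" using \<open>d = p ^ i\<close> by blast
    qed
    show "?R \<subseteq> ?L"
    proof
      fix d assume "d \<in> ?R"
      then obtain i where i: "1 \<le> i" "i \<le> (k - 1) div 2" "d = p ^ i" by blast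
      then have "i + i < k" by auto
      then show "d \<in> ?L" using p1 *[of i] i by (simp add: small_divisors_iff le_imp_power_dvd)
    qed
  qed
qed

text \<open>Since \<open>p < q < p^2\<close>, the square root of \<open>p^k * q\<close> lies
  strictly between \<open>p^((k+1)/2)\<close> and \<open>p^((k+2)/2)\<close>. Both size conditions
  thus become conditions on exponents, wherever \<open>q\<close> lies in its interval.\<close>

lemma small_divisors_form4:
  fixes p q :: int
  assumes p: "prime p" and q: "prime q" and pq: "p < q" "q < p\<^sup>2"
  shows "small_divisors (p ^ k * q) = {p ^ t * p | t. 2 * t < k} \<union> {p ^ t * q | t. Suc (2 * t) < k}"
    (is "?L = ?R")
proof
  note p1 = prime_gt_1_int[OF p] and q1 = prime_gt_1_int[OF q]
  show "?L \<subseteq> ?R"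
  proof
    fix d assume "d \<in> ?L"
    then have d: "1 < d" "d * d < p ^ k * q" "d dvd p ^ k * q" by (auto simp: small_divisors_iff)
    obtain i e where i: "i \<le> k" "0 < e" "e dvd q" "d = p ^ i * e"
      using dvd_prime_power_mult_cases[OF p d(3)] d(1) q1 by auto
    consider "e = 1" | "e = q" using dvd_prime_cases[OF q i(3,2)] by blast
    then show "d \<in> ?R"
    proof cases
      case 1
      then obtain t where t: "i = Suc t" using d i by (cases i) auto
      have "p ^ (i + i) < p ^ k * q" using d(2) i 1 by (simp add: power_add)
      also have "\<dots> < p ^ k * p\<^sup>2" using pq p1 by simp
      finally have "p ^ (i + i) < p ^ k * p\<^sup>2" .
      then have "p ^ (i + i) < p ^ (k + 2)" by (simp only: power_add)
      then have "2 * t < k" using p1 t by simp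
      then show ?thesis using 1 i t by auto
    next
      case 2
      have "p ^ i * p ^ i * p < p ^ i * p ^ i * q" using p1 pq by simp
      also have "\<dots> < p ^ k" using d(2) i 2 q1 by (simp add: mult_ac)
      finally have "p ^ Suc (i + i) < p ^ k" by (simp add: power_add mult_ac)
      then have "Suc (2 * i) < k" using p1 by (simp only: prime_power_cmp[OF p])
      then show ?thesis using 2 i by auto
    qed
  qed
  show "?R \<subseteq> ?L"
  proof
    fix d assume "d \<in> ?R"
    then consider t where "2 * t < k" "d = p ^ Suc t" | t where "Suc (2 * t) < k" "d = p ^ t * q"
      by (auto simp: mult.commute)
    then show "d \<in> ?L"
    proof cases
      case 1
      have "p ^ Suc t * p ^ Suc t = p ^ (Suc t + Suc t)" by (simp only: power_add)
      also have "\<dots> \<le> p ^ Suc k" using 1 p1 by (intro power_increasing) auto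
      also have "\<dots> < p ^ k * q" using pq p1 by (simp add: mult.commute)
      finally have "d * d < p ^ k * q" using 1 by simp
      moreover have "d dvd p ^ k" using 1 by (auto intro: le_imp_power_dvd simp del: power_Suc)
      moreover have "1 < d" using 1 p1 by (simp only: one_less_power)
      ultimately show ?thesis by (simp add: small_divisors_iff)
    next
      case 2
      have "p ^ t * p ^ t * q < p ^ t * p ^ t * p\<^sup>2" using pq p1 by simp
      also have "\<dots> = p ^ (t + t + 2)" by (simp only: power_add)
      also have "\<dots> \<le> p ^ k" using 2 p1 by (intro power_increasing) auto
      finally have "p ^ t * p ^ t * q * q < p ^ k * q" using q1 by simp
      then have "d * d < p ^ k * q" using 2 by (simp add: mult_ac)
      moreover have "d dvd p ^ k * q" using 2 by (auto intro!: mult_dvd_mono le_imp_power_dvd)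
      moreover have "1 < d"
        using 2 p1 q1 mult_right_mono[of 1 "p ^ t" q] one_le_power[of p t] by linarith
      ultimately show ?thesis by (simp add: small_divisors_iff)
    qed
  qed
qed

text \<open>The square root of \<open>p * q^k\<close> lies strictly between \<open>q^(k/2)\<close>
  and \<open>q^((k+1)/2)\<close>, so again exponents decide.\<close>

lemma small_divisors_form5:
  fixes p q :: int
  assumes p: "prime p" and q: "prime q" and pq: "p < q"
  shows "small_divisors (p * q ^ k) = {q ^ t * p | t. 2 * t < k} \<union> {q ^ t * q | t. Suc (2 * t) < k}"
    (is "?L = ?R")
proof
  note p1 = prime_gt_1_int[OF p] and q1 = prime_gt_1_int[OF q]
  show "?L \<subseteq> ?R"
  proof
    fix d assume "d \<in> ?L"
    then have d: "1 < d" "d * d < p * q ^ k" "d dvd q ^ k * p"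
      by (auto simp: small_divisors_iff mult.commute)
    obtain i e where i: "i \<le> k" "0 < e" "e dvd p" "d = q ^ i * e"
      using dvd_prime_power_mult_cases[OF q d(3)] d(1) p1 by auto
    consider "e = 1" | "e = p" using dvd_prime_cases[OF p i(3,2)] by blast
    then show "d \<in> ?R"
    proof cases
      case 1
      then obtain t where t: "i = Suc t" using d i by (cases i) auto
      have "q ^ (i + i) < p * q ^ k" using d(2) i 1 by (simp add: power_add)
      also have "\<dots> < q ^ Suc k" using pq q1 by simp
      finally have "i + i < Suc k" using q1 by (simp only: prime_power_cmp[OF q])
      then have "Suc (2 * t) < k" using t by simp
      then show ?thesis using 1 i t by auto
    next
      case 2
      have "q ^ (i + i) * 1 < q ^ (i + i) * p" using p1 q1 by simp
      also have "\<dots> < q ^ k" using d(2) i 2 p1 by (simp add: mult_ac power_add)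
      finally have "i + i < k" using q1 by (simp add: prime_power_cmp[OF q])
      then show ?thesis using 2 i by auto
    qed
  qed
  show "?R \<subseteq> ?L"
  proof
    fix d assume "d \<in> ?R"
    then consider t where "2 * t < k" "d = q ^ t * p" | t where "Suc (2 * t) < k" "d = q ^ Suc t"
      by (auto simp: mult.commute)
    then show "d \<in> ?L"
    proof cases
      case 1
      have "q ^ t * q ^ t * p < q ^ t * q ^ t * q" using pq q1 by simp
      also have "\<dots> = q ^ Suc (t + t)" by (simp add: power_add)
      also have "\<dots> \<le> q ^ k" using 1 q1 by (intro power_increasing) auto
      finally have "q ^ t * q ^ t * p * p < q ^ k * p" using p1 by simp
      then have "d * d < p * q ^ k" using 1 by (simp add: mult_ac)
      moreover have "d dvd p * q ^ k"
        using 1 by (subst mult.commute) (auto intro!: mult_dvd_mono le_imp_power_dvd)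
      moreover have "1 < d"
        using 1 p1 q1 mult_right_mono[of 1 "q ^ t" p] one_le_power[of q t] by linarith
      ultimately show ?thesis by (simp add: small_divisors_iff)
    next
      case 2
      have "q ^ Suc t * q ^ Suc t = q ^ (Suc t + Suc t)" by (simp only: power_add)
      also have "\<dots> \<le> q ^ k" using 2 q1 by (intro power_increasing) auto
      also have "\<dots> < p * q ^ k" using p1 q1 by simp
      finally have "d * d < p * q ^ k" using 2 by simp
      moreover have "d dvd p * q ^ k"
        using 2 by (auto intro!: dvd_mult le_imp_power_dvd simp del: power_Suc)
      moreover have "1 < d" using 2 q1 by (simp only: one_less_power)
      ultimately show ?thesis by (simp add: small_divisors_iff)
    qed
  qed
qed

lemma square_less_square_iff: "0 \<le> x \<Longrightarrow> 0 \<le> y \<Longrightarrow> x * x < y * y \<longleftrightarrow> x < (y :: int)"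
  using power_mono_iff[of y x 2] by (simp add: power2_eq_square not_le [symmetric])

text \<open>A divisor below the square root of \<open>M * r\<close> is below \<open>r\<close>, hence
  coprime to the prime \<open>r\<close>. Conversely, \<open>d \<le> M < r\<close> gives
  \<open>d * d < M * r\<close>.\<close>

lemma small_divisors_mult_large_prime:
  fixes M r :: int
  assumes r: "prime r" and M: "0 < M" "M < r"
  shows "small_divisors (M * r) = {d. 1 < d \<and> d dvd M}" (is "?L = ?R")
proof
  note r1 = prime_gt_1_int[OF r]
  show "?L \<subseteq> ?R"
  proof
    fix d assume "d \<in> ?L"
    then have d: "1 < d" "d * d < M * r" "d dvd M * r" by (auto simp: small_divisors_iff)
    have "M * r < r * r" using M r1 by simp
    with d(2) have "d * d < r * r" by linarith
    then have "d < r" using d(1) r1 square_less_square_iff[of d r] by auto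
    then have "\<not> r dvd d" using d(1) zdvd_imp_le[of r d] by linarith
    then have "coprime d r" using r prime_imp_coprime coprime_commute by blast
    then have "d dvd M" using d(3) coprime_dvd_mult_left_iff by blast
    then show "d \<in> ?R" using d by simp
  qed
  show "?R \<subseteq> ?L"
  proof
    fix d assume "d \<in> ?R"
    then have d: "1 < d" "d dvd M" by auto
    then have "d \<le> M" using M zdvd_imp_le by blast
    then have "d * d < M * r" using d M by (intro mult_le_less_imp_less) auto
    then show "d \<in> ?L" using d by (simp add: small_divisors_iff)
  qed
qed

lemma small_divisors_prime_power_mult_large_prime:
  fixes p q :: int
  assumes p: "prime p" and q: "prime q" and qp: "q > p ^ k"
  shows "small_divisors (p ^ k * q) = {p ^ i | i. 1 \<le> i \<and> i \<le> k}"
proof -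
  note p1 = prime_gt_1_int[OF p]
  have "small_divisors (p ^ k * q) = {d. 1 < d \<and> d dvd p ^ k}"
    using p1 qp by (intro small_divisors_mult_large_prime[OF q]) auto
  also have "\<dots> = {p ^ i | i. 1 \<le> i \<and> i \<le> k}"
  proof (intro equalityI subsetI)
    fix d assume "d \<in> {d. 1 < d \<and> d dvd p ^ k}"
    then have d: "1 < d" "d dvd p ^ k * 1" by auto
    obtain i e where i: "i \<le> k" "0 < e" "e dvd 1" "d = p ^ i * e"
      using dvd_prime_power_mult_cases[OF p d(2)] d(1) by auto
    then have "d = p ^ i" by simp
    moreover have "1 \<le> i" using d calculation by (cases i) auto
    ultimately show "d \<in> {p ^ i | i. 1 \<le> i \<and> i \<le> k}" using i(1) by blast
  qed (use p1 in \<open>auto intro: le_imp_power_dvd\<close>)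
  finally show ?thesis .
qed

lemma dvd_prime_power_mult_prime_power_cases:
  fixes p q :: int
  assumes "prime p" "prime q" "d dvd p ^ k * q ^ l" "0 < d"
  obtains i j where "i \<le> k" "j \<le> l" "d = p ^ i * q ^ j"
proof -
  have q0: "0 < q ^ l" using prime_gt_0_int[OF assms(2)] by simp
  obtain i e where i: "i \<le> k" "0 < e" "e dvd q ^ l" "d = p ^ i * e"
    using dvd_prime_power_mult_cases[OF assms(1,3,4) q0] by blast
  have "e dvd q ^ l * 1" using i by simp
  then obtain j f where j: "j \<le> l" "0 < f" "f dvd 1" "e = q ^ j * f"
    using dvd_prime_power_mult_cases[OF assms(2) _ i(2), of l 1] by auto
  then show thesis using i that[of i j] by simp
qed

lemma small_divisors_form6:
  fixes p q r :: int
  assumes "prime p" "prime q" "prime r" "r > p * q ^ k"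
  shows "small_divisors (p * q ^ k * r) =
    {q ^ i | i. 1 \<le> i \<and> i \<le> k} \<union> {p * q ^ i | i. i \<le> k}"
proof -
  note p1 = prime_gt_1_int[OF assms(1)] and q1 = prime_gt_1_int[OF assms(2)]
  have "small_divisors (p * q ^ k * r) = {d. 1 < d \<and> d dvd p * q ^ k}"
    using assms(4) p1 q1 by (intro small_divisors_mult_large_prime[OF assms(3)]) auto
  also have "\<dots> = {q ^ i | i. 1 \<le> i \<and> i \<le> k} \<union> {p * q ^ i | i. i \<le> k}"
  proof (intro equalityI subsetI)
    fix d assume "d \<in> {d. 1 < d \<and> d dvd p * q ^ k}"
    then have d: "1 < d" "d dvd p ^ 1 * q ^ k" by auto
    obtain i j where ij: "i \<le> 1" "j \<le> k" "d = p ^ i * q ^ j"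
      using dvd_prime_power_mult_prime_power_cases[OF assms(1,2) d(2)] d(1) by auto
    then consider "d = q ^ j" | "d = p * q ^ j" by (cases i) auto
    then show "d \<in> {q ^ i | i. 1 \<le> i \<and> i \<le> k} \<union> {p * q ^ i | i. i \<le> k}"
    proof cases
      case 1
      then have "1 \<le> j" using d by (cases j) auto
      then show ?thesis using 1 ij by blast
    qed (use ij in blast)
  next
    fix d assume "d \<in> {q ^ i | i. 1 \<le> i \<and> i \<le> k} \<union> {p * q ^ i | i. i \<le> k}"
    then consider i where "1 \<le> i" "i \<le> k" "d = q ^ i" | i where "i \<le> k" "d = p * q ^ i"
      by blast
    then show "d \<in> {d. 1 < d \<and> d dvd p * q ^ k}"
    proof cases
      case 1
      then show ?thesis using q1 by (auto intro: le_imp_power_dvd dvd_mult)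
    next
      case (2 i)
      have "1 < p * q ^ i" using p1 q1 mult_left_mono[of 1 "q ^ i" p] one_le_power[of q i] by linarith
      then show ?thesis using 2 by (auto intro!: mult_dvd_mono le_imp_power_dvd)
    qed
  qed
  finally show ?thesis .
qed

lemma satisfies_U_form6:
  fixes p q r :: int
  assumes "prime p" "prime q" "prime r" "r > p * q ^ k" "p < q"
  shows "satisfies_U (small_divisors (p * q ^ k * r)) p q 0 q"
proof (rule satisfies_U_interlaced(1))
  \<comment> \<open>The bound \<open>2 * k + 1\<close> is the number of divisors of
    \<open>p * q^k\<close> other than 1.\<close>
  show "small_divisors (p * q ^ k * r) =
    {q ^ t * p | t. 2 * t < 2 * k + 1} \<union> {q ^ t * q | t. Suc (2 * t) < 2 * k + 1}"
    unfolding small_divisors_form6[OF assms(1-4)]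
  proof (intro equalityI subsetI)
    fix d assume "d \<in> {q ^ i | i. 1 \<le> i \<and> i \<le> k} \<union> {p * q ^ i | i. i \<le> k}"
    then consider i where "1 \<le> i" "i \<le> k" "d = q ^ i" | i where "i \<le> k" "d = p * q ^ i"
      by blast
    then show "d \<in> {q ^ t * p | t. 2 * t < 2 * k + 1} \<union> {q ^ t * q | t. Suc (2 * t) < 2 * k + 1}"
    proof cases
      case (1 i)
      then obtain t where "i = Suc t" by (cases i) auto
      then have "d = q ^ t * q" "Suc (2 * t) < 2 * k + 1" using 1 by auto
      then show ?thesis by blast
    next
      case (2 i)
      then have "d = q ^ i * p" "2 * i < 2 * k + 1" by auto
      then show ?thesis by blast
    qed
  next
    fix d assume "d \<in> {q ^ t * p | t. 2 * t < 2 * k + 1} \<union> {q ^ t * q | t. Suc (2 * t) < 2 * k + 1}"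
    then consider t where "2 * t < 2 * k + 1" "d = p * q ^ t"
      | t where "Suc (2 * t) < 2 * k + 1" "d = q ^ Suc t" by (auto simp: mult.commute)
    then show "d \<in> {q ^ i | i. 1 \<le> i \<and> i \<le> k} \<union> {p * q ^ i | i. i \<le> k}"
    proof cases
      case (1 t)
      then show ?thesis by auto
    next
      case (2 t)
      then have "1 \<le> Suc t" "Suc t \<le> k" by auto
      then show ?thesis using 2 by blast
    qed
  qed
qed (use assms prime_gt_1_int[of p] prime_gt_1_int[of q] in auto)

lemma satisfies_U_form4:
  fixes p q :: int
  assumes "prime p" "prime q" "p < q" "q < p\<^sup>2"
  shows "satisfies_U (small_divisors (p ^ k * q)) p q 0 p"
    and "sorted_list_of_set (small_divisors (p ^ k * q)) = map (rec_seq p q 0 p) [0..<k]"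
  using satisfies_U_interlaced[OF small_divisors_form4[OF assms]]
    assms prime_gt_1_int[of p] by (auto simp: power2_eq_square)

lemma satisfies_U_form5:
  fixes p q :: int
  assumes "prime p" "prime q" "p < q"
  shows "satisfies_U (small_divisors (p * q ^ k)) p q 0 q"
    and "sorted_list_of_set (small_divisors (p * q ^ k)) = map (rec_seq p q 0 q) [0..<k]"
  using satisfies_U_interlaced[OF small_divisors_form5[OF assms]]
    assms prime_gt_1_int[of p] prime_gt_1_int[of q] by auto

lemma take_4_rec_seq:
  "4 \<le> k \<Longrightarrow> take 4 (map (rec_seq u v a b) [0..<k]) =
    [u, v, a * v + b * u, a * (a * v + b * u) + b * v]"
proof -
  assume "4 \<le> k"
  then have "take 4 (map (rec_seq u v a b) [0..<k]) = map (rec_seq u v a b) [0..<4]"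
    by (simp add: take_map)
  also have "[0..<4] = [0, Suc 0, Suc (Suc 0), Suc (Suc (Suc 0))]"
    by (simp add: upt_rec numeral_eq_Suc)
  finally show ?thesis by simp
qed

lemma small_divisors_form7:
  fixes p q :: int
  assumes p: "prime p" and q: "prime q" and pq: "p < q" "q < p\<^sup>2"
  shows "small_divisors (p\<^sup>2 * q\<^sup>2) = {p, q, p\<^sup>2}"
proof -
  note p1 = prime_gt_1_int[OF p] and q1 = prime_gt_1_int[OF q]
  have *: "d * d < p\<^sup>2 * q\<^sup>2 \<longleftrightarrow> d < p * q" if "1 < d" for d
    using square_less_square_iff[of d "p * q"] that p1 q1 by (simp add: power2_eq_square mult_ac)
  show ?thesis
  proof (intro equalityI subsetI)
    fix d assume "d \<in> small_divisors (p\<^sup>2 * q\<^sup>2)"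
    then have d: "1 < d" "d < p * q" "d dvd p ^ 2 * q ^ 2" by (auto simp: small_divisors_iff *)
    obtain i j where ij: "i \<le> 2" "j \<le> 2" "d = p ^ i * q ^ j"
      using dvd_prime_power_mult_prime_power_cases[OF p q d(3)] d(1) by auto
    have "\<not> (1 \<le> i \<and> 1 \<le> j)"
    proof
      assume "1 \<le> i \<and> 1 \<le> j"
      then have "p * q \<le> p ^ i * q ^ j"
        using p1 q1 self_le_power[of p i] self_le_power[of q j] by (intro mult_mono) auto
      then show False using d ij by simp
    qed
    moreover have "j \<noteq> 2"
    proof
      assume "j = 2"
      then have "i = 0" using calculation by auto
      then show False using \<open>j = 2\<close> d ij pq q1 by (simp add: power2_eq_square)
    qed
    ultimately have "i = 0 \<and> j = 0 \<or> i = 0 \<and> j = 1 \<or> i = 1 \<and> j = 0 \<or> i = 2 \<and> j = 0"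
      using ij by linarith
    then show "d \<in> {p, q, p\<^sup>2}" using d ij by auto
  next
    have "p < p * q" "q < p * q" "p * p < p * q" using p1 q1 pq by auto
    fix d assume "d \<in> {p, q, p\<^sup>2}"
    then have "1 < d" "d < p * q" "d dvd p\<^sup>2 * q\<^sup>2"
      using \<open>p < p * q\<close> \<open>q < p * q\<close> \<open>p * p < p * q\<close> p1 q1
      by (auto simp: power2_eq_square less_1_mult)
    then show "d \<in> small_divisors (p\<^sup>2 * q\<^sup>2)" by (simp add: small_divisors_iff *)
  qed
qed

lemma small_divisors_form8:
  fixes p q r :: int
  assumes p: "prime p" and q: "prime q" and r: "prime r" and pqr: "p < q" "q < r" "r < p * q"
  shows "small_divisors (p * q * r) = {p, q, r}"
proof -
  note p1 = prime_gt_1_int[OF p] and q1 = prime_gt_1_int[OF q] and r1 = prime_gt_1_int[OF r]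
  show ?thesis
  proof (intro equalityI subsetI)
    fix d assume "d \<in> small_divisors (p * q * r)"
    then have d: "1 < d" "d * d < p * q * r" "d dvd p ^ 1 * (q * r)"
      by (auto simp: small_divisors_iff mult.assoc)
    obtain i e where e: "i \<le> 1" "0 < e" "e dvd q ^ 1 * r" "d = p ^ i * e"
      using dvd_prime_power_mult_cases[OF p d(3)] d(1) q1 r1 by auto
    obtain j f where f: "j \<le> 1" "0 < f" "f dvd r" "e = q ^ j * f"
      using dvd_prime_power_mult_cases[OF q e(3,2)] r1 by auto
    have "d \<noteq> p * q"
    proof
      assume "d = p * q"
      then have "p * q < r" using d(2) p1 q1 by simp
      then show False using pqr by simp
    qed
    moreover have "d \<noteq> p * r"
    proof
      assume "d = p * r"
      then have "(p * r) * (p * r) < (p * r) * q" using d(2) by (simp add: mult_ac)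
      then have "p * r < q" using p1 r1 by simp
      moreover have "1 * r \<le> p * r" using p1 r1 by (intro mult_right_mono) auto
      ultimately show False using pqr by simp
    qed
    moreover have "d \<noteq> q * r"
    proof
      assume "d = q * r"
      then have "(q * r) * (q * r) < (q * r) * p" using d(2) by (simp add: mult_ac)
      then have "q * r < p" using q1 r1 by simp
      moreover have "1 * r \<le> q * r" using q1 r1 by (intro mult_right_mono) auto
      ultimately show False using pqr by simp
    qed
    moreover have "d \<noteq> p * q * r"
    proof
      assume "d = p * q * r"
      moreover have "d * 1 < d * d" using d(1) by (intro mult_strict_left_mono) auto
      ultimately show False using d(2) by simp
    qed
    moreover have "f = 1 \<or> f = r" using dvd_prime_cases[OF r f(3,2)] .
    moreover have "i = 0 \<or> i = 1" "j = 0 \<or> j = 1" using e f by auto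
    ultimately show "d \<in> {p, q, r}" using d e f by (auto simp: mult_ac)
  next
    have "p * p < p * q * r" "q * q < p * q * r" "r * r < p * q * r"
    proof -
      have "p * p < p * (q * r)" using p1 q1 r1 pqr mult_strict_mono[of 1 q p r] by simp
      then show "p * p < p * q * r" by (simp add: mult_ac)
      have "q * q < q * (p * r)" using p1 q1 r1 pqr mult_strict_mono[of 1 p q r] by simp
      then show "q * q < p * q * r" by (simp add: mult_ac)
      show "r * r < p * q * r" using pqr r1 by simp
    qed
    then show "d \<in> small_divisors (p * q * r)" if "d \<in> {p, q, r}" for d
      using that p1 q1 r1 by (auto simp: small_divisors_iff)
  qed
qed

lemma small_divisors_form8_large:
  fixes p q r :: int
  assumes p: "prime p" and q: "prime q" and r: "prime r" and pqr: "r > p * q"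
  shows "small_divisors (p * q * r) = {p, q, p * q}"
proof -
  have "small_divisors (p * q ^ 1 * r) =
    {q ^ i | i. 1 \<le> i \<and> i \<le> 1} \<union> {p * q ^ i | i. i \<le> 1}"
    using assms by (intro small_divisors_form6) auto
  moreover have "{q ^ i | i. 1 \<le> i \<and> i \<le> (1::nat)} = {q}"
    by (auto intro: exI[of _ 1])
  moreover have "{p * q ^ i | i. i \<le> (1::nat)} = {p, p * q}"
    by (auto simp: le_Suc_eq intro: exI[of _ 0] exI[of _ 1])
  ultimately show ?thesis by auto
qed

text \<open>Because \<open>p^3 < q^2\<close>, the largest small divisor is \<open>p^3\<close>. Every
  divisor outside the list is 1 or a multiple of \<open>p^2 * q\<close> or \<open>q^2\<close>, and
  both of these have squares at least \<open>N\<close>.\<close>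

lemma small_divisors_form9:
  fixes p q :: int
  assumes p: "prime p" and q: "prime q" and pq: "p < q" "q < p\<^sup>2" "p ^ 3 < q\<^sup>2"
  shows "small_divisors (p ^ 3 * q\<^sup>2) = {p, q, p\<^sup>2, p * q, p ^ 3}"
proof -
  note p1 = prime_gt_1_int[OF p] and q1 = prime_gt_1_int[OF q]
  have pow: "p ^ i < p ^ j" if "i < j" for i j using that p1 by simp
  have sq: "(p ^ i * q ^ j) * (p ^ i * q ^ j) < p ^ 3 * q\<^sup>2 \<longleftrightarrow> p ^ (2 * i) * q ^ (2 * j) < p ^ 3 * q\<^sup>2" for i j
    by (simp add: power_mult power2_eq_square power_mult_distrib mult_ac)
  show ?thesis
  proof (intro equalityI subsetI)
    fix d assume "d \<in> small_divisors (p ^ 3 * q\<^sup>2)"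
    then have d: "1 < d" "d * d < p ^ 3 * q\<^sup>2" "d dvd p ^ 3 * q ^ 2"
      by (auto simp: small_divisors_iff)
    obtain i j where ij: "i \<le> 3" "j \<le> 2" "d = p ^ i * q ^ j"
      using dvd_prime_power_mult_prime_power_cases[OF p q d(3)] d(1) by auto
    have le: "p ^ i' * q ^ j' \<le> d" if "i' \<le> i" "j' \<le> j" for i' j'
      unfolding ij using that p1 q1 by (intro mult_mono power_increasing) auto
    have big: "p ^ 3 * q\<^sup>2 \<le> p\<^sup>2 * q * (p\<^sup>2 * q)" "p ^ 3 * q\<^sup>2 \<le> q\<^sup>2 * q\<^sup>2"
      using pq p1 q1 power_increasing[of 3 4 p]
      by (auto simp: power2_eq_square power3_eq_cube power4_eq_xxxx mult_ac)
    have "\<not> (2 \<le> i \<and> 1 \<le> j)"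
    proof
      assume "2 \<le> i \<and> 1 \<le> j"
      then have "p\<^sup>2 * q ^ 1 \<le> d" by (intro le) auto
      then have "p\<^sup>2 * q * (p\<^sup>2 * q) \<le> d * d" using p1 q1 d(1) by (intro mult_mono) auto
      then show False using d big by linarith
    qed
    moreover have "j \<noteq> 2"
    proof
      assume "j = 2"
      then have "p ^ 0 * q\<^sup>2 \<le> d" by (intro le) auto
      then have "q\<^sup>2 * q\<^sup>2 \<le> d * d" using q1 d(1) by (intro mult_mono) auto
      then show False using d big by linarith
    qed
    moreover have "i = 0 \<or> i = 1 \<or> i = 2 \<or> i = 3" "j = 0 \<or> j = 1 \<or> j = 2" using ij by auto
    ultimately show "d \<in> {p, q, p\<^sup>2, p * q, p ^ 3}" using d ij by auto
  next
    fix d assume d: "d \<in> {p, q, p\<^sup>2, p * q, p ^ 3}"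
    have "p ^ 3 * p ^ 3 < p ^ 3 * q\<^sup>2" using pq p1 by (intro mult_strict_left_mono) auto
    have c: "p * q < p ^ 3"
      using pq p1 by (simp add: power3_eq_cube power2_eq_square)
    have "p < p * q" "q < p * q" "p * p < p * q" "1 < p * p"
      using p1 q1 pq by (auto intro: less_1_mult)
    with c p1 q1 have "1 < p * p" "1 < p * q" "1 < p ^ 3" "p < p ^ 3" "q < p ^ 3" "p * p < p ^ 3"
      by linarith+
    with c p1 q1 d have *: "1 < d" "d \<le> p ^ 3" unfolding power2_eq_square
      by (metis insertE less_imp_le order_refl singletonD)+
    then have "d * d \<le> p ^ 3 * p ^ 3" using p1 by (intro mult_mono) auto
    then have "d * d < p ^ 3 * q\<^sup>2" using \<open>p ^ 3 * p ^ 3 < p ^ 3 * q\<^sup>2\<close> by linarith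
    moreover have "d dvd p ^ 3 * q\<^sup>2"
      using \<open>d \<in> {p, q, p\<^sup>2, p * q, p ^ 3}\<close> by (auto simp: power2_eq_square power3_eq_cube)
    ultimately show "d \<in> small_divisors (p ^ 3 * q\<^sup>2)" using * by (simp add: small_divisors_iff)
  qed
qed

text \<open>The numbers \<open>p * r\<close>, \<open>q * r\<close> and \<open>p^2 * q\<close> are
  too large, and every divisor outside the list is 1 or a multiple of one of them.\<close>

lemma small_divisors_form10:
  fixes p q r :: int
  assumes p: "prime p" and q: "prime q" and r: "prime r"
    and pqr: "p < q" "q < p\<^sup>2" "p\<^sup>2 < r" "r < p * q"
  shows "small_divisors (p\<^sup>2 * q * r) = {p, q, p\<^sup>2, r, p * q}"
proof -
  note p1 = prime_gt_1_int[OF p] and q1 = prime_gt_1_int[OF q] and r1 = prime_gt_1_int[OF r]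
  show ?thesis
  proof (intro equalityI subsetI)
    fix d assume "d \<in> small_divisors (p\<^sup>2 * q * r)"
    then have d: "1 < d" "d * d < p\<^sup>2 * q * r" "d dvd p ^ 2 * (q * r)"
      by (auto simp: small_divisors_iff mult.assoc)
    obtain i e where e: "i \<le> 2" "0 < e" "e dvd q ^ 1 * r" "d = p ^ i * e"
      using dvd_prime_power_mult_cases[OF p d(3)] d(1) q1 r1 by auto
    obtain j f where f: "j \<le> 1" "0 < f" "f dvd r" "e = q ^ j * f"
      using dvd_prime_power_mult_cases[OF q e(3,2)] r1 by auto
    have small: "d < c" if "p\<^sup>2 * q * r \<le> c * c" "0 < c" for c
      using that d square_less_square_iff[of d c] by linarith
    have "p * q \<le> p * r" using pqr p1 by simp
    then have "p * (p * q) * r \<le> p * (p * r) * r" using p1 r1 by simp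
    then have 1: "d < p * r"
      using p1 r1 by (intro small) (auto simp: power2_eq_square mult_ac)
    have "r * (p * p * q) \<le> p * p * q * (p * p * q)"
    proof (intro mult_right_mono)
      have "p * q * 1 \<le> p * q * p" using p1 q1 by (intro mult_left_mono) auto
      then show "r \<le> p * p * q" using pqr by (simp add: mult_ac)
    qed (use p1 q1 in auto)
    then have 2: "d < p\<^sup>2 * q"
      using p1 q1 by (intro small) (auto simp: power2_eq_square mult_ac)
    have 3: "p * r < q * r" using pqr r1 by simp
    have le: "p ^ i' * (q ^ j' * f) \<le> d" if "i' \<le> i" "j' \<le> j" for i' j'
      unfolding e f using that p1 q1 f(2) by (intro mult_mono power_increasing) auto
    have "f = 1 \<or> f = r" using dvd_prime_cases[OF r f(3,2)] .
    moreover have "\<not> (1 \<le> i \<and> f = r)" using le[of 1 0] 1 by auto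
    moreover have "\<not> (1 \<le> j \<and> f = r)" using le[of 0 1] 1 3 by auto
    moreover have "\<not> (2 \<le> i \<and> 1 \<le> j)" 
    proof
      assume "2 \<le> i \<and> 1 \<le> j"
      then have "p\<^sup>2 * (q ^ 1 * f) \<le> d" by (intro le) auto
      moreover have "p\<^sup>2 * q * 1 \<le> p\<^sup>2 * q * f" using f(2) p1 q1 by (intro mult_left_mono) auto
      ultimately show False using 2 by (simp add: mult_ac)
    qed
    moreover have "i = 0 \<or> i = 1 \<or> i = 2" "j = 0 \<or> j = 1" using e f by auto
    ultimately show "d \<in> {p, q, p\<^sup>2, r, p * q}" using d e f by auto
  next
    fix d assume d: "d \<in> {p, q, p\<^sup>2, r, p * q}"
    have "p < p * q" "q < p * q" "p * p < p * q" "1 < p * q" "1 < p * p"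
      using p1 q1 pqr by (auto intro: less_1_mult)
    then have *: "1 < d" "d \<le> p * q" using d r1 pqr p1 q1 by (auto simp: power2_eq_square)
    have "d * d \<le> p * q * (p * q)" using * by (intro mult_mono) auto
    also have "\<dots> = p\<^sup>2 * q * q" by (simp add: power2_eq_square mult_ac)
    also have "\<dots> < p\<^sup>2 * q * r" using pqr p1 q1 by simp
    finally have "d * d < p\<^sup>2 * q * r" .
    moreover have "d dvd p\<^sup>2 * q * r" using d by (auto simp: power2_eq_square mult_ac)
    ultimately show "d \<in> small_divisors (p\<^sup>2 * q * r)" using * by (simp add: small_divisors_iff)
  qed
qed

text \<open>From \<open>r < p * q\<close> the square root is positive, so the radicand is
  nonnegative and the equation may be squared.\<close>

lemma form10_equation:
  assumes "form10 N p q r"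
  shows "(r - p * q)\<^sup>2 = (q\<^sup>2 - p ^ 3) * (p\<^sup>2 - q)"
proof -
  let ?R = "(q\<^sup>2 - p ^ 3) * (p\<^sup>2 - q)"
  have s: "sqrt (real_of_int ?R) = real_of_int (p * q - r)" and r: "r < p * q"
    using assms by (auto simp: form10_def)
  have "sqrt (real_of_int ?R) > 0" unfolding s using r by (simp only: of_int_0_less_iff diff_gt_0_iff_gt)
  then have "real_of_int ?R \<ge> 0" by (simp only: real_sqrt_gt_0_iff)
  then have "real_of_int ?R = (sqrt (real_of_int ?R))\<^sup>2" by (simp only: real_sqrt_pow2)
  also have "\<dots> = real_of_int ((p * q - r)\<^sup>2)" unfolding s by simp
  finally have "?R = (p * q - r)\<^sup>2" by linarith
  then show ?thesis by (simp add: power2_commute)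
qed

text \<open>Serves to exclude boundary cases such as \<open>q = p^2\<close> and
  \<open>q^2 = p^3\<close>, so that weak inequalities become strict.\<close>

lemma distinct_prime_powers_neq:
  fixes p q :: int
  assumes "prime p" "prime q" "p \<noteq> q"
  shows "q ^ i = p ^ j \<Longrightarrow> i = 0"
proof (rule ccontr)
  assume "q ^ i = p ^ j" "i \<noteq> 0"
  then have "q dvd p ^ j" by (metis dvd_power not_gr_zero)
  then show False using assms by (metis prime_dvd_power primes_dvd_imp_eq)
qed

text \<open>The coefficients are the solution by Cramer's rule of \<open>p^2 = a q + b p\<close> and
  \<open>r = a p^2 + b q\<close>, a system with determinant \<open>q^2 - p^3\<close>. The last
  relation \<open>p q = a r + b p^2\<close> is then equivalent to the quadratic equation for
  \<open>r\<close>.\<close>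

lemma satisfies_U_form10:
  assumes f: "form10 N p q r"
  shows "satisfies_U (small_divisors N) p q
    ((p * (p * q - r)) div (q\<^sup>2 - p ^ 3)) ((r * q - p ^ 4) div (q\<^sup>2 - p ^ 3))"
proof -
  let ?D = "q\<^sup>2 - p ^ 3"
  have pqr: "prime p" "prime q" "prime r" "p < q" "q < p\<^sup>2" "p\<^sup>2 < r" "r < p * q"
    and N: "N = p\<^sup>2 * q * r" and dvd: "?D dvd p * q - r" "?D dvd r * q - p ^ 4"
    using f by (auto simp: form10_def)
  have D0: "?D \<noteq> 0" using distinct_prime_powers_neq[of p q 2 3] pqr by auto
  define a where "a = (p * (p * q - r)) div ?D"
  define b where "b = (r * q - p ^ 4) div ?D"
  have a: "?D * a = p * (p * q - r)" and b: "?D * b = r * q - p ^ 4"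
    using dvd by (simp_all add: a_def b_def)
  have "?D * (p\<^sup>2) = ?D * (a * q + b * p)"
  proof -
    have "?D * (a * q + b * p) = (?D * a) * q + (?D * b) * p" by (simp add: algebra_simps)
    also have "\<dots> = ?D * p\<^sup>2" unfolding a b by (simp add: algebra_simps power2_eq_square power3_eq_cube power4_eq_xxxx)
    finally show ?thesis ..
  qed
  then have 1: "p\<^sup>2 = a * q + b * p" using D0 by simp
  have "?D * r = ?D * (a * p\<^sup>2 + b * q)"
  proof -
    have "?D * (a * p\<^sup>2 + b * q) = (?D * a) * p\<^sup>2 + (?D * b) * q" by (simp add: algebra_simps)
    also have "\<dots> = ?D * r" unfolding a b by (simp add: algebra_simps power2_eq_square power3_eq_cube power4_eq_xxxx)
    finally show ?thesis ..
  qed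
  then have 2: "r = a * p\<^sup>2 + b * q" using D0 by simp
  \<comment> \<open>The only one of the three relations that depends on the square root condition,
    through \<open>form10_equation\<close>.\<close>
  have "?D * (p * q) = ?D * (a * r + b * p\<^sup>2)"
  proof -
    have "?D * (a * r + b * p\<^sup>2) = (?D * a) * r + (?D * b) * p\<^sup>2" by (simp add: algebra_simps)
    also have "\<dots> = p * ((p * q)\<^sup>2 - (r - p * q)\<^sup>2 - p ^ 5)"
      unfolding a b by (simp add: algebra_simps power2_eq_square eval_nat_numeral)
    also have "\<dots> = ?D * (p * q)" unfolding form10_equation[OF f]
      by (simp add: algebra_simps power2_eq_square eval_nat_numeral)
    finally show ?thesis ..
  qed
  then have 3: "p * q = a * r + b * p\<^sup>2" using D0 by simp
  show ?thesis
    unfolding N small_divisors_form10[OF pqr] a_def[symmetric] b_def[symmetric]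
    by (rule satisfies_U_insert5) (use pqr 1 2 3 in auto)
qed

lemma form9_cube_less_square:
  assumes "form9 N p q"
  shows "p ^ 3 < q\<^sup>2"
proof -
  have p: "0 < p" and q: "0 < q" using assms prime_gt_0_int by (auto simp: form9_def)
  have "real_of_int p powr 3 = (real_of_int p powr (3/2))\<^sup>2"
    using p by (simp add: power2_eq_square powr_add [symmetric])
  also have "\<dots> < (real_of_int q)\<^sup>2"
    using assms by (intro power_strict_mono) (auto simp: form9_def)
  finally have "real_of_int (p ^ 3) < real_of_int (q\<^sup>2)" using p by (simp add: powr_numeral)
  then show ?thesis by linarith
qed

lemma cube_less_square_powr:
  fixes p q :: int
  assumes "p ^ 3 < q\<^sup>2" "0 < p" "0 < q"
  shows "real_of_int p powr (3/2) < real_of_int q"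
proof (rule power2_less_imp_less)
  have "(real_of_int p powr (3/2))\<^sup>2 = real_of_int (p ^ 3)"
    using assms(2) by (simp add: power2_eq_square powr_add [symmetric] powr_numeral)
  also have "\<dots> < real_of_int (q\<^sup>2)" using assms(1) by linarith
  finally show "(real_of_int p powr (3/2))\<^sup>2 < (real_of_int q)\<^sup>2" by simp
qed (use assms in auto)

lemma form4_less_square: "form4 N p q k \<Longrightarrow> q < p\<^sup>2"
proof -
  assume f: "form4 N p q k"
  then have "0 < p" "0 < q" "sqrt (real_of_int q) < real_of_int p"
    using prime_gt_0_int by (auto simp: form4_def)
  then have "(sqrt (real_of_int q))\<^sup>2 < (real_of_int p)\<^sup>2" by (intro power_strict_mono) auto
  then have "real_of_int q < real_of_int (p\<^sup>2)" using \<open>0 < q\<close> by simp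
  then show ?thesis by linarith
qed

lemma less_square_sqrt:
  fixes p q :: int
  assumes "q < p\<^sup>2" "0 < p"
  shows "sqrt (real_of_int q) < real_of_int p"
proof (rule real_less_lsqrt)
  have "real_of_int q < real_of_int (p\<^sup>2)" using assms by linarith
  then show "real_of_int q < (real_of_int p)\<^sup>2" by simp
qed (use assms in auto)

section \<open>Every listed form is small recurrent\<close>

lemma form1_divisors:
  assumes "form1 N p k"
  shows "small_divisors N = {p ^ i | i. 1 \<le> i \<and> i \<le> (k - 1) div 2}"
    and "satisfies_U (small_divisors N) p (p\<^sup>2) p 0"
  using assms small_divisors_prime_power[of p k] satisfies_U_powers[of p "(k - 1) div 2"]
    prime_gt_1_int[of p] by (auto simp: form1_def)

lemma form3_divisors:
  assumes "form3 N p q k"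
  shows "small_divisors N = {p ^ i | i. 1 \<le> i \<and> i \<le> k}"
    and "satisfies_U (small_divisors N) p (p\<^sup>2) p 0"
  using assms small_divisors_prime_power_mult_large_prime[of p q k] satisfies_U_powers[of p k]
    prime_gt_1_int[of p] by (auto simp: form3_def)

lemma form9_divisors:
  assumes "form9 N p q"
  shows "small_divisors N = {p, q, p\<^sup>2, p * q, p ^ 3}"
    and "satisfies_U (small_divisors N) p q 0 p"
proof -
  show S: "small_divisors N = {p, q, p\<^sup>2, p * q, p ^ 3}"
    using assms small_divisors_form9[of p q] form9_cube_less_square[OF assms]
    by (auto simp: form9_def)
  show "satisfies_U (small_divisors N) p q 0 p" unfolding S
    using assms prime_gt_1_int[of p]
    by (intro satisfies_U_insert5) (auto simp: form9_def power2_eq_square power3_eq_cube)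
qed

lemma small_recurrent_form2:
  assumes "form2 N p q k"
  shows "small_recurrent N"
proof -
  have p: "prime p" and q: "prime q" and pq: "p < q" and k: "1 \<le> k" "k \<le> 3"
    using assms by (auto simp: form2_def)
  note p1 = prime_gt_1_int[OF p]
  consider "N = p * q ^ k" | "N = p ^ k * q" "k = 3 \<longrightarrow> q < p\<^sup>2 \<or> p ^ 3 < q"
    using assms by (auto simp: form2_def)
  then show ?thesis
  proof cases
    case 1
    then show ?thesis
      using satisfies_U_form5(1)[OF p q pq] small_recurrent_of_satisfies_U by blast
  next
    case 2
    \<comment> \<open>These cases are exhaustive: \<open>q = p^2\<close> is impossible, and for
      \<open>k \<le> 2\<close> the inequality \<open>q > p^2\<close> gives
      \<open>q > p^k\<close>.\<close>
    consider "q < p\<^sup>2" | "p ^ k < q"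
    proof -
      have "k = 1 \<or> k = 2 \<or> k = 3" using k by auto
      moreover have "q \<noteq> p\<^sup>2" using distinct_prime_powers_neq[of p q 1 2] p q pq by auto
      ultimately have "q < p\<^sup>2 \<or> p ^ k < q" using 2 pq by auto
      then show thesis using that by blast
    qed
    then show ?thesis
    proof cases
      case 1
      then show ?thesis
        using 2 satisfies_U_form4(1)[OF p q pq] small_recurrent_of_satisfies_U by blast
    next
      case c: 2
      have "satisfies_U (small_divisors N) p (p\<^sup>2) p 0"
        unfolding 2 small_divisors_prime_power_mult_large_prime[OF p q c]
        by (rule satisfies_U_powers[OF p1])
      then show ?thesis by (rule small_recurrent_of_satisfies_U)
    qed
  qed
qed

text \<open>Three elements impose a single equation \<open>r = a q + b p\<close>, solvable because
  \<open>p\<close> and \<open>q\<close> are coprime.\<close>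

lemma bezout_satisfies_U:
  assumes "prime p" "prime q" "p < q" "q < (r::int)"
  shows "\<exists>a b. satisfies_U {p, q, r} p q a b"
proof -
  have "coprime q p" using assms by (simp add: primes_coprime)
  then obtain x y where "x * q + y * p = 1" using bezout_int[of q p] by auto
  then have "r = (r * x) * q + (r * y) * p" by (metis distrib_left mult.assoc mult.right_neutral)
  then show ?thesis using satisfies_U_insert3 assms by blast
qed

lemma small_recurrent_form7:
  assumes "form7 N p q"
  shows "small_recurrent N"
proof -
  have "small_divisors N = {p, q, p\<^sup>2}"
    using assms small_divisors_form7 by (auto simp: form7_def)
  then show ?thesis using bezout_satisfies_U[of p q "p\<^sup>2"] assms small_recurrent_of_satisfies_U
    by (auto simp: form7_def)
qed

lemma form8_divisors:
  assumes "form8 N p q r"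
  shows "r < p * q \<Longrightarrow> small_divisors N = {p, q, r}"
    and "r > p * q \<Longrightarrow> small_divisors N = {p, q, p * q}"
  using assms small_divisors_form8 small_divisors_form8_large by (auto simp: form8_def)

lemma small_recurrent_form8:
  assumes f: "form8 N p q r"
  shows "small_recurrent N"
proof -
  have p: "prime p" and q: "prime q" and r: "prime r" and pqr: "p < q" "q < r"
    using assms by (auto simp: form8_def)
  note p1 = prime_gt_1_int[OF p] and q1 = prime_gt_1_int[OF q]
  have "q < p * q" using p1 q1 by simp
  have "r \<noteq> p * q"
  proof
    assume "r = p * q"
    then have "p dvd r" by simp
    then show False using primes_dvd_imp_eq[OF p r] pqr by simp
  qed
  then consider "r < p * q" | "r > p * q" by linarith
  then obtain s where "small_divisors N = {p, q, s}" "q < s"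
    using form8_divisors[OF f] pqr \<open>q < p * q\<close> by metis
  then show ?thesis
    using bezout_satisfies_U[OF p q pqr(1), of s] small_recurrent_of_satisfies_U by metis
qed

definition listed :: "int \<Rightarrow> bool" where
  "listed N \<longleftrightarrow>
        (\<exists>p k. form1 N p k) \<or>
        (\<exists>p q k. form2 N p q k) \<or>
        (\<exists>p q k. form3 N p q k) \<or>
        (\<exists>p q k. form4 N p q k) \<or>
        (\<exists>p q k. form5 N p q k) \<or>
        (\<exists>p q r k. form6 N p q r k) \<or>
        (\<exists>p q. form7 N p q) \<or>
        (\<exists>p q r. form8 N p q r) \<or>
        (\<exists>p q. form9 N p q) \<or>
        (\<exists>p q r. form10 N p q r)"

lemma listedI:
  "form1 N p k \<Longrightarrow> listed N" "form2 N p q k \<Longrightarrow> listed N" "form3 N p q k \<Longrightarrow> listed N"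
  "form4 N p q k \<Longrightarrow> listed N" "form5 N p q k \<Longrightarrow> listed N" "form6 N p q r k \<Longrightarrow> listed N"
  "form7 N p q \<Longrightarrow> listed N" "form8 N p q r \<Longrightarrow> listed N" "form9 N p q \<Longrightarrow> listed N"
  "form10 N p q r \<Longrightarrow> listed N"
  unfolding listed_def by fast+

lemma form4_divisors:
  assumes f: "form4 N p q k"
  shows "take 4 (sorted_list_of_set (small_divisors N)) = [p, q, p\<^sup>2, p * q]"
    and "satisfies_U (small_divisors N) p q 0 p"
  using f satisfies_U_form4[of p q k] form4_less_square[OF f]
  by (auto simp: form4_def take_4_rec_seq power2_eq_square)

lemma form5_divisors:
  assumes f: "form5 N p q k"
  shows "take 4 (sorted_list_of_set (small_divisors N)) = [p, q, p * q, q\<^sup>2]"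
    and "satisfies_U (small_divisors N) p q 0 q"
  using f satisfies_U_form5[of p q k]
  by (auto simp: form5_def take_4_rec_seq power2_eq_square)

lemma form6_divisors:
  assumes "form6 N p q r k"
  shows "small_divisors N = {q ^ i | i. 1 \<le> i \<and> i \<le> k} \<union> {p * q ^ i | i. i \<le> k}"
    and "satisfies_U (small_divisors N) p q 0 q"
  using assms small_divisors_form6[of p q r k] satisfies_U_form6[of p q r k]
  by (simp_all add: form6_def)

lemma form7_divisors: "form7 N p q \<Longrightarrow> small_divisors N = {p, q, p\<^sup>2}"
  using small_divisors_form7 by (auto simp: form7_def)

lemma form10_divisors: "form10 N p q r \<Longrightarrow> small_divisors N = {p, q, p\<^sup>2, r, p * q}"
  unfolding form10_def using small_divisors_form10 by blast

lemma small_recurrent_of_listed: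
  assumes "listed N"
  shows "small_recurrent N"
  using assms form1_divisors(2) small_recurrent_form2 form3_divisors(2) form4_divisors(2)
    form5_divisors(2) form6_divisors(2) small_recurrent_form7 small_recurrent_form8
    form9_divisors(2) satisfies_U_form10 small_recurrent_of_satisfies_U
  unfolding listed_def by meson

section \<open>Zeros of a linear recurrence modulo a prime\<close>

lemma prime_if_less_square:
  fixes d c :: int
  assumes "1 < d" "0 < c" "d < c * c" "\<And>l. prime l \<Longrightarrow> l dvd d \<Longrightarrow> c \<le> l"
  shows "prime d"
proof -
  obtain l where l: "prime l" "l dvd d" using assms(1) prime_factor_int[of d] by auto
  then obtain e where e: "d = l * e" by blast
  have l1: "l > 1" "c \<le> l" using l assms(4) prime_gt_1_int by auto
  then have "e > 0" using e assms(1) by (metis less_trans zero_less_mult_pos zero_less_one)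
  have "e = 1"
  proof (rule ccontr)
    assume "e \<noteq> 1"
    then obtain l' where "prime l'" "l' dvd e" using \<open>e > 0\<close> prime_factor_int[of e] by auto
    then have "c \<le> l'" "l' \<le> e" using assms(4) e \<open>e > 0\<close> zdvd_imp_le by auto
    then have "c * c \<le> l * e" using l1 assms(2) by (intro mult_mono) auto
    then show False using e assms(3) by simp
  qed
  then show ?thesis using e l by simp
qed

text \<open>As a function of \<open>n\<close> the expression satisfies the same recurrence. It is
  divisible by \<open>l\<close> at \<open>n = 0\<close> by assumption and vanishes at
  \<open>n = 1\<close>.\<close>

lemma recurrence_cross_dvd:
  fixes X :: "nat \<Rightarrow> int"
  assumes rec: "\<And>i. X (Suc (Suc i)) = a * X (Suc i) + b * X i"
    and "l dvd X i" "l dvd X j"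
  shows "l dvd X (Suc i) * X (j + n) - X (Suc j) * X (i + n)"
proof (induction n rule: induct_nat_012)
  case (ge2 n)
  have "X (Suc i) * X (j + Suc (Suc n)) - X (Suc j) * X (i + Suc (Suc n)) =
    a * (X (Suc i) * X (j + Suc n) - X (Suc j) * X (i + Suc n)) +
    b * (X (Suc i) * X (j + n) - X (Suc j) * X (i + n))"
    by (simp add: rec algebra_simps)
  then show ?case using ge2 by (metis dvd_add dvd_mult)
qed (use assms in \<open>simp_all add: dvd_diff dvd_mult\<close>)

text \<open>Multiplying the pair \<open>(0, X (Suc i))\<close> by a unit modulo \<open>l\<close> gives \<open>(0, X (Suc (i + s)))\<close>, so the
  zeros modulo \<open>l\<close> repeat with period \<open>s\<close>.\<close>

lemma recurrence_zeros_shift: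
  fixes X :: "nat \<Rightarrow> int"
  assumes rec: "\<And>i. X (Suc (Suc i)) = a * X (Suc i) + b * X i"
    and l: "prime l" and i: "l dvd X i" "l dvd X (i + s)"
    and nz: "\<And>i. \<not> (l dvd X i \<and> l dvd X (Suc i))"
  shows "l dvd X (i + s + n) \<longleftrightarrow> l dvd X (i + n)"
proof -
  have u: "\<not> l dvd X (Suc i)" "\<not> l dvd X (Suc (i + s))" using nz i by auto
  have *: "l dvd X (Suc i) * X (i + s + n) - X (Suc (i + s)) * X (i + n)"
    using recurrence_cross_dvd[OF rec i] by blast
  show ?thesis
  proof
    assume "l dvd X (i + s + n)"
    then have "l dvd X (Suc i) * X (i + s + n)" by (rule dvd_mult)
    with * have "l dvd X (Suc (i + s)) * X (i + n)" using dvd_diff_right_iff by blast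
    then show "l dvd X (i + n)" using l u prime_dvd_mult_iff by blast
  next
    assume "l dvd X (i + n)"
    then have "l dvd X (Suc (i + s)) * X (i + n)" by (rule dvd_mult)
    with * have "l dvd X (Suc i) * X (i + s + n)" using dvd_diff_left_iff by blast
    then show "l dvd X (i + s + n)" using l u prime_dvd_mult_iff by blast
  qed
qed

lemma recurrence_zeros:
  fixes X :: "nat \<Rightarrow> int"
  assumes rec: "\<And>i. X (Suc (Suc i)) = a * X (Suc i) + b * X i"
    and l: "prime l" and i: "l dvd X i" "l dvd X (i + s)" and s: "0 < s"
    and nz: "\<And>i. \<not> (l dvd X i \<and> l dvd X (Suc i))"
    and gap: "\<And>t. 0 < t \<Longrightarrow> t < s \<Longrightarrow> \<not> l dvd X (i + t)"
  shows "l dvd X (i + n) \<longleftrightarrow> s dvd n"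
proof (induction n rule: less_induct)
  case (less n)
  show ?case
  proof (cases "n < s")
    case True
    then show ?thesis using gap[of n] i s by (cases "n = 0") (auto dest: dvd_imp_le)
  next
    case False
    then obtain k where k: "n = s + k" using le_Suc_ex not_less by blast
    have "l dvd X (i + n) \<longleftrightarrow> l dvd X (i + k)"
      using recurrence_zeros_shift[OF rec l i nz, of k] k by (simp add: add.assoc)
    then show ?thesis using less[of k] k s by simp
  qed
qed

text \<open>The zeros from \<open>i\<close> on are exactly \<open>i, i + s, i + 2 s, ...\<close>.
  Both \<open>j\<close> and \<open>j + s'\<close> belong to them, so \<open>s\<close> divides
  \<open>s'\<close>; and the zero \<open>j + s\<close> cannot come before
  \<open>j + s'\<close>.\<close>

lemma recurrence_zeros_gap:
  fixes X :: "nat \<Rightarrow> int"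
  assumes rec: "\<And>i. X (Suc (Suc i)) = a * X (Suc i) + b * X i"
    and l: "prime l" and i: "l dvd X i" "l dvd X (i + s)" and s: "0 < s"
    and nz: "\<And>i. \<not> (l dvd X i \<and> l dvd X (Suc i))"
    and gap: "\<And>t. 0 < t \<Longrightarrow> t < s \<Longrightarrow> \<not> l dvd X (i + t)"
    and j: "i \<le> j" "l dvd X j" "l dvd X (j + s')" "0 < s'"
    and gap': "\<And>t. 0 < t \<Longrightarrow> t < s' \<Longrightarrow> \<not> l dvd X (j + t)"
  shows "s' = s"
proof -
  note z = recurrence_zeros[OF rec l i s nz gap]
  obtain n where n: "j = i + n" using j(1) le_Suc_ex by blast
  have "s dvd n" "s dvd n + s'" using z[of n] z[of "n + s'"] j n by (auto simp: add.assoc)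
  then have "s \<le> s'" using j(4) dvd_add_right_iff dvd_imp_le by blast
  moreover have "l dvd X (j + s)"
    using z[of "n + s"] n \<open>s dvd n\<close> by (simp add: add.assoc)
  ultimately show ?thesis using gap'[of s] s by linarith
qed

text \<open>\<open>V\<close> is the companion Lucas number \<open>alpha^s + beta^s\<close> and
  \<open>W = - (alpha * beta)^s\<close>, for the roots of \<open>x^2 - a x - b\<close>. The
  induction uses \<open>V_(s+2) = a V_(s+1) + b V_s\<close> with \<open>V_0 = 2\<close> and
  \<open>V_1 = a\<close>, so the roots never appear.\<close>

lemma recurrence_subsampled:
  fixes X :: "nat \<Rightarrow> int"
  assumes rec: "\<And>i. X (Suc (Suc i)) = a * X (Suc i) + b * X i"
  obtains V W where "\<And>n. X (n + 2 * s) = V * X (n + s) + W * X n"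
proof -
  have "\<exists>V. \<forall>n. X (n + 2 * s) = V * X (n + s) - (- b) ^ s * X n"
  proof (induction s rule: induct_nat_012)
    case 0
    show ?case by (intro exI[of _ 2]) simp
  next
    case 1
    show ?case using rec by (intro exI[of _ a]) simp
  next
    case (ge2 s)
    then obtain V V' where V: "\<And>n. X (n + 2 * s) = V * X (n + s) - (- b) ^ s * X n"
      and V': "\<And>n. X (n + 2 * Suc s) = V' * X (n + Suc s) - (- b) ^ Suc s * X n" by blast
    show ?case
    proof (intro exI allI)
      fix n
      let ?c = "n + Suc (Suc s)"
      have "X (n + 2 * Suc (Suc s)) = a * X (Suc n + 2 * Suc s) + b * X (Suc (Suc n) + 2 * s)"
        using rec[of "n + 2 * s + 2"] by (simp add: numeral_eq_Suc)
      also have "\<dots> = a * (V' * X ?c - (- b) ^ Suc s * X (Suc n))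
          + b * (V * X ?c - (- b) ^ s * X (Suc (Suc n)))"
        unfolding V' V by simp
      also have "\<dots> = (a * V' + b * V) * X ?c - (- b) ^ Suc (Suc s) * X n"
        by (simp add: rec algebra_simps)
      finally show "X (n + 2 * Suc (Suc s)) =
        (a * V' + b * V) * X ?c - (- b) ^ Suc (Suc s) * X n" .
    qed
  qed
  then obtain V where "\<And>n. X (n + 2 * s) = V * X (n + s) + (- ((- b) ^ s)) * X n" by auto
  then show thesis using that by blast
qed

section \<open>Small divisors that follow a recurrence, and index gaps between multiples of a
  prime\<close>

locale recurrent_small_divisors =
  fixes N a b :: int and X :: "nat \<Rightarrow> int" and m :: nat
  assumes N1: "1 < N"
    and image: "small_divisors N = X ` {..<m}"
    and increasing: "\<And>i j. i < j \<Longrightarrow> j < m \<Longrightarrow> X i < X j"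
    and rec: "\<And>i. X (Suc (Suc i)) = a * X (Suc i) + b * X i"
begin

abbreviation S where "S \<equiv> small_divisors N"

lemma X_in: "i < m \<Longrightarrow> X i \<in> S" using image by simp

lemma index: assumes "d \<in> S" obtains i where "i < m" "X i = d" using assms image by auto

lemma X_less_iff: "i < m \<Longrightarrow> j < m \<Longrightarrow> X i < X j \<longleftrightarrow> i < j"
  using increasing[of i j] increasing[of j i] by (cases i j rule: linorder_cases) auto

lemma X_eq_iff: "i < m \<Longrightarrow> j < m \<Longrightarrow> X i = X j \<longleftrightarrow> i = j"
  using increasing[of i j] increasing[of j i] by (cases i j rule: linorder_cases) auto

lemma first: assumes "d \<in> S" shows "0 < m \<and> X 0 \<le> d"
proof -
  obtain i where "i < m" "X i = d" using index[OF assms] .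
  then show ?thesis using increasing[of 0 i] by (cases i) auto
qed

lemma next_le:
  assumes "d \<in> S" "i < m" "X i < d"
  shows "Suc i < m \<and> X (Suc i) \<le> d"
proof -
  obtain j where j: "j < m" "X j = d" using index[OF assms(1)] .
  then have "i < j" using assms X_less_iff by blast
  then show ?thesis using j increasing[of "Suc i" j] by (cases "j = Suc i") auto
qed

lemma first_eq:
  assumes "d \<in> S" "\<And>e. e \<in> S \<Longrightarrow> d \<le> e"
  shows "0 < m" "X 0 = d"
proof -
  show m: "0 < m" using first[OF assms(1)] by simp
  show "X 0 = d" using first[OF assms(1)] assms(2)[OF X_in[OF m]] by linarith
qed

lemma next_eq:
  assumes "d \<in> S" "i < m" "X i < d" "\<And>e. e \<in> S \<Longrightarrow> X i < e \<Longrightarrow> d \<le> e"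
  shows "Suc i < m" "X (Suc i) = d"
proof -
  show i: "Suc i < m" using next_le[OF assms(1-3)] by simp
  have "X i < X (Suc i)" using i by (intro increasing) auto
  then show "X (Suc i) = d" using next_le[OF assms(1-3)] assms(4)[OF X_in[OF i]] by linarith
qed

lemma dvd_from:
  assumes "l dvd X i" "l dvd X (Suc i)" "i \<le> j"
  shows "l dvd X j"
proof -
  have "l dvd X (i + n)" for n
  proof (induction n rule: induct_nat_012)
    case (ge2 n)
    then show ?case using rec[of "i + n"] by simp
  qed (use assms in simp_all)
  then show ?thesis using assms(3) le_Suc_ex by blast
qed

text \<open>Records two consecutive multiples of \<open>l\<close> in the list by their cofactors;
  \<open>u = 1\<close> stands for \<open>l\<close> itself. Testing \<open>l * d dvd N\<close> is
  enough, since a divisor of \<open>N\<close> between two small divisors is small.\<close>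

definition adjacent :: "int \<Rightarrow> int \<Rightarrow> int \<Rightarrow> bool" where
  "adjacent l u v \<longleftrightarrow> l * u \<in> S \<and> l * v \<in> S \<and> u < v \<and> (\<forall>d. u < d \<and> d < v \<longrightarrow> \<not> l * d dvd N)"

lemma adjacent_index:
  assumes "prime l" "adjacent l u v" "i < m" "X i = l * u"
  obtains s where "0 < s" "i + s < m" "X (i + s) = l * v" "\<And>t. 0 < t \<Longrightarrow> t < s \<Longrightarrow> \<not> l dvd X (i + t)"
proof -
  note l = prime_gt_1_int[OF assms(1)]
  obtain j where j: "j < m" "X j = l * v" using assms(2) index by (auto simp: adjacent_def)
  have "X i < X j" using assms l j by (auto simp: adjacent_def)
  then have "i < j" using X_less_iff assms(3) j by blast
  then obtain s where s: "j = i + s" "0 < s" using less_imp_add_positive by blast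
  have "\<not> l dvd X (i + t)" if t: "0 < t" "t < s" for t
  proof
    assume "l dvd X (i + t)"
    then obtain d where d: "X (i + t) = l * d" by blast
    have *: "X i < X (i + t)" "X (i + t) < X j" "X (i + t) \<in> S"
      using t s j increasing[of i "i + t"] increasing[of "i + t" j] X_in[of "i + t"] by auto
    then have "u < d" "d < v" using d assms(4) j l by auto
    moreover have "l * d dvd N" using * d by (simp add: small_divisors_iff)
    ultimately show False using assms(2) by (auto simp: adjacent_def)
  qed
  then show thesis using that s j by blast
qed

text \<open>Used to locate elements: once one pair of consecutive multiples of \<open>l\<close> has
  index distance \<open>s\<close>, the successor of any later multiple of \<open>l\<close> is found
  \<open>s\<close> places further on.\<close>

lemma adjacent_gap:
  assumes l: "prime l" and nz: "\<And>i. \<not> (l dvd X i \<and> l dvd X (Suc i))"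
    and uv: "adjacent l u v" "i < m" "X i = l * u" "i + s < m" "X (i + s) = l * v"
    and uv': "adjacent l u' v'" "i' < m" "X i' = l * u'" "u \<le> u'"
  shows "i' + s < m" "X (i' + s) = l * v'"
proof -
  note l1 = prime_gt_1_int[OF l]
  obtain s1 where s1: "0 < s1" "i + s1 < m" "X (i + s1) = l * v"
    "\<And>t. 0 < t \<Longrightarrow> t < s1 \<Longrightarrow> \<not> l dvd X (i + t)"
    using adjacent_index[OF l uv(1-3)] by blast
  then have [simp]: "s1 = s" using X_eq_iff[of "i + s" "i + s1"] uv by auto
  obtain s2 where s2: "0 < s2" "i' + s2 < m" "X (i' + s2) = l * v'"
    "\<And>t. 0 < t \<Longrightarrow> t < s2 \<Longrightarrow> \<not> l dvd X (i' + t)"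
    using adjacent_index[OF l uv'(1-3)] by blast
  have "X i \<le> X i'" using uv uv' l1 by simp
  then have "i \<le> i'" using X_less_iff[of i' i] uv uv' by linarith
  have d: "l dvd X i" "l dvd X (i + s)" "l dvd X i'" "l dvd X (i' + s2)" using uv uv' s2 by simp_all
  have "s2 = s"
    by (rule recurrence_zeros_gap[OF rec l d(1,2) _ _ _ \<open>i \<le> i'\<close> d(3,4) s2(1,4)])
      (use s1 nz in simp_all)
  then show "i' + s < m" "X (i' + s) = l * v'" using s2 by auto
qed

text \<open>Three consecutive multiples of \<open>l\<close> sit at indices \<open>j\<close>,
  \<open>j + s\<close>, \<open>j + 2 s\<close>, so the recurrence of step \<open>s\<close> applies
  to them; cancelling \<open>l\<close> passes it on to the cofactors.\<close>

lemma adjacent_recurrence: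
  assumes l: "prime l" and nz: "\<And>i. \<not> (l dvd X i \<and> l dvd X (Suc i))"
    and uv: "adjacent l u0 v0"
  obtains V W where
    "\<And>u v w. u0 \<le> u \<Longrightarrow> adjacent l u v \<Longrightarrow> adjacent l v w \<Longrightarrow> w = V * v + W * u"
proof -
  note l1 = prime_gt_1_int[OF l]
  obtain i where i: "i < m" "X i = l * u0" using uv index by (auto simp: adjacent_def)
  obtain s where s: "i + s < m" "X (i + s) = l * v0" using adjacent_index[OF l uv i] by blast
  obtain V W where V: "\<And>n. X (n + 2 * s) = V * X (n + s) + W * X n"
    by (rule recurrence_subsampled[of X a b s, OF rec]) blast
  have "w = V * v + W * u" if u: "u0 \<le> u" "adjacent l u v" "adjacent l v w" for u v w
  proof -
    obtain j where j: "j < m" "X j = l * u" using u(2) index by (auto simp: adjacent_def)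
    note 1 = adjacent_gap[OF l nz uv i s u(2) j u(1)]
    have "u0 \<le> v" using u by (auto simp: adjacent_def)
    note 2 = adjacent_gap[OF l nz uv i s u(3) 1 this]
    have "l * w = X (j + 2 * s)" using 2 by (simp add: add.assoc mult_2)
    also have "\<dots> = V * (l * v) + W * (l * u)" using V[of j] 1 j by simp
    finally have "l * w = l * (V * v + W * u)" by (simp add: algebra_simps)
    then show ?thesis using l1 by simp
  qed
  then show thesis using that by blast
qed

lemma S_downward:
  "e \<in> S \<Longrightarrow> 1 < d \<Longrightarrow> d \<le> e \<Longrightarrow> d dvd N \<Longrightarrow> d \<in> S"
  using mult_mono[of d e d e] by (auto simp: small_divisors_iff)

lemma no_divisor_between:
  assumes "Suc i < m" "X i < d" "d < X (Suc i)"
  shows "\<not> d dvd N"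
proof
  assume "d dvd N"
  have i: "X i \<in> S" "X (Suc i) \<in> S" using assms X_in by auto
  then have "1 < d" using assms by (simp add: small_divisors_iff)
  then have "d \<in> S" using S_downward[OF i(2)] assms \<open>d dvd N\<close> by simp
  then have "X (Suc i) \<le> d" using next_le[of d i] assms by simp
  then show False using assms by simp
qed

lemma adjacent_Suc:
  assumes "Suc i < m" "l * X i \<in> S" "l * X (Suc i) \<in> S"
  shows "adjacent l (X i) (X (Suc i))"
  using assms no_divisor_between[OF assms(1)] increasing[of i "Suc i"] dvd_mult_right
  unfolding adjacent_def by blast

lemma adjacent_one:
  assumes "0 < m" "l \<in> S" "l * X 0 \<in> S"
  shows "adjacent l 1 (X 0)"
proof -
  have X: "X 0 \<in> S" using X_in assms by simp
  have "\<not> l * d dvd N" if d: "1 < d" "d < X 0" for d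
  proof
    assume "l * d dvd N"
    then have "d dvd N" by (rule dvd_mult_right)
    then have "d \<in> S" using S_downward[OF X d(1)] d by simp
    then show False using first[of d] d by simp
  qed
  moreover have "1 < X 0" using X by (simp add: small_divisors_iff)
  ultimately show ?thesis using assms by (simp add: adjacent_def)
qed

lemma adjacent_zeros:
  assumes l: "prime l" and nz: "\<And>i. \<not> (l dvd X i \<and> l dvd X (Suc i))"
    and uv: "adjacent l u v" "i < m" "X i = l * u" "i + s < m" "X (i + s) = l * v"
  shows "l dvd X (i + n) \<longleftrightarrow> s dvd n"
proof -
  obtain s1 where s1: "0 < s1" "i + s1 < m" "X (i + s1) = l * v"
    "\<And>t. 0 < t \<Longrightarrow> t < s1 \<Longrightarrow> \<not> l dvd X (i + t)"
    using adjacent_index[OF l uv(1-3)] by blast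
  then have [simp]: "s1 = s" using X_eq_iff[of "i + s" "i + s1"] uv by auto
  have "l dvd X i" "l dvd X (i + s)" using uv by simp_all
  then show ?thesis 
    by (rule recurrence_zeros[where X = X and a = a and b = b, OF rec l]) (use s1 nz in simp_all)
qed

text \<open>If all of \<open>2, ..., n\<close> divide \<open>N\<close> and nothing larger is small,
  then \<open>N\<close> is at most the square of some divisor just above \<open>n\<close>, yet at
  least a product of three pairwise coprime numbers close to \<open>n\<close>. The cubic bound wins
  from \<open>n = 8\<close> on.\<close>

lemma not_consecutive_integers:
  assumes m: "7 \<le> m" and X: "\<And>i. X i = int i + 2"
  shows False
proof -
  define n where "n = int m + 1"
  have n: "8 \<le> n" using m by (simp add: n_def)
  have dvdN: "d dvd N" if "2 \<le> d" "d \<le> n" for d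
  proof -
    have "nat (d - 2) < m" "X (nat (d - 2)) = d" using that X n_def by auto
    then show ?thesis using X_in[of "nat (d - 2)"] by (simp add: small_divisors_iff)
  qed
  have le: "d \<le> n" if d: "d \<in> S" for d
  proof -
    obtain i where "i < m" "X i = d" using index[OF d] .
    then show ?thesis using X[of i] n_def by simp
  qed
  \<comment> \<open>An odd \<open>e\<close> just above \<open>n / 2\<close> makes
    \<open>2 * e\<close> a divisor of \<open>N\<close> beyond the end of the list, which bounds
    \<open>N\<close> from above.\<close>
  obtain e where e: "odd e" "n < 2 * e" "2 * e \<le> n + 4"
  proof -
    have "n < 2 * (n div 2 + 1)" "2 * (n div 2 + 2) \<le> n + 4" by simp_all
    then show thesis using that[of "n div 2 + 1"] that[of "n div 2 + 2"]
      by (cases "odd (n div 2)") simp_all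
  qed
  have "2 * e dvd N"
  proof (rule divides_mult)
    show "2 dvd N" "e dvd N" using dvdN n e by auto
    show "coprime 2 e" using e by simp
  qed
  then have "N \<le> 2 * e * (2 * e)" using le[of "2 * e"] e n by (force simp: small_divisors_iff)
  also have "\<dots> \<le> (n + 4) * (n + 4)" using e n by (intro mult_mono) auto
  finally have N_le: "N \<le> (n + 4) * (n + 4)" .
  \<comment> \<open>Among \<open>c - 2\<close>, \<open>c - 1\<close>, \<open>c\<close> only the
    middle number is even, so the three are pairwise coprime.\<close>
  obtain c where c: "odd c" "n - 1 \<le> c" "c \<le> n"
    using that[of n] that[of "n - 1"] by (cases "odd n") simp_all
  have "coprime (c - 2) c"
  proof (rule coprimeI)
    fix d assume d: "d dvd c - 2" "d dvd c"
    then have "d dvd c - (c - 2)" by (rule dvd_diff[rotated])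
    then have "d dvd 2" by simp
    moreover have "coprime 2 c" using c(1) by simp
    ultimately show "is_unit d" using d(2) coprime_common_divisor by blast
  qed
  moreover have "coprime (c - 1) c" using coprime_diff_one_left[of c] .
  moreover have "coprime (c - 2) (c - 1)" using coprime_diff_one_left[of "c - 1"] by simp
  moreover have "c - 2 dvd N" "c - 1 dvd N" "c dvd N" using dvdN c n by auto
  ultimately have "(c - 2) * (c - 1) * c dvd N" by (intro divides_mult) simp_all
  then have "(c - 2) * (c - 1) * c \<le> N" using N1 zdvd_imp_le by simp
  moreover have "(n - 3) * (n - 2) * (n - 1) \<le> (c - 2) * (c - 1) * c"
    using c n by (intro mult_mono mult_nonneg_nonneg) auto
  \<comment> \<open>For \<open>n = 8\<close> this reads \<open>144 < 210\<close>; for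
    \<open>n = 7\<close> it would read \<open>121 < 120\<close>.\<close>
  moreover have "(n + 4) * (n + 4) < (n - 3) * (n - 2) * (n - 1)"
  proof -
    have "8 * (n * n) \<le> n * (n * n)" using n by (intro mult_right_mono) auto
    moreover have "8 * 8 \<le> n * n" using n by (intro mult_mono) auto
    moreover have "(n - 3) * (n - 2) * (n - 1) = n * (n * n) - 6 * (n * n) + 11 * n - 6"
      "(n + 4) * (n + 4) = n * n + 8 * n + 16" by (simp_all add: algebra_simps)
    ultimately show ?thesis using n by linarith
  qed
  ultimately show False using N_le by linarith
qed

end

section \<open>Two smallest prime factors\<close>

lemma prime_power_decompose:
  fixes p N :: int
  assumes "prime p" "N > 0"
  obtains k M where "N = p ^ k * M" "\<not> p dvd M" "M > 0"
proof -
  have "\<not> is_unit p" "N \<noteq> 0" using assms not_prime_unit by auto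
  then obtain M where M: "N = p ^ multiplicity p N * M" "\<not> p dvd M"
    using multiplicity_decompose'[of N p] by auto
  moreover have "M > 0" using M(1) assms prime_gt_0_int[of p] by (metis zero_less_mult_pos zero_less_power)
  ultimately show thesis using that by blast
qed

text \<open>Prime factors outside \<open>small_divisors N\<close> are at least \<open>sqrt N\<close>, so there is room for only one.\<close>

lemma large_cofactor_prime:
  fixes K M :: int
  assumes N: "N = K * M" and KM: "1 < K" "1 < M" "\<not> M dvd K"
    and large: "\<And>l. prime l \<Longrightarrow> l dvd M \<Longrightarrow> N \<le> l * l"
  shows "prime M \<and> K < M"
proof -
  obtain r where r: "prime r" "r dvd M" using KM(2) prime_factor_int[of M] by auto
  then obtain M' where M': "M = r * M'" by blast
  have r1: "r > 1" using r(1) prime_gt_1_int by blast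
  have M0: "M' > 0" using M' KM(2) r1 by (metis less_trans zero_less_mult_pos zero_less_one)
  have "K * (r * M') \<le> r * r" using large[OF r] N M' by simp
  then have "r * (K * M') \<le> r * r" by (simp add: mult_ac)
  then have K: "K * M' \<le> r" using r1 by simp
  have "M' = 1"
  proof (rule ccontr)
    assume "M' \<noteq> 1"
    then obtain r' where r': "prime r'" "r' dvd M'" using M0 prime_factor_int[of M'] by auto
    then have "r' \<le> M'" "r' > 1" using M0 zdvd_imp_le prime_gt_1_int by auto
    have "M' * 1 < M' * K" using M0 KM(1) by (intro mult_strict_left_mono) auto
    with K have "M' < r" by (simp add: mult_ac)
    \<comment> \<open>The second prime factor \<open>r'\<close> also has square at least
      \<open>N\<close>, although it is at most \<open>M'\<close>, which is below
      \<open>r\<close>.\<close>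
    have "M' * (r * K) \<le> r' * r'" using large[OF r'(1)] r'(2) M' N by (simp add: mult_ac)
    also have "\<dots> \<le> M' * r'" using \<open>r' \<le> M'\<close> \<open>r' > 1\<close> by simp
    finally have "r * K \<le> r'" using M0 by simp
    moreover have "r * 1 < r * K" using r1 KM(1) by (intro mult_strict_left_mono) auto
    ultimately show False using \<open>M' < r\<close> \<open>r' \<le> M'\<close> by simp
  qed
  then have "M = r" "K \<le> r" using M' K by auto
  then show ?thesis using r KM(3) by (cases "K = r") auto
qed

text \<open>Here \<open>p\<close> and \<open>q\<close> are the two smallest prime factors. The last
  assumption excludes lists starting with \<open>p, p^2\<close>: there \<open>p\<close> would divide
  every element, while \<open>q\<close> is one of them.\<close>

locale two_small_primes = recurrent_small_divisors +
  fixes p q :: int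
  assumes p: "prime p" and q: "prime q" and pq: "p < q" and pqS: "p * q \<in> S"
    and least: "\<And>l. prime l \<Longrightarrow> l dvd N \<Longrightarrow> l \<noteq> p \<Longrightarrow> q \<le> l"
    and p2: "p * p dvd N \<Longrightarrow> q < p * p"
begin

lemma p1: "1 < p" and q1: "1 < q"
  using prime_gt_1_int p q by auto

lemma q_less_pq: "q < p * q" and p_less_pq: "p < p * q"
  using p1 q1 by auto

lemma dvds: "p * q dvd N" "p dvd N" "q dvd N"
  using pqS by (auto simp: small_divisors_iff intro: dvd_mult_left dvd_mult_right)

lemma pS: "p \<in> S" and qS: "q \<in> S"
  using S_downward[OF pqS] p1 q1 dvds by auto

lemma X_0: "0 < m" "X 0 = p"
proof -
  have "p \<le> e" if "e \<in> S" for e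
  proof -
    have e: "1 < e" "e dvd N" using that by (auto simp: small_divisors_iff)
    obtain l where l: "prime l" "l dvd e" using e prime_factor_int[of e] by auto
    then have "p \<le> l" using least[of l] pq e by (cases "l = p") (auto intro: dvd_trans)
    then show "p \<le> e" using l e zdvd_imp_le[of l e] by auto
  qed
  then show "0 < m" "X 0 = p" using first_eq[OF pS] by auto
qed

lemma prime_if_not_dvd:
  assumes "d dvd N" "1 < d" "d < q * q" "\<not> p dvd d"
  shows "prime d" "q \<le> d"
proof -
  show "prime d" using assms q1
    by (intro prime_if_less_square[of d q] least) (auto intro: dvd_trans)
  moreover have "d \<noteq> p" using assms by auto
  ultimately show "q \<le> d" using least assms(1) by blast
qed

text \<open>If \<open>p\<close> does not divide \<open>e\<close>, all prime factors of
  \<open>e\<close> are at least \<open>q\<close>, and \<open>e < q^2\<close> makes \<open>e\<close>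
  prime. If \<open>e = p * f\<close>, then \<open>f < q\<close> can only be a power of
  \<open>p\<close>, and \<open>f < q < p^2\<close> leaves 1 and \<open>p\<close>.\<close>

lemma below_pq:
  assumes "e \<in> S" "e < p * q"
  shows "e = p \<or> e = p * p \<or> prime e \<and> q \<le> e"
proof (cases "p dvd e")
  case False
  have "p * q < q * q" using pq q1 by simp
  then have "e < q * q" using assms by simp
  then show ?thesis using prime_if_not_dvd[of e] assms False by (auto simp: small_divisors_iff)
next
  case True
  then obtain f where f: "e = p * f" by blast
  have e: "1 < e" "e dvd N" using assms by (auto simp: small_divisors_iff)
  have f0: "0 < f" using f e p1 by (metis less_trans zero_less_mult_pos zero_less_one)
  have "f < q" using assms f p1 by simp
  have fN: "f dvd N" using e f dvd_mult_right by blast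
  show ?thesis
  proof (cases "f = 1")
    case False
    then obtain l where l: "prime l" "l dvd f" using f0 prime_factor_int[of f] by auto
    then have "l \<le> f" using f0 zdvd_imp_le by blast
    then have "l = p" using least[of l] l fN \<open>f < q\<close> by (meson dvd_trans leD le_less_trans)
    then obtain g where g: "f = p * g" using l by blast
    have "q < p * p" using p2 e f g by (metis dvd_mult_left mult.assoc)
    moreover have g0: "0 < g" using g f0 p1 by (metis less_trans zero_less_mult_pos zero_less_one)
    have "g < p"
    proof (rule ccontr)
      assume "\<not> g < p"
      then have "p * p \<le> p * g" using p1 by simp
      then show False using \<open>f < q\<close> g calculation by simp
    qed
    have "g = 1"
    proof (rule ccontr)
      assume "g \<noteq> 1"
      then obtain l where l: "prime l" "l dvd g" using g0 prime_factor_int[of g] by auto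
      then have "l \<le> g" using g0 zdvd_imp_le by blast
      moreover have "l dvd N" using l g fN by (meson dvd_mult dvd_trans)
      ultimately show False using least[of l] l \<open>g < p\<close> pq by auto
    qed
    then show ?thesis using f g by simp
  qed (use f in simp)
qed

lemma X_1: "1 < m" "X 1 = q"
proof -
  have *: "q \<le> e" if "e \<in> S" "p < e" for e
  proof (cases "e < p * q")
    case True
    then show ?thesis using below_pq[OF that(1)] that p2 by (auto simp: small_divisors_iff)
  qed (use q_less_pq in linarith)
  have "Suc 0 < m" "X (Suc 0) = q"
    using next_eq[OF qS X_0(1)] X_0(2) pq * by simp_all
  then show "1 < m" "X 1 = q" by simp_all
qed

text \<open>The list starts with \<open>p, q, p q\<close>, so every small divisor except
  \<open>p\<close> is a multiple of \<open>q\<close>. Prime factors of \<open>N\<close> other than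
  \<open>p\<close> and \<open>q\<close> are therefore not small, and
  \<open>large_cofactor_prime\<close> allows just one of them.\<close>

lemma listed_if_X_2_eq_pq:
  assumes np: "\<not> p * p dvd N" and nr: "\<And>r. prime r \<Longrightarrow> r dvd N \<Longrightarrow> q < r \<Longrightarrow> \<not> r < p * q"
  shows "listed N"
proof -
  have *: "p * q \<le> e" if e: "e \<in> S" "X 1 < e" for e
  proof (rule ccontr)
    assume "\<not> p * q \<le> e"
    then have "e < p * q" by simp
    have eN: "e dvd N" using e by (simp add: small_divisors_iff)
    have "prime e" using below_pq[OF e(1) \<open>e < p * q\<close>] e(2) X_1(2) pq np eN by auto
    then show False using nr[of e] eN e(2) X_1(2) \<open>e < p * q\<close> by simp
  qed
  have X2: "X (Suc 1) = p * q"
    by (rule next_eq(2)[OF pqS X_1(1) _ *]) (use X_1(2) q_less_pq in linarith)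
  have q_dvd: "q dvd e" if e: "e \<in> S" "e \<noteq> p" for e
  proof -
    obtain i where i: "i < m" "X i = e" using index[OF e(1)] .
    then have "1 \<le> i" using e X_0 by (cases i) auto
    then have "q dvd X i" using X2 X_1 by (intro dvd_from[of q 1 i]) simp_all
    then show ?thesis using i by simp
  qed
  obtain M1 where M1: "N = p * M1" using dvds(2) by blast
  have M10: "M1 > 0" using M1 N1 p1 by (metis less_trans zero_less_mult_pos zero_less_one)
  obtain l M where M: "M1 = q ^ l * M" "\<not> q dvd M" "M > 0"
    using prime_power_decompose[OF q M10] by blast
  have N: "N = p * q ^ l * M" using M1 M by simp
  have "\<not> p dvd M"
  proof
    assume "p dvd M"
    then have "p * p dvd p * (q ^ l * M)" by (intro mult_dvd_mono) auto
    then show False using np N by (simp add: mult_ac)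
  qed
  have "l \<noteq> 0"
  proof
    assume "l = 0"
    then have "q dvd p * M" using N dvds by simp
    then show False using M q p pq primes_dvd_imp_eq prime_dvd_mult_iff by blast
  qed
  show ?thesis
  proof (cases "M = 1")
    case True
    then have N: "N = p * q ^ l" using N by simp
    show ?thesis
    proof (cases "l \<le> 3")
      case True
      then have "form2 N p q l" using N p q pq \<open>l \<noteq> 0\<close> by (simp add: form2_def)
      then show ?thesis by (rule listedI(2))
    next
      case False
      then have "form5 N p q l" using N p q pq by (simp add: form5_def)
      then show ?thesis by (rule listedI(5))
    qed
  next
    case False
    have K: "1 < p * q ^ l" using p1 q1 mult_left_mono[of 1 "q ^ l" p] one_le_power[of q l] by linarith
    have large: "N \<le> r * r" if r: "prime r" "r dvd M" for r
    proof (rule ccontr)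
      assume "\<not> N \<le> r * r"
      then have "r \<in> S" using r N prime_gt_1_int by (auto simp: small_divisors_iff)
      moreover have "r \<noteq> p" using r \<open>\<not> p dvd M\<close> by auto
      ultimately have "q dvd r" using q_dvd by blast
      then show False using primes_dvd_imp_eq[OF q r(1)] r M by auto
    qed
    have "\<not> M dvd p * q ^ l"
    proof
      assume "M dvd p * q ^ l"
      moreover obtain r where r: "prime r" "r dvd M" using False M prime_factor_int[of M] by auto
      ultimately have "r dvd p * q ^ l" using dvd_trans by blast
      then have "r dvd p \<or> r dvd q" using r(1) prime_dvd_mult_iff prime_dvd_power by blast
      then have "r = p \<or> r = q" using r p q primes_dvd_imp_eq by blast
      then show False using r M \<open>\<not> p dvd M\<close> by auto
    qed
    moreover have "1 < M" using False M(3) by simp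
    ultimately have *: "prime M" "p * q ^ l < M"
      using large_cofactor_prime[OF N K _ _ large] by simp_all
    have "q ^ 1 \<le> q ^ l" using q1 \<open>l \<noteq> 0\<close> by (intro power_increasing) auto
    then have "1 * q \<le> p * q ^ l" using p1 q1 by (intro mult_mono) auto
    then have "q < M" using * by simp
    then have "l = 1 \<Longrightarrow> form8 N p q M" "l \<ge> 2 \<Longrightarrow> form6 N p q M l"
      using * N p q pq by (auto simp: form8_def form6_def)
    moreover have "l = 1 \<or> l \<ge> 2" using \<open>l \<noteq> 0\<close> by auto
    ultimately show ?thesis using listedI(8)[of N p q M] listedI(6)[of N p q M l] by blast
  qed
qed

lemma square_dvd_S:
  assumes "p * p dvd N" shows "p * p \<in> S"
  using S_downward[OF pqS, of "p * p"] assms less_1_mult[OF p1 p1] p1 pq by simp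

lemma X_2_eq_square:
  assumes pp: "p * p dvd N"
    and nr: "\<And>r. prime r \<Longrightarrow> r dvd N \<Longrightarrow> q < r \<Longrightarrow> \<not> r < p * p"
  shows "2 < m" "X 2 = p * p"
proof -
  have less: "p * p < p * q" using pq p1 by simp
  have *: "p * p \<le> e" if e: "e \<in> S" "X 1 < e" for e
  proof (rule ccontr)
    assume "\<not> p * p \<le> e"
    then have "e < p * p" "e < p * q" using less by auto
    have eN: "e dvd N" using e by (simp add: small_divisors_iff)
    have "prime e" using below_pq[OF e(1) \<open>e < p * q\<close>] e(2) X_1(2) pq \<open>e < p * p\<close> by auto
    then show False using nr[of e] eN e(2) X_1(2) \<open>e < p * p\<close> by simp
  qed
  have "X 1 < p * p" unfolding X_1(2) by (rule p2[OF pp])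
  then have "Suc 1 < m" "X (Suc 1) = p * p"
    using next_eq[OF square_dvd_S[OF pp] X_1(1) _ *] by blast+
  then show "2 < m" "X 2 = p * p" by (simp_all add: numeral_2_eq_2)
qed

lemma X_3_eq_pq:
  assumes pp: "p * p dvd N"
    and nr: "\<And>r. prime r \<Longrightarrow> r dvd N \<Longrightarrow> q < r \<Longrightarrow> \<not> r < p * q"
  shows "3 < m" "X 3 = p * q"
proof -
  have less: "p * p < p * q" using pq p1 by simp
  have nr': "\<not> r < p * p" if "prime r" "r dvd N" "q < r" for r using nr[OF that] less by simp
  have X2: "2 < m" "X 2 = p * p" using X_2_eq_square[OF pp] nr' by blast+
  have *: "p * q \<le> e" if e: "e \<in> S" "X 2 < e" for e
  proof (rule ccontr)
    assume "\<not> p * q \<le> e"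
    then have "e < p * q" using less by auto
    have eN: "e dvd N" using e by (simp add: small_divisors_iff)
    have "q < e" "p * p < e" using e(2) X2(2) p2[OF pp] by auto
    then have "prime e" using below_pq[OF e(1) \<open>e < p * q\<close>] pq by auto
    then show False using nr[of e] eN \<open>q < e\<close> \<open>e < p * q\<close> by simp
  qed
  have "X 2 < p * q" unfolding X2(2) by (rule less)
  then have "Suc 2 < m" "X (Suc 2) = p * q" using next_eq[OF pqS X2(1) _ *] by blast+
  then show "3 < m" "X 3 = p * q" by (simp_all add: numeral_3_eq_3 numeral_2_eq_2)
qed

text \<open>Both the shift of \<open>X\<close> by two places and \<open>p\<close> times
  \<open>X\<close> satisfy the recurrence, and they agree in their first two terms. The values of
  \<open>a\<close> and \<open>b\<close> do not have to be computed.\<close>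

lemma geometric_tail:
  assumes "X 2 = p * p" "X 3 = p * q"
  shows "X (2 + n) = p * X n"
proof (induction n rule: induct_nat_012)
  case 0
  then show ?case using assms X_0 by simp
next
  case 1
  then show ?case using assms X_1 by (simp add: numeral_3_eq_3)
next
  case (ge2 n)
  have "X (2 + Suc (Suc n)) = a * (p * X (Suc n)) + b * (p * X n)"
    using rec[of "2 + n"] ge2 by simp
  then show ?case using rec[of n] by (simp add: algebra_simps)
qed

lemma interlaced_powers:
  assumes "X 2 = p * p" "X 3 = p * q"
  shows "X (2 * n) = p ^ n * p" "X (Suc (2 * n)) = p ^ n * q"
proof -
  have "X (2 * n) = p ^ n * p \<and> X (Suc (2 * n)) = p ^ n * q"
  proof (induction n)
    case 0
    then show ?case using X_0 X_1 by simp
  next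
    case (Suc n)
    then show ?case using geometric_tail[OF assms, of "2 * n"] geometric_tail[OF assms, of "Suc (2 * n)"]
      by simp
  qed
  then show "X (2 * n) = p ^ n * p" "X (Suc (2 * n)) = p ^ n * q" by auto
qed

text \<open>The list starts with \<open>p, q, p^2, p q\<close>, so every small divisor except
  \<open>q\<close> is a multiple of \<open>p\<close>. In particular \<open>q^2\<close> is never
  small, which bounds the exponents, and other prime factors of \<open>N\<close> are large.\<close>

lemma listed_if_X_3_eq_pq:
  assumes pp: "p * p dvd N"
    and nr: "\<And>r. prime r \<Longrightarrow> r dvd N \<Longrightarrow> q < r \<Longrightarrow> \<not> r < p * q"
  shows "listed N"
proof -
  have less: "p * p < p * q" using pq p1 by simp
  have nr': "\<not> r < p * p" if "prime r" "r dvd N" "q < r" for r using nr[OF that] less by simp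
  have X2: "2 < m" "X 2 = p * p" using X_2_eq_square[OF pp] nr' by blast+
  have X3: "3 < m" "X 3 = p * q" using X_3_eq_pq[OF pp] nr by blast+
  note powers = interlaced_powers[OF X2(2) X3(2)]
  have p_dvd: "p dvd e" if e: "e \<in> S" "e \<noteq> q" for e
  proof -
    obtain i where i: "i < m" "X i = e" using index[OF e(1)] .
    show ?thesis
    proof (cases "even i")
      case True
      then obtain t where "i = 2 * t" by blast
      then show ?thesis using i powers(1)[of t] by auto
    next
      case False
      then obtain t where t: "i = Suc (2 * t)" using oddE by fastforce
      then have "t \<noteq> 0" using i e(2) X_1(2) by (intro notI) simp
      then show ?thesis using i t powers(2)[of t] by auto
    qed
  qed
  have N0: "N > 0" using N1 by simp
  obtain k M1 where M1: "N = p ^ k * M1" "\<not> p dvd M1" "M1 > 0"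
    using prime_power_decompose[OF p N0] by blast
  obtain l M where M: "M1 = q ^ l * M" "\<not> q dvd M" "M > 0"
    using prime_power_decompose[OF q M1(3)] by blast
  have N: "N = p ^ k * q ^ l * M" using M1 M by simp
  have pM: "\<not> p dvd M" using M1 M by auto
  have k: "2 \<le> k"
  proof (rule ccontr)
    assume "\<not> 2 \<le> k"
    then have "k = 0 \<or> k = 1" by auto
    then show False
    proof
      assume "k = 0" then show False using M1 dvds by simp
    next
      assume "k = 1" then show False using M1 pp p1 by simp
    qed
  qed
  have l: "1 \<le> l"
  proof (rule ccontr)
    assume "\<not> 1 \<le> l"
    then have "l = 0" by simp
    then have "q dvd p ^ k * M" using N dvds(3) by simp
    then have "q dvd p ^ k" using M(2) q prime_dvd_mult_iff by blast
    then have "q dvd p" using q prime_dvd_power by blast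
    then show False using primes_dvd_imp_eq[OF q p] pq by simp
  qed
  have qq: "N \<le> q * q * (q * q)" if "q * q dvd N"
  proof (rule ccontr)
    assume "\<not> N \<le> q * q * (q * q)"
    then have "q * q \<in> S" using that q1 by (auto simp: small_divisors_iff intro: less_1_mult)
    moreover have "q * q \<noteq> q" using q1 by simp
    ultimately have "p dvd q * q" using p_dvd by blast
    then have "p dvd q" using p prime_dvd_mult_iff by blast
    then show False using primes_dvd_imp_eq[OF p q] pq by simp
  qed
  have pk: "p * p \<le> p ^ k" using power_increasing[OF k, of p] p1 by (simp add: power2_eq_square)
  have ql: "q \<le> q ^ l" using power_increasing[OF l, of q] q1 by simp
  have pk1: "1 < p ^ k" using pk less_1_mult[OF p1 p1] by simp
  have K: "1 < p ^ k * q ^ l" using pk1 ql q1 by (intro less_1_mult) auto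
  show ?thesis
  proof (cases "M = 1")
    case False
    have large: "N \<le> r * r" if r: "prime r" "r dvd M" for r
    proof (rule ccontr)
      assume "\<not> N \<le> r * r"
      then have "r \<in> S" using r N prime_gt_1_int by (auto simp: small_divisors_iff)
      moreover have "r \<noteq> q" using r M by auto
      ultimately have "p dvd r" using p_dvd by blast
      then show False using primes_dvd_imp_eq[OF p r(1)] r pM by auto
    qed
    have "\<not> M dvd p ^ k * q ^ l"
    proof
      assume "M dvd p ^ k * q ^ l"
      moreover obtain r where r: "prime r" "r dvd M" using False M prime_factor_int[of M] by auto
      ultimately have "r dvd p ^ k * q ^ l" using dvd_trans by blast
      then have "r dvd p \<or> r dvd q" using r(1) prime_dvd_mult_iff prime_dvd_power by blast
      then have "r = p \<or> r = q" using r p q primes_dvd_imp_eq by blast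
      then show False using r M pM by auto
    qed
    moreover have "1 < M" using False M(3) by simp
    ultimately have *: "prime M" "p ^ k * q ^ l < M"
      using large_cofactor_prime[OF N K _ _ large] by simp_all
    \<comment> \<open>With \<open>l \<ge> 2\<close> the divisor \<open>q^2\<close> would be at most
      \<open>p^k * q^l\<close>, which is less than \<open>M\<close>, and hence small.\<close>
    have "l = 1"
    proof (rule ccontr)
      assume "l \<noteq> 1"
      then have "q ^ 2 \<le> q ^ l" using l q1 by (intro power_increasing) auto
      then have "1 * (q * q) \<le> p ^ k * q ^ l"
        using pk1 q1 by (intro mult_mono) (auto simp: power2_eq_square)
      then have h: "q * q \<le> p ^ k * q ^ l" by simp
      have "0 \<le> q * q" "0 \<le> p ^ k * q ^ l" using q1 p1 by simp_all
      then have "(q * q) * (q * q) \<le> (p ^ k * q ^ l) * (p ^ k * q ^ l)"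
        using mult_mono[OF h h] by blast
      also have "\<dots> < N" unfolding N using * K by (intro mult_strict_left_mono) auto
      finally have "q * q * (q * q) < N" .
      moreover have "q ^ 2 dvd N" unfolding N using l \<open>l \<noteq> 1\<close>
        by (intro dvd_mult2 dvd_mult le_imp_power_dvd) auto
      ultimately show False using qq by (simp add: power2_eq_square)
    qed
    have "p ^ k * q * (p ^ k * q) < N" unfolding N using * K \<open>l = 1\<close>
      by (simp only: power_one_right) (intro mult_strict_left_mono, auto)
    then have "p ^ k * q \<in> S" using N K \<open>l = 1\<close> by (simp add: small_divisors_iff)
    then obtain i where i: "i < m" "X i = p ^ k * q" using index by metis
    text \<open>The value \<open>p ^ k * q\<close> sits at index \<open>2 k + 1\<close>, right after \<open>p ^ (k + 1)\<close>, which does not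
      divide \<open>N\<close>.\<close>
    have mono: "X j < X (Suc j)" for j
    proof (cases "even j")
      case True
      then obtain t where "j = 2 * t" by blast
      then show ?thesis using powers[of t] pq p1 by simp
    next
      case False
      then obtain t where t: "j = Suc (2 * t)" using oddE by fastforce
      have "X (Suc j) = p ^ t * (p * p)" using powers(1)[of "Suc t"] t by (simp add: mult_ac)
      then show ?thesis using powers(2)[of t] t p2[OF pp] p1 by simp
    qed
    have "inj X" using mono strict_mono_Suc_iff strict_mono_imp_inj_on by blast
    moreover have "X i = X (Suc (2 * k))" using powers(2)[of k] i by simp
    ultimately have "i = Suc (2 * k)" by (simp add: inj_eq)
    then have "X (2 * k) \<in> S" using X_in[of "2 * k"] i by simp
    then have "p ^ k * p dvd p ^ k * (q * M)"
      using powers(1)[of k] N \<open>l = 1\<close> by (simp add: small_divisors_iff mult_ac)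
    then have "p dvd q * M" using p1 by simp
    then have "p dvd q" using p pM prime_dvd_mult_iff by blast
    then show ?thesis using primes_dvd_imp_eq[OF p q] pq by simp
  next
    case True
    then have N: "N = p ^ k * q ^ l" using N by simp
    have q2: "q < p\<^sup>2" using p2[OF pp] by (simp add: power2_eq_square)
    show ?thesis
    proof (cases "l = 1")
      case True
      have "form2 N p q k" if "k \<le> 3"
        using that N True p q pq k q2 by (auto simp: form2_def)
      moreover have "form4 N p q k" if "4 \<le> k"
        using that N True p q pq less_square_sqrt[OF q2] p1 by (auto simp: form4_def)
      moreover have "k \<le> 3 \<or> 4 \<le> k" by auto
      ultimately show ?thesis using listedI(2,4)[of N p q k] by blast
    next
      case False
      then have "2 \<le> l" using l by simp
      then obtain l' where l': "l = 2 + l'" using le_Suc_ex by blast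
      have "q ^ 2 dvd N" unfolding N l' power_add by simp
      then have "q * q * (p ^ k * q ^ l') \<le> q * q * (q * q)"
        using qq N l' by (simp add: power2_eq_square mult_ac power_add)
      then have le: "p ^ k * q ^ l' \<le> q * q" using q1 by simp
      have "l' = 0"
      proof (rule ccontr)
        assume "l' \<noteq> 0"
        then have "q ^ 1 \<le> q ^ l'" using q1 by (intro power_increasing) auto
        then have "p ^ k * q \<le> p ^ k * q ^ l'" using p1 by simp
        with le have "p ^ k * q \<le> q * q" by (rule order_trans[rotated])
        then have "p ^ k \<le> q" using q1 by simp
        then show False using pk p2[OF pp] by simp
      qed
      \<comment> \<open>From \<open>p^k \<le> q^2 < p^4\<close> only \<open>k = 2\<close> and
        \<open>k = 3\<close> remain, that is, forms 7 and 9.\<close>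
      have "p ^ k < p ^ 4"
      proof -
        have "q * q < (p * p) * (p * p)" using p2[OF pp] q1 by (intro mult_strict_mono) auto
        then show ?thesis using le \<open>l' = 0\<close> by (simp add: power4_eq_xxxx mult_ac)
      qed
      then have "k < 4" using p1 by simp
      then have "k = 2 \<or> k = 3" using k by auto
      then show ?thesis
      proof
        assume "k = 2"
        then have "form7 N p q" using N l' \<open>l' = 0\<close> p q pq q2 by (simp add: form7_def)
        then show ?thesis by (rule listedI(7))
      next
        assume "k = 3"
        then have "p ^ 3 \<le> q\<^sup>2" using le \<open>l' = 0\<close> by (simp add: power2_eq_square)
        moreover have "p ^ 3 \<noteq> q\<^sup>2" using distinct_prime_powers_neq[of p q 2 3] p q pq by auto
        ultimately have "form9 N p q"
          using N l' \<open>l' = 0\<close> \<open>k = 3\<close> p q pq q2 p1 q1 cube_less_square_powr[of p q]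
          by (simp add: form9_def)
        then show ?thesis by (rule listedI(9))
      qed
    qed
  qed
qed

section \<open>Lists in which a third prime precedes \<open>p * q\<close>\<close>

lemma X_2_eq_prime:
  assumes r: "prime r" "r dvd N" "q < r" "r < p * q" and pp: "p * p dvd N \<Longrightarrow> r < p * p"
    and least_r: "\<And>l. prime l \<Longrightarrow> l dvd N \<Longrightarrow> q < l \<Longrightarrow> r \<le> l"
  shows "2 < m" "X 2 = r"
proof -
  have rS: "r \<in> S" using S_downward[OF pqS] r prime_gt_1_int by auto
  have *: "r \<le> e" if e: "e \<in> S" "X 1 < e" for e
  proof (rule ccontr)
    assume "\<not> r \<le> e"
    then have "e < p * q" "e < r" using r by auto
    have eN: "e dvd N" using e by (simp add: small_divisors_iff)
    have "e \<noteq> p * p" using pp eN \<open>e < r\<close> by auto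
    then have "prime e" using below_pq[OF e(1) \<open>e < p * q\<close>] e(2) X_1(2) pq by auto
    then show False using least_r[of e] eN e(2) X_1(2) \<open>e < r\<close> by simp
  qed
  have "X 1 < r" unfolding X_1(2) by (rule r)
  then have "Suc 1 < m" "X (Suc 1) = r" using next_eq[OF rS X_1(1) _ *] by blast+
  then show "2 < m" "X 2 = r" by (simp_all add: numeral_2_eq_2)
qed

lemma X_3_eq_prime:
  assumes pp: "p * p dvd N" and r: "prime r" "r dvd N" "p * p < r" "r < p * q"
    and least_r: "\<And>l. prime l \<Longrightarrow> l dvd N \<Longrightarrow> q < l \<Longrightarrow> r \<le> l"
  shows "2 < m" "X 2 = p * p" "3 < m" "X 3 = r"
proof -
  have nr: "\<not> l < p * p" if "prime l" "l dvd N" "q < l" for l using least_r[OF that] r by simp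
  show X2: "2 < m" "X 2 = p * p" using X_2_eq_square[OF pp] nr by blast+
  have rS: "r \<in> S" using S_downward[OF pqS] r prime_gt_1_int by auto
  have *: "r \<le> e" if e: "e \<in> S" "X 2 < e" for e
  proof (rule ccontr)
    assume "\<not> r \<le> e"
    then have "e < p * q" "e < r" using r by auto
    have eN: "e dvd N" using e by (simp add: small_divisors_iff)
    have "q < e" "p * p < e" using e(2) X2(2) p2[OF pp] by auto
    then have "prime e" using below_pq[OF e(1) \<open>e < p * q\<close>] pq by auto
    then show False using least_r[of e] eN \<open>q < e\<close> \<open>e < r\<close> by simp
  qed
  have "X 2 < r" unfolding X2(2) by (rule r)
  then have "Suc 2 < m" "X (Suc 2) = r" using next_eq[OF rS X2(1) _ *] by blast+
  then show "3 < m" "X 3 = r" by (simp_all add: numeral_3_eq_3 numeral_2_eq_2)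
qed

lemma next_prime_le:
  assumes least_r: "\<And>l. prime l \<Longrightarrow> l dvd N \<Longrightarrow> q < l \<Longrightarrow> r \<le> l"
    and d: "d dvd N" "1 < d" "d < r * r" "\<not> p dvd d" "\<not> q dvd d" "1 < r"
  shows "prime d" "r \<le> d"
proof -
  have *: "r \<le> l" if l: "prime l" "l dvd d" for l
  proof -
    have "l \<noteq> p" "l \<noteq> q" "l dvd N" using l d by (auto intro: dvd_trans)
    then have "q < l" using least[of l] l by auto
    then show ?thesis using least_r l \<open>l dvd N\<close> by blast
  qed
  show "prime d" using d by (intro prime_if_less_square[of d r] *) auto
  then show "r \<le> d" using *[of d] by simp
qed

text \<open>The relation \<open>p^2 = a q + b p\<close> gives \<open>p dvd a\<close>, hence
  \<open>p\<close> divides \<open>X 4 = a r + b p^2\<close>. Every list element strictly between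
  \<open>r\<close> and \<open>p * q\<close> would be a prime larger than \<open>p\<close>.\<close>

lemma X_4_eq_pq:
  assumes pp: "p * p dvd N" and r: "prime r" "r dvd N" "p * p < r" "r < p * q"
    and least_r: "\<And>l. prime l \<Longrightarrow> l dvd N \<Longrightarrow> q < l \<Longrightarrow> r \<le> l"
  shows "4 < m" "X 4 = p * q"
proof -
  have X: "2 < m" "X 2 = p * p" "3 < m" "X 3 = r"
    using X_3_eq_prime[OF pp r] least_r by blast+
  have "p dvd a * q" using rec[of 0] X(2) X_0 X_1
    by (simp add: numeral_2_eq_2) (metis dvd_add_left_iff dvd_triv_left dvd_triv_right)
  then have "p dvd a" using p q pq primes_dvd_imp_eq prime_dvd_mult_iff by blast
  then have "p dvd X 4" using rec[of 2] X by (simp add: numeral_eq_Suc)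
  have "X 3 < p * q" using X r by simp
  then have 4: "Suc 3 < m" "X (Suc 3) \<le> p * q" using next_le[OF pqS X(3)] by auto
  then have "X 4 \<in> S" "X 3 < X 4" using X_in[of 4] increasing[of 3 4] by (auto simp: numeral_eq_Suc)
  have "\<not> X 4 < p * q"
  proof
    assume "X 4 < p * q"
    then have "X 4 = p \<or> X 4 = p * p \<or> prime (X 4) \<and> q \<le> X 4" using below_pq[OF \<open>X 4 \<in> S\<close>] by simp
    moreover have "q < X 4" using \<open>X 3 < X 4\<close> X r p2[OF pp] by simp
    moreover have "p * p < X 4" using \<open>X 3 < X 4\<close> X r by simp
    ultimately have "prime (X 4)" using pq by auto
    then have "X 4 = p" using \<open>p dvd X 4\<close> primes_dvd_imp_eq[OF p] by metis
    then show False using \<open>q < X 4\<close> pq by simp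
  qed
  then show "4 < m" "X 4 = p * q" using 4 by (auto simp: numeral_eq_Suc)
qed

text \<open>The converse of the computation for form 10: eliminating \<open>b\<close> or
  \<open>a\<close> from the first two relations gives Cramer's formulas, and the third relation
  becomes the quadratic equation for \<open>r\<close>.\<close>

lemma form10_relations:
  assumes X: "X 2 = p * p" "X 3 = r" "X 4 = p * q"
  shows "(q\<^sup>2 - p ^ 3) dvd p * q - r" "(q\<^sup>2 - p ^ 3) dvd r * q - p ^ 4"
    "(q\<^sup>2 - p ^ 3) * (p\<^sup>2 - q) = (p * q - r)\<^sup>2"
proof -
  have e: "p * p = a * q + b * p" "r = a * (p * p) + b * q" "p * q = a * r + b * (p * p)"
    using rec[of 0] rec[of 1] rec[of 2] X X_0 X_1 by (simp_all add: numeral_eq_Suc)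
  let ?D = "q\<^sup>2 - p ^ 3"
  have "p dvd a * q" using e(1) by (metis dvd_add_left_iff dvd_triv_left dvd_triv_right)
  then have "p dvd a" using p q pq primes_dvd_imp_eq prime_dvd_mult_iff by blast
  then obtain a' where a': "a = p * a'" by blast
  \<comment> \<open>Eliminates \<open>b\<close>: \<open>q\<close> times the first relation minus
    \<open>p\<close> times the second. The factor \<open>p\<close> cancels afterwards because it
    divides \<open>a\<close>.\<close>
  have A0: "p * (p * q - r) = ?D * a"
    using arg_cong2[of _ _ _ _ "(-)", OF arg_cong[of _ _ "(*) q", OF e(1)] arg_cong[of _ _ "(*) p", OF e(2)]]
    by (simp add: algebra_simps power2_eq_square power3_eq_cube)
  then have "p * (p * q - r) = p * (?D * a')" unfolding a' by simp
  then have "p * q - r = ?D * a'" using p1 by simp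
  then show "?D dvd p * q - r" by simp
  have B: "r * q - p ^ 4 = ?D * b"
    using arg_cong2[of _ _ _ _ "(-)", OF arg_cong[of _ _ "(*) q", OF e(2)] arg_cong[of _ _ "(*) (p * p)", OF e(1)]]
    by (simp add: algebra_simps power2_eq_square power3_eq_cube power4_eq_xxxx)
  then show "?D dvd r * q - p ^ 4" by simp
  have "?D * (p * q) = (?D * a) * r + (?D * b) * (p * p)"
    using e(3) by (simp add: algebra_simps)
  also have "\<dots> = p * (p * q - r) * r + (r * q - p ^ 4) * (p * p)"
    unfolding B A0 ..
  finally have "p * ((p * q - r)\<^sup>2) = p * (?D * (p\<^sup>2 - q))"
    by (simp add: algebra_simps power2_eq_square eval_nat_numeral)
  then show "?D * (p\<^sup>2 - q) = (p * q - r)\<^sup>2" using p1 by simp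
qed

lemma form10_if:
  assumes N: "N = p * p * q * r" and r: "prime r" "p * p < r" "r < p * q" and q2: "q < p * p"
    and X: "X 2 = p * p" "X 3 = r" "X 4 = p * q"
  shows "form10 N p q r"
proof -
  note rel = form10_relations[OF X]
  have "sqrt (real_of_int ((q\<^sup>2 - p ^ 3) * (p\<^sup>2 - q))) = \<bar>real_of_int (p * q - r)\<bar>"
    unfolding rel by simp
  also have "\<dots> = real_of_int (p * q - r)" using r by linarith
  finally have "real_of_int r = real_of_int (p * q) -
    sqrt (real_of_int ((q\<^sup>2 - p ^ 3) * (p\<^sup>2 - q)))" by simp
  then show ?thesis using rel(1,2) p q r pq q2 N
    by (simp add: form10_def power2_eq_square)
qed

lemma divisor_below_pq:
  assumes "d dvd N" "1 < d" "d < p * q"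
  shows "d = p \<or> d = p * p \<or> prime d \<and> q \<le> d"
  using below_pq[OF S_downward[OF pqS]] assms by simp

lemma least_divisor: "d dvd N \<Longrightarrow> 1 < d \<Longrightarrow> p \<le> d"
proof -
  assume "d dvd N" "1 < d"
  then obtain l where l: "prime l" "l dvd d" using prime_factor_int[of d] by auto
  then have "l \<le> d" using \<open>1 < d\<close> zdvd_imp_le by simp
  moreover have "p \<le> l" using least[of l] l pq dvd_trans[OF l(2) \<open>d dvd N\<close>] by (cases "l = p") auto
  ultimately show "p \<le> d" by simp
qed

text \<open>If \<open>N\<close> exceeds \<open>p^2 * q * r\<close>, the list reaches past
  \<open>p * q\<close>. Multiples of \<open>p\<close> then occupy exactly the even indices, and the
  recurrence of step two on their cofactors, read modulo \<open>p\<close>, leaves only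
  \<open>p = 2\<close> or \<open>p = 3\<close>. These are refuted numerically.\<close>

lemma listed_if_X_3_eq_prime:
  assumes pp: "p * p dvd N" and r: "prime r" "r dvd N" "p * p < r" "r < p * q"
    and least_r: "\<And>l. prime l \<Longrightarrow> l dvd N \<Longrightarrow> q < l \<Longrightarrow> r \<le> l"
  shows "listed N"
proof (cases "N = p * p * q * r")
  case True
  have "X 2 = p * p" "X 3 = r" "X 4 = p * q"
    using X_3_eq_prime[OF pp r] X_4_eq_pq[OF pp r] least_r by blast+
  then have "form10 N p q r" using form10_if[OF True r(1,3,4) p2[OF pp]] by simp
  then show ?thesis by (rule listedI(10))
next
  case False
  note r1 = prime_gt_1_int[OF r(1)] and q2 = p2[OF pp]
  have qr: "q < r" using q2 r by simp
  have X: "2 < m" "X 2 = p * p" "3 < m" "X 3 = r" "4 < m" "X 4 = p * q"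
    using X_3_eq_prime[OF pp r] X_4_eq_pq[OF pp r] least_r by blast+
  have e: "p * p = a * q + b * p" "r = a * (p * p) + b * q" "p * q = a * r + b * (p * p)"
    using rec[of 0] rec[of 1] rec[of 2] X X_0 X_1 by (simp_all add: numeral_eq_Suc)
  have "p dvd p * p - b * p" by simp
  then have "p dvd a * q" using e(1) by simp
  then have pa: "p dvd a" using p q pq primes_dvd_imp_eq prime_dvd_mult_iff by blast
  have pb: "\<not> p dvd b"
  proof
    assume "p dvd b"
    then have "p dvd r" using e(2) pa by simp
    then show False using primes_dvd_imp_eq[OF p r(1)] pq qr by simp
  qed
  have qb: "\<not> q dvd b"
  proof
    assume "q dvd b"
    then have "q dvd p * p" using e(1) by simp
    then show False using q p pq primes_dvd_imp_eq prime_dvd_mult_iff by blast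
  qed
  \<comment> \<open>As \<open>p\<close> divides \<open>a\<close> but not \<open>b\<close>, modulo
    \<open>p\<close> the recurrence reads \<open>X (i + 2) = b * X i\<close> with \<open>b\<close> a
    unit.\<close>
  have even: "p dvd X i \<longleftrightarrow> even i" for i
  proof (induction i rule: induct_nat_012)
    case 0
    then show ?case using X_0 by simp
  next
    case 1
    then show ?case using X_1 primes_dvd_imp_eq[OF p q] pq by auto
  next
    case (ge2 i)
    have "p dvd a * X (Suc i)" using pa by simp
    then have "p dvd X (Suc (Suc i)) \<longleftrightarrow> p dvd b * X i"
      unfolding rec[of i] by (rule dvd_add_right_iff)
    then show ?case using ge2(1) p pb prime_dvd_mult_iff by auto
  qed
  have nz: "\<not> (p dvd X i \<and> p dvd X (Suc i))" for i using even by simp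
  have "coprime (p * p) q" using p q pq by (simp add: primes_coprime)
  then have "p * p * q dvd N" using divides_mult[OF pp dvds(3)] by simp
  moreover have "coprime (p * p * q) r" using p q r pq qr by (simp add: primes_coprime)
  ultimately have "p * p * q * r dvd N" using divides_mult[OF _ r(2)] by simp
  then obtain t where t: "N = p * p * q * r * t" by blast
  have base: "0 < p * p * q * r" using p1 q1 r1 by simp
  have "t > 0" using t N1 base by (metis less_trans zero_less_mult_pos zero_less_one)
  moreover have "t \<noteq> 1" using False t by auto
  ultimately have "p \<le> t" using least_divisor[of t] t by simp
  have prS: "p * r \<in> S"
  proof -
    have "r * 1 < (p * q) * 1" using r by simp
    also have "\<dots> \<le> t * q" using \<open>p \<le> t\<close> q1 by simp
    finally have "(p * p * r) * r < (p * p * r) * (t * q)" using p1 r1 by (intro mult_strict_left_mono) auto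
    then show ?thesis using t less_1_mult[OF p1 r1] by (simp add: small_divisors_iff mult_ac)
  qed
  have "X 4 < p * r" using X qr p1 by simp
  then have 5: "Suc 4 < m" "X (Suc 4) \<le> p * r" using next_le[OF prS X(5)] by auto
  \<comment> \<open>The element after \<open>p * q\<close> has odd index, so \<open>p\<close> does
    not divide it, and \<open>q\<close> does not divide it either. Being below \<open>r^2\<close> it
    is prime, and this extra prime factor of \<open>N\<close> makes \<open>p^2 * q\<close>
    small.\<close>
  define s where "s = X 5"
  have s: "s \<in> S" "s \<le> p * r" "p * q < s"
    using 5 X_in[of 5] increasing[of 4 5] X by (simp_all add: s_def)
  have sN: "s dvd N" "1 < s" using s by (auto simp: small_divisors_iff)
  have "\<not> p dvd s" unfolding s_def even by simp
  have "\<not> q dvd s"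
  proof
    assume "q dvd s"
    moreover have "s = a * (p * q) + b * r" using rec[of 3] X by (simp add: s_def numeral_eq_Suc)
    ultimately have "q dvd b * r" by (simp add: dvd_add_right_iff)
    then show False using qb primes_dvd_imp_eq[OF q r(1)] qr prime_dvd_mult_iff[OF q] by auto
  qed
  have "p * r < r * r" using pq qr r1 by simp
  then have "s < r * r" using s by simp
  then have "prime s"
    using next_prime_le[OF least_r sN(1,2) _ \<open>\<not> p dvd s\<close> \<open>\<not> q dvd s\<close> r1] by blast
  have "coprime (p * p * q * r) s"
    using prime_imp_coprime[OF p \<open>\<not> p dvd s\<close>] prime_imp_coprime[OF q \<open>\<not> q dvd s\<close>]
      primes_coprime[OF r(1) \<open>prime s\<close>] s r by simp
  then have "p * p * q * r * s dvd N" 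
    using divides_mult[OF \<open>p * p * q * r dvd N\<close> sN(1)] by simp
  then have N_ge: "p * p * q * r * s \<le> N" using N1 zdvd_imp_le by simp
  have ppqS: "p * (p * q) \<in> S"
  proof -
    have "q < s" using s q_less_pq by simp
    have "(p * p) * q < r * s" using r r1 \<open>q < s\<close> p1 q1 by (intro mult_strict_mono) auto
    then have "(p * p * q) * (p * p * q) < (p * p * q) * (r * s)"
      using p1 q1 by (intro mult_strict_left_mono) auto
    also have "\<dots> \<le> N" using N_ge by (simp add: mult_ac)
    finally show ?thesis using \<open>p * p * q dvd N\<close> less_1_mult[OF p1 less_1_mult[OF p1 q1]]
      by (simp add: small_divisors_iff mult_ac)
  qed
  have adj1: "adjacent p 1 p" using adjacent_one[OF X_0(1) pS] square_dvd_S[OF pp] X_0 by simp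
  have adj2: "adjacent p p q"
    using adjacent_Suc[of 0 p] X_0 X_1 square_dvd_S[OF pp] pqS by simp
  have X2: "X (0 + 2) = p * p" "0 + 2 < m" using X by (simp_all add: numeral_2_eq_2)
  have gap: "i + 2 < m \<and> X (i + 2) = p * v" if "adjacent p u v" "i < m" "X i = p * u" "1 \<le> u" for i u v
    using adjacent_gap[OF p nz adj1 X_0(1) _ X2(2,1) that] X_0 by simp
  \<comment> \<open>Coefficient of the step two recurrence: for roots \<open>alpha\<close>,
    \<open>beta\<close> it is \<open>alpha^2 + beta^2\<close>.\<close>
  define V where "V = a * a + 2 * b"
  have V: "X (n + 4) = V * X (n + 2) - b * b * X n" for n
    using rec[of n] rec[of "n + 1"] rec[of "n + 2"]
    by (simp add: V_def numeral_eq_Suc algebra_simps)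
  have False
  \<comment> \<open>This decides whether the multiple of \<open>p\<close> after \<open>p * q\<close>
    is \<open>p * p^2\<close> or \<open>p * r\<close>.\<close>
  proof (cases "p * (p * p) dvd N")
    case True
    have "p * (p * p) \<in> S"
      using S_downward[OF prS _ _ True] r p1 less_1_mult[OF p1 less_1_mult[OF p1 p1]] by simp
    then have "adjacent p q (p * p)" using adjacent_Suc[of 1 p] X X_1 pqS by (simp add: numeral_2_eq_2)
    then have X6: "6 < m" "X 6 = p * (p * p)" using gap[of q "p * p" 4] X q1 by auto
    have "p * (p * p) = V * (p * q) - b * b * (p * p)" using V[of 2] X X6 by simp
    then have "p * (p * p) = p * (V * q - b * b * p)" by (simp add: algebra_simps)
    then have "p * p = V * q - b * b * p" using p1 by simp
    then have "V * q = p * (p + b * b)" by (simp add: algebra_simps)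
    then have "p dvd V * q" by simp
    then have "p dvd V" using p q pq primes_dvd_imp_eq prime_dvd_mult_iff by blast
    then have "p dvd 2 * b" using pa by (simp add: V_def dvd_add_right_iff)
    then have "p dvd 2" using pb p prime_dvd_mult_iff by blast
    then have p2: "p = 2" using p1 zdvd_imp_le[of p 2] by simp
    then have q3: "q = 3" using pq q2 by simp
    have "r = 5" using r p2 q3 by simp
    \<comment> \<open>The list \<open>2, 3, 4, 5\<close> has constant differences, so the recurrence
      is \<open>X (i + 2) = 2 X (i + 1) - X i\<close> and the list consists of consecutive
      integers.\<close>
    have ab: "a = 2" "b = - 1" using e p2 q3 \<open>r = 5\<close> by simp_all
    have "X i = int i + 2" for i
    proof (induction i rule: induct_nat_012)
      case (ge2 i)
      then show ?case using rec[of i] ab by simp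
    qed (use X_0 X_1 p2 q3 in simp_all)
    then show False using not_consecutive_integers X6 by auto
  next
    case False
    have "\<not> p * d dvd N" if d: "q < d" "d < r" for d
    proof
      assume "p * d dvd N"
      then have "d dvd N" by (rule dvd_mult_right)
      moreover have "\<not> (q < d \<and> d < p * p)" using no_divisor_between[of 1 d] X X_1 \<open>d dvd N\<close>
        by (auto simp: numeral_2_eq_2)
      moreover have "\<not> (p * p < d \<and> d < r)" using no_divisor_between[of 2 d] X \<open>d dvd N\<close>
        by (auto simp: numeral_3_eq_3 numeral_2_eq_2)
      ultimately have "d = p * p" using d by linarith
      then show False using False \<open>p * d dvd N\<close> by simp
    qed
    then have "adjacent p q r" using pqS prS qr by (simp add: adjacent_def)
    then have X6: "6 < m" "X 6 = p * r" using gap[of q r 4] X q1 by auto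
    have "adjacent p r (p * q)" using adjacent_Suc[of 3 p] X prS ppqS by (simp add: numeral_eq_Suc)
    then have X8: "X 8 = p * (p * q)" using gap[of r "p * q" 6] X6 r1 by auto
    have "X 4 = V * X 2 - b * b * X 0" using V[of 0] by (simp add: numeral_2_eq_2)
    then have "p * q = V * (p * p) - b * b * p" "p * r = V * (p * q) - b * b * (p * p)"
      "p * (p * q) = V * (p * r) - b * b * (p * q)"
      using V[of 2] V[of 4] X X6 X8 X_0 by simp_all
    then have "p * q = p * (V * p - b * b)" "p * r = p * (V * q - b * b * p)"
      "p * (p * q) = p * (V * r - b * b * q)" by (simp_all add: algebra_simps)
    then have E: "q = V * p - b * b" "r = V * q - b * b * p" "p * q = V * r - b * b * q"
      using p1 by simp_all
    \<comment> \<open>Substituting \<open>r\<close> into the last relation gives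
      \<open>p dvd V^2 - b^2\<close>. Since \<open>V\<close> is congruent to \<open>2 b\<close>
      modulo \<open>p\<close>, this means \<open>p dvd 3 b^2\<close>.\<close>
    have "q * (V * V - b * b) = p * (q + V * b * b)"
      using E(3) unfolding E(2) by (simp add: algebra_simps)
    then have "p dvd q * (V * V - b * b)" by simp
    then have "p dvd V * V - b * b" using p q pq primes_dvd_imp_eq prime_dvd_mult_iff by blast
    moreover have "V * V - b * b = a * (a * a * a + 4 * a * b) + 3 * (b * b)"
      by (simp add: V_def algebra_simps)
    ultimately have "p dvd 3 * (b * b)" using pa by (simp add: dvd_add_right_iff)
    then have "p dvd 3" using pb p prime_dvd_mult_iff by blast
    then have "p \<le> 3" using zdvd_imp_le[of p 3] by simp
    then have "p = 2 \<or> p = 3" using p1 by auto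
    then have p3: "p = 3" using \<open>p dvd 3\<close> by auto
    have "q \<in> {4..8}" using pq q2 p3 by simp
    moreover have "\<not> even q" using q q1 p3 pq primes_dvd_imp_eq[of 2 q] by auto
    ultimately have "q = 5 \<or> q = 7" by (auto simp: atLeastAtMost_iff) presburger
    \<comment> \<open>The left side is \<open>-8\<close> for \<open>q = 5\<close> and
      \<open>44\<close> for \<open>q = 7\<close>; neither is a square.\<close>
    have sq: "(q\<^sup>2 - 27) * (9 - q) = (p * q - r)\<^sup>2"
      using form10_relations(3)[OF X(2,4,6)] p3 by simp
    from \<open>q = 5 \<or> q = 7\<close> show False
    proof
      assume "q = 5"
      then have "(p * q - r)\<^sup>2 < 0" using sq by simp
      then show False by (simp add: not_less [symmetric])
    next
      assume q7: "q = 7"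
      define y where "y = p * q - r"
      have y: "y * y = 44" using sq q7 by (simp add: y_def power2_eq_square)
      have "0 < y" using r by (simp add: y_def)
      have "y < 7" using square_less_square_iff[of y 7] y \<open>0 < y\<close> by simp
      moreover have "6 < y" using square_less_square_iff[of 6 y] y \<open>0 < y\<close> by simp
      ultimately show False by simp
    qed
  qed
  then show ?thesis ..
qed

end

section \<open>Three small primes\<close>

text \<open>The assumptions say that the list starts with \<open>p, q, r\<close>. They turn out to
  be inconsistent; everything below works towards that contradiction.\<close>

locale third_small_prime = two_small_primes +
  fixes r :: int
  assumes r: "prime r" "r dvd N" "q < r" "r < p * q" and r_less: "p * p dvd N \<Longrightarrow> r < p * p"
    and least_r: "\<And>l. prime l \<Longrightarrow> l dvd N \<Longrightarrow> q < l \<Longrightarrow> r \<le> l"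
begin

lemma r1: "1 < r" using prime_gt_1_int r by auto

lemma X_2: "2 < m" "X 2 = r"
  using X_2_eq_prime[OF r r_less] least_r by blast+

lemma rec_0: "r = a * q + b * p"
  using rec[of 0] X_2 X_1 X_0 by (simp add: numeral_2_eq_2)

lemma X_3: "3 < m" "\<not> r dvd X 3" "X 3 \<le> p * q"
proof -
  have "X 2 < p * q" using X_2 r by simp
  then have 3: "Suc 2 < m" "X (Suc 2) \<le> p * q" using next_le[OF pqS X_2(1)] by auto
  then show 3: "3 < m" "X 3 \<le> p * q" by (simp_all add: numeral_3_eq_3 numeral_2_eq_2)
  show "\<not> r dvd X 3"
  proof
    assume "r dvd X 3"
    then obtain f where f: "X 3 = r * f" by blast
    have "r < X 3" using increasing[of 2 3] 3 X_2 by simp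
    then have "1 < f" using f r1 by simp
    moreover have "f dvd N" using X_in[OF 3(1)] f by (auto simp: small_divisors_iff)
    ultimately have "p \<le> f" using least_divisor by simp
    then have "r * p \<le> r * f" using r1 by simp
    then have "r * p \<le> p * q" using 3 f by simp
    then show False using r p1 by (simp add: mult.commute)
  qed
qed

lemma X_3_eq: "X 3 = a * r + b * q"
  using rec[of 1] X_2 X_1 by (simp add: numeral_3_eq_3 numeral_2_eq_2)

text \<open>Modulo a prime dividing \<open>b\<close> the recurrence is
  \<open>X (i + 2) = a * X (i + 1)\<close>, so a zero at index 3 or later would force
  \<open>l dvd a\<close> or an earlier zero. A zero at index 2 means \<open>l = r\<close>, and then
  \<open>r dvd a\<close> and \<open>r dvd X 3\<close>, which is false.\<close>

lemma prime_dvd_b: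
  assumes l: "prime l" "l dvd b"
  shows "\<not> l dvd X (Suc (Suc i))"
proof (induction i)
  case 0
  have "\<not> l dvd r"
  proof
    assume "l dvd r"
    then have [simp]: "l = r" using primes_dvd_imp_eq l r by blast
    have "r dvd r - b * p" using l by simp
    then have "r dvd a * q" using rec_0 by simp
    then have "r dvd a" using primes_dvd_imp_eq[OF r(1) q] r prime_dvd_mult_iff[OF r(1)] by auto
    then show False using X_3(2) X_3_eq l by simp
  qed
  then show ?case using X_2 by (simp add: numeral_2_eq_2)
next
  case (Suc i)
  show ?case
  proof
    assume "l dvd X (Suc (Suc (Suc i)))"
    then have "l dvd a * X (Suc (Suc i)) + b * X (Suc i)" using rec by simp
    then have "l dvd a * X (Suc (Suc i))" using l by (simp add: dvd_add_left_iff)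
    then have "l dvd a" using Suc l prime_dvd_mult_iff by blast
    then have "l dvd X (Suc (Suc i))" using rec[of i] l by simp
    then show False using Suc by simp
  qed
qed

text \<open>A prime not dividing \<open>b\<close> lets the recurrence run backwards, so a common
  factor would descend to \<open>p\<close> and \<open>q\<close>. Primes dividing \<open>b\<close>
  are excluded by \<open>prime_dvd_b\<close>.\<close>

lemma no_common_prime: "prime l \<Longrightarrow> \<not> (l dvd X i \<and> l dvd X (Suc i))"
proof (induction i)
  case 0
  then show ?case using X_0 X_1 primes_dvd_imp_eq[of l p] primes_dvd_imp_eq[of l q] p q pq by auto
next
  case (Suc i)
  show ?case
  proof
    assume *: "l dvd X (Suc i) \<and> l dvd X (Suc (Suc i))"
    then have "\<not> l dvd b" using prime_dvd_b[OF Suc(2)] by blast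
    have "l dvd X (Suc (Suc i)) - a * X (Suc i)" using * by simp
    then have "l dvd b * X i" using rec[of i] by simp
    then have "l dvd X i" using \<open>\<not> l dvd b\<close> Suc(2) prime_dvd_mult_iff by blast
    then show False using * Suc by blast
  qed
qed

lemma coprime_pqr: "coprime p q" "coprime p r" "coprime q r"
  using p q r pq by (auto intro: primes_coprime)

lemma pqr_dvd: "p * q * r dvd N"
proof (rule divides_mult)
  show "coprime (p * q) r" using coprime_pqr by simp
qed (use dvds r in auto)

lemma index_pq:
  obtains R where "R < m" "X R = p * q" "3 \<le> R"
proof -
  obtain R where R: "R < m" "X R = p * q" using index[OF pqS] .
  have "X 2 < X R" using R X_2 r by simp
  then have "2 < R" using X_less_iff X_2 R by blast
  then have "3 \<le> R" by simp
  then show thesis using that R by blast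
qed

lemma X_Suc_gt:
  assumes "R < m" "X R = p * q" "Suc R < m"
  shows "\<not> p dvd X (Suc R)" "\<not> q dvd X (Suc R)" "p * q < X (Suc R)"
  using no_common_prime[OF p, of R] no_common_prime[OF q, of R] increasing[of R "Suc R"] assms by auto

lemma p_less_r: "p < r" using pq r by simp

lemma adjacent_0: "l \<in> S \<Longrightarrow> l * p \<in> S \<Longrightarrow> adjacent l 1 p"
  using adjacent_one X_0 by simp

lemma adjacent_1: "l * p \<in> S \<Longrightarrow> l * q \<in> S \<Longrightarrow> adjacent l p q"
  using adjacent_Suc[of 0 l] X_0 X_1 by simp

lemma adjacent_2: "l * q \<in> S \<Longrightarrow> l * r \<in> S \<Longrightarrow> adjacent l q r"
  using adjacent_Suc[of 1 l] X_2 X_1 by (simp add: numeral_2_eq_2)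

lemma rS: "r \<in> S" using S_downward[OF pqS] r r1 by simp

text \<open>Otherwise \<open>p * q\<close>, at index \<open>R\<close>, is the second multiple of
  \<open>p\<close> (from index 0, gap \<open>R\<close>) and of \<open>q\<close> (from index 1, gap
  \<open>R - 1\<close>). This places \<open>p * r\<close> at \<open>2 R\<close>, hence the gap for
  \<open>r\<close> is \<open>2 R - 2\<close> and \<open>r * q\<close> sits at
  \<open>4 R - 2\<close>, which is no index of a multiple of \<open>q\<close>.\<close>

lemma p_squared_dvd: "p * p dvd N"
proof (rule ccontr)
  assume np: "\<not> p * p dvd N"
  obtain t where t: "N = p * q * r * t" using pqr_dvd by blast
  have pos: "0 < p" "0 < q" "0 < r" "0 < p * q" "0 < p * q * r" using p1 q1 r1 by simp_all
  have t0: "0 < t" using t N1 pos by (metis less_trans zero_less_mult_pos zero_less_one)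
  have "p * q * (p * q) < p * q * (r * t)" using pqS t by (simp add: small_divisors_iff mult_ac)
  then have "p * q < r * t" using pos(4) by (simp only: mult_less_cancel_left_pos)
  then have "t \<noteq> 1" using r by auto
  have pt: "\<not> p dvd t"
  proof
    assume "p dvd t"
    then have "p * p dvd p * (q * r * t)" by (intro mult_dvd_mono) auto
    then show False using np t by (simp add: mult_ac)
  qed
  have tN: "t dvd N" using t by simp
  have prN: "p * r dvd N" using t by (simp add: mult_ac)
  obtain R where R: "R < m" "X R = p * q" "3 \<le> R" using index_pq .
  \<comment> \<open>If \<open>p * r\<close> were not small, size would force
    \<open>N = p * q^2 * r\<close> with \<open>q^2\<close> small. The element after
    \<open>p * q\<close> is coprime to \<open>p\<close> and \<open>q\<close>, so it would divide
    \<open>r\<close>, which is below \<open>p * q\<close>.\<close>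
  have prS: "p * r \<in> S"
  proof (rule ccontr)
    assume "p * r \<notin> S"
    then have "N \<le> p * r * (p * r)" using prN less_1_mult[OF p1 r1] by (auto simp: small_divisors_iff)
    then have "(p * r) * (q * t) \<le> (p * r) * (p * r)" using t by (simp add: mult_ac)
    then have le: "q * t \<le> p * r" using p1 r1 by simp
    also have "\<dots> < p * (p * q)" using r p1 by simp
    finally have "q * t < q * (p * p)" by (simp add: mult_ac)
    then have "t < p * p" using q1 by simp
    also have "\<dots> < q * q" using pq p1 by (intro mult_strict_mono) auto
    finally have "prime t" "q \<le> t" using prime_if_not_dvd[OF tN _ _ pt] t0 \<open>t \<noteq> 1\<close> by auto
    have "p * r < q * r" using pq r1 by simp
    then have "q * t < q * r" using le by simp
    then have "t < r" using q1 by simp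
    then have "t = q" using least_r[OF \<open>prime t\<close> tN] \<open>q \<le> t\<close> \<open>t < r\<close> by (cases "q < t") simp_all
    then have N: "N = (p * r) * (q * q)" using t by (simp add: mult_ac)
    have "q * q \<noteq> p * r"
    proof
      assume "q * q = p * r"
      then have "p dvd q * q" by simp
      then show False using p q pq primes_dvd_imp_eq prime_dvd_mult_iff by blast
    qed
    then have less: "q * q < p * r" using le \<open>t = q\<close> by simp
    then have "q * q * (q * q) < N" unfolding N using q1 by simp
    then have qqS: "q * q \<in> S" using N less_1_mult[OF q1 q1] by (simp add: small_divisors_iff)
    have "X R < q * q" using R pq q1 by simp
    then have 1: "Suc R < m" "X (Suc R) \<le> q * q" using next_le[OF qqS R(1)] by auto
    note 2 = X_Suc_gt[OF R(1,2) 1(1)]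
    have c: "coprime (X (Suc R)) p" "coprime (X (Suc R)) q"
      using 2 p q prime_imp_coprime coprime_commute by blast+
    have "X (Suc R) dvd p * (q * q) * r" using X_in[OF 1(1)] N by (simp add: small_divisors_iff mult_ac)
    then have "X (Suc R) dvd r" using c by (simp add: coprime_dvd_mult_right_iff mult.assoc)
    then have "X (Suc R) \<le> r" using r1 zdvd_imp_le by simp
    then show False using 2 r by simp
  qed
  have nzp: "\<And>i. \<not> (p dvd X i \<and> p dvd X (Suc i))" and nzq: "\<And>i. \<not> (q dvd X i \<and> q dvd X (Suc i))"
    and nzr: "\<And>i. \<not> (r dvd X i \<and> r dvd X (Suc i))"
    using no_common_prime p q r by blast+
  have "\<not> p * d dvd N" if d: "1 < d" "d < q" for d
  proof
    assume d': "p * d dvd N"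
    then have "d dvd N" by (rule dvd_mult_right)
    then have "d = p \<or> d = p * p" using divisor_below_pq[of d] d q_less_pq by simp
    then have "d = p" using np \<open>d dvd N\<close> by auto
    then show False using np d' by simp
  qed
  then have adj_p: "adjacent p 1 q" using pS pqS q1 by (simp add: adjacent_def)
  have p2R: "2 * R < m" "X (2 * R) = p * r"
  proof -
    have "X 0 = p * 1" "0 + R < m" "X (0 + R) = p * q" "1 \<le> q" using X_0 R q1 by simp_all
    note gap = adjacent_gap[OF p nzp adj_p X_0(1) this(1-3) adjacent_2[OF pqS prS] R(1,2) this(4)]
    then show "2 * R < m" "X (2 * R) = p * r" by (simp_all add: mult_2)
  qed
  have zq: "q dvd X (1 + n) \<longleftrightarrow> (R - 1) dvd n" for n
  proof -
    have "q * p \<in> S" "X 1 = q * 1" "1 + (R - 1) < m" "X (1 + (R - 1)) = q * p"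
      using X_1 R pqS by (simp_all add: mult.commute)
    then show ?thesis using adjacent_zeros[OF q nzq adjacent_0[OF qS] X_1(1)] by blast
  qed
  \<comment> \<open>The index \<open>2 R - 1 = 1 + 2 (R - 1)\<close> carries a multiple of
    \<open>q\<close> just before \<open>p * r\<close>; its cofactor lies strictly between
    \<open>p\<close> and \<open>r\<close>, hence is \<open>q\<close>.\<close>
  define d where "d = X (2 * R - 1) div q"
  have "q dvd X (1 + 2 * (R - 1))" unfolding zq by simp
  moreover have "1 + 2 * (R - 1) = 2 * R - 1" using R(3) by simp
  ultimately have "q dvd X (2 * R - 1)" by (simp only:)
  then have d: "X (2 * R - 1) = q * d" by (simp add: d_def)
  have "X R < X (2 * R - 1)" "X (2 * R - 1) < X (2 * R)" 
    using increasing[of R "2 * R - 1"] increasing[of "2 * R - 1" "2 * R"] R(3) p2R(1) by simp_all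
  then have "p * q < q * d" "q * d < p * r" using d R p2R by simp_all
  moreover have "p * r < q * r" using pq r1 by simp
  ultimately have "q * p < q * d" "q * d < q * r" by (simp only: mult.commute, linarith)
  then have "p < d" "d < r" using q1 by simp_all
  have "X (2 * R - 1) \<in> S" using p2R by (intro X_in) simp
  then have qdN: "q * d dvd N" using d by (simp add: small_divisors_iff)
  then have dN: "d dvd N" by (rule dvd_mult_right)
  have "d = p \<or> d = p * p \<or> prime d \<and> q \<le> d"
    using divisor_below_pq[OF dN] \<open>p < d\<close> p1 \<open>d < r\<close> r by simp
  then have "prime d" "q \<le> d" using np dN \<open>p < d\<close> by auto
  then have "d = q" using least_r[of d] dN \<open>d < r\<close> by (cases "q < d") auto
  then have qqN: "q * q dvd N" using qdN by simp
  have SR: "Suc R < 2 * R" using R by simp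
  then have "Suc R < m" using p2R by simp
  \<comment> \<open>The prime right after \<open>p * q\<close> is a further factor of
    \<open>N\<close>, large enough to make \<open>q * r\<close> small.\<close>
  define s where "s = X (Suc R)"
  have s: "\<not> p dvd s" "\<not> q dvd s" "p * q < s" "s \<in> S"
    using X_Suc_gt[OF R(1,2) \<open>Suc R < m\<close>] X_in[OF \<open>Suc R < m\<close>] by (simp_all add: s_def)
  have "s < p * r" using increasing[OF SR p2R(1)] p2R by (simp add: s_def)
  then have "s < r * r" using p_less_r r1 mult_strict_right_mono[of p r r] by linarith
  have sN: "s dvd N" "1 < s" using s by (auto simp: small_divisors_iff)
  have "prime s"
    using next_prime_le[OF least_r sN \<open>s < r * r\<close> s(1,2) r1] by blast
  have "coprime p s" "coprime q s" using s p q prime_imp_coprime by blast+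
  moreover have "coprime r s" using primes_coprime[OF r(1) \<open>prime s\<close>] s r by auto
  moreover have "p * (q * q) dvd N" using divides_mult[OF dvds(2) qqN] coprime_pqr by simp
  then have "p * (q * q) * r dvd N" using divides_mult[OF _ r(2)] coprime_pqr by simp
  ultimately have "p * (q * q) * r * s dvd N" using divides_mult[OF _ sN(1)] by simp
  then have N_ge: "p * (q * q) * r * s \<le> N" using N1 zdvd_imp_le by simp
  have "r * 1 < s * p" using s sN r p1 by (intro mult_strict_mono) auto
  then have "(q * q * r) * r < (q * q * r) * (s * p)" using q1 r1 by simp
  then have "q * r * (q * r) < N" using N_ge by (simp add: mult_ac)
  moreover have "q * r dvd N" using t by (simp add: mult_ac)
  ultimately have qrS: "q * r \<in> S" using less_1_mult[OF q1 r1] by (simp add: small_divisors_iff)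
  have adj_r: "adjacent r 1 p" "adjacent r p q"
    using adjacent_0[OF rS] adjacent_1[of r] prS qrS by (simp_all add: mult.commute)
  \<comment> \<open>The step from \<open>r\<close> at index 2 to \<open>r * p\<close> at index
    \<open>2 R\<close> is repeated once.\<close>
  have "X (2 * R + (2 * R - 2)) = r * q"
  proof -
    have "2 + (2 * R - 2) = 2 * R" using R(3) by simp
    moreover have "X (2 * R) = r * p" using p2R by simp
    ultimately have "X 2 = r * 1" "2 + (2 * R - 2) < m" "X (2 + (2 * R - 2)) = r * p" "X (2 * R) = r * p" "1 \<le> p"
      using X_2 p2R p1 by (simp_all only: mult_1_right)
    then show ?thesis
      using adjacent_gap(2)[OF r(1) nzr adj_r(1) X_2(1) _ _ _ adj_r(2) p2R(1)] by blast
  qed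
  then have "q dvd X (2 * R + (2 * R - 2))" by simp
  moreover have "2 * R + (2 * R - 2) = 1 + (4 * (R - 1) + 1)" using R by simp
  ultimately have "(R - 1) dvd 4 * (R - 1) + 1" using zq by simp
  then have "R - 1 dvd 1" by (subst (asm) dvd_add_right_iff) simp_all
  then show False using R by simp
qed

end

section \<open>Exact prime powers and the refutation of lists starting with
  \<open>p, q, r\<close>\<close>

lemma mult_dvd_if_not_prime_power_dvd:
  fixes l :: int
  assumes "prime l" "N = l ^ e * M" "u dvd N" "\<not> l ^ e dvd u"
  shows "l * u dvd N"
proof -
  obtain c where c: "N = u * c" using assms(3) by blast
  have "l dvd c"
  proof (rule ccontr)
    assume "\<not> l dvd c"
    then have "coprime (l ^ e) c" using assms(1) prime_imp_coprime by auto
    moreover have "l ^ e dvd u * c" using assms(2) c by simp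
    ultimately show False using assms(4) coprime_dvd_mult_left_iff by blast
  qed
  then show ?thesis using c by (auto simp: mult_ac)
qed

context third_small_prime
begin

text \<open>The multiples of a prime \<open>l\<close> in the list are \<open>l\<close> times the divisors \<open>1, X 0, X 1, \<dots>\<close>, at
  equidistant indices, so these divisors satisfy a recurrence of their own. It agrees with the
  original one, as both generate \<open>p, q, r, X 3\<close>; but it must skip the largest power of \<open>l\<close>
  dividing \<open>N\<close>.\<close>

lemma no_small_prime_power:
  assumes l: "prime l" "X 3 < l" and N: "N = l ^ e * M" "\<not> l dvd M" and e: "1 \<le> e"
    and pl: "p * l ^ e dvd N" and small: "(p * l ^ e * l) * (p * l ^ e * l) < N"
  shows False
proof -
  note l1 = prime_gt_1_int[OF l(1)]
  define F where "F = l ^ e"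
  have F: "l \<le> F" using power_increasing[OF e, of l] l1 by (simp add: F_def)
  have pF: "p * F < p * F * l" using p1 F l1 by simp
  have "0 < p * F" using p1 F l1 by simp
  then have "p * F * (p * F) < (p * F * l) * (p * F * l)" 
    using mult_strict_mono[OF pF pF] pF by linarith
  then have "p * F * (p * F) < N" using small by (simp add: F_def)
  then have pFS: "p * F \<in> S" using pl less_1_mult[OF p1, of F] F l1
    by (simp add: small_divisors_iff F_def)
  have "1 * F < p * F" using p1 F l1 by (intro mult_strict_right_mono) auto
  then have F_less: "F < p * F" by simp
  have FS: "F \<in> S" using S_downward[OF pFS] F_less F l1 N by (simp add: F_def)
  \<comment> \<open>A divisor up to \<open>p * F\<close> that is not a multiple of \<open>F\<close>
    can absorb one more factor \<open>l\<close>, and \<open>small\<close> keeps the product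
    small.\<close>
  have lS: "l * u \<in> S" if u: "u dvd N" "0 < u" "u \<le> p * F" "\<not> F dvd u" for u
  proof -
    have "l * u dvd N" using mult_dvd_if_not_prime_power_dvd[OF l(1) N(1) u(1)] u(4) by (simp add: F_def)
    moreover have h: "l * u \<le> p * F * l" using u l1 by (simp add: mult.commute)
    have "0 \<le> l * u" "0 \<le> p * F * l" using u l1 \<open>0 < p * F\<close> pF by simp_all
    then have "l * u * (l * u) \<le> (p * F * l) * (p * F * l)" using mult_mono[OF h h] by blast
    then have "l * u * (l * u) < N" using small by (simp add: F_def)
    moreover have "l * 1 \<le> l * u" using u l1 by (intro mult_left_mono) auto
    then have "1 < l * u" using l1 by linarith
    ultimately show ?thesis by (simp add: small_divisors_iff)
  qed
  have X_N: "X i dvd N" "0 < X i" if "i < m" for i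
    using X_in[OF that] by (auto simp: small_divisors_iff)
  have lX: "l * X i \<in> S" if "i < m" "X i < F" for i
    using lS[of "X i"] X_N[OF that(1)] that F_less zdvd_imp_le[of F "X i"] by auto
  have X3S: "X i \<in> S" "X i < F" if "i \<le> 3" for i
    using that X_in[of i] X_3(1) increasing[of i 3] l(2) F by (cases "i = 3"; simp)+
  have lX3: "l * X i \<in> S" if "i \<le> 3" for i using lX[of i] X3S[OF that] that X_3(1) by simp
  have lS1: "l \<in> S" using S_downward[OF FS l1 F] N e by (simp add: F_def dvd_power_le)
  have adj: "adjacent l 1 (X 0)" "adjacent l (X 0) (X 1)" "adjacent l (X 1) (X 2)" "adjacent l (X 2) (X 3)"
    using adjacent_one[OF X_0(1) lS1] lX3 adjacent_Suc[of 0 l] adjacent_Suc[of 1 l] adjacent_Suc[of 2 l]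
      X_3(1) by (simp_all add: numeral_2_eq_2 numeral_3_eq_3)
  have nzl: "\<And>i. \<not> (l dvd X i \<and> l dvd X (Suc i))" using no_common_prime l by blast
  obtain V W where VW: "\<And>u v w. 1 \<le> u \<Longrightarrow> adjacent l u v \<Longrightarrow> adjacent l v w \<Longrightarrow> w = V * v + W * u"
    using adjacent_recurrence[OF l(1) nzl adj(1)] by blast
  have pos: "1 \<le> X i" if "i < m" for i using X_N(2)[OF that] by simp
  have "X 2 = V * X 1 + W * X 0" "X 3 = V * X 2 + W * X 1"
    using VW[OF _ adj(2,3)] VW[OF _ adj(3,4)] pos[OF X_0(1)] pos[OF X_1(1)] by blast+
  then have rel: "r = V * q + W * p" "X 3 = V * r + W * q" using X_0 X_1 X_2 by simp_all
  then have 1: "(V - a) * q = (b - W) * p" "(V - a) * r = (b - W) * q"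
  proof -
    have "(V - a) * q - (b - W) * p = (V * q + W * p) - (a * q + b * p)"
      "(V - a) * r - (b - W) * q = (V * r + W * q) - (a * r + b * q)"
      by (simp_all add: algebra_simps)
    then show "(V - a) * q = (b - W) * p" "(V - a) * r = (b - W) * q"
      using rel rec_0 X_3_eq by linarith+
  qed
  \<comment> \<open>The differences \<open>V - a\<close> and \<open>b - W\<close> solve a
    homogeneous system with determinant \<open>p r - q^2\<close>, which is nonzero because
    \<open>p\<close> does not divide \<open>q\<close>.\<close>
  have "(V - a) * (q * q) = ((V - a) * q) * q" by (simp add: mult_ac)
  also have "\<dots> = ((b - W) * q) * p" unfolding 1 by (simp add: mult_ac)
  also have "\<dots> = (V - a) * (r * p)" unfolding 1(2)[symmetric] by (simp add: mult_ac)
  finally have "V - a = 0 \<or> q * q = r * p" by (simp only: mult_cancel_left)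
  moreover have "q * q \<noteq> r * p"
  proof
    assume "q * q = r * p"
    then have "p dvd q * q" by simp
    then show False using p q pq primes_dvd_imp_eq prime_dvd_mult_iff by blast
  qed
  ultimately have "V = a" by simp
  then have "(b - W) * p = 0" using 1(1) by simp
  then have "W = b" using p1 by simp
  obtain k where k: "k < m" "X k = F" using index[OF FS] .
  have "X 3 < X k" using k X3S(2)[of 3] by simp
  then have "3 < k" using X_less_iff[OF X_3(1) k(1)] by simp
  then have "k = Suc (Suc (k - 2))" by simp
  then obtain i where i: "k = Suc (Suc i)" by blast
  have "X k < p * F" using k F_less by simp
  then have next_k: "Suc k < m" "X (Suc k) \<le> p * F" using next_le[OF pFS k(1)] by auto
  have "\<not> F dvd X (Suc k)"
  proof
    assume "F dvd X (Suc k)"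
    moreover have "l dvd F" using e by (simp add: F_def)
    ultimately have "l dvd X k \<and> l dvd X (Suc k)" using k dvd_trans[of l F] by simp
    then show False using nzl by blast
  qed
  then have lXSk: "l * X (Suc k) \<in> S" using lS[OF _ _ next_k(2)] X_N[OF next_k(1)] by simp
  have less: "X i < X (Suc i)" "X (Suc i) < X k"
    using i k increasing[of i "Suc i"] increasing[of "Suc i" k] by simp_all
  have lXi: "l * X i \<in> S" "l * X (Suc i) \<in> S"
    using lX[of i] lX[of "Suc i"] less k i by auto
  have adj_i: "adjacent l (X i) (X (Suc i))" using adjacent_Suc[of i l] lXi k i by simp
  have "\<not> l * d dvd N" if d: "X (Suc i) < d" "d < X (Suc k)" for d
  proof
    assume *: "l * d dvd N"
    then have dN: "d dvd N" by (rule dvd_mult_right)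
    have "\<not> d < X k" using no_divisor_between[of "Suc i" d] d k i dN by auto
    moreover have "\<not> X k < d" using no_divisor_between[of k d] d next_k dN by auto
    ultimately have "d = F" using k by simp
    then have "l ^ e * l dvd l ^ e * M" using * N(1) by (simp add: F_def mult.commute)
    then have "l dvd M" using l1 by simp
    then show False using N(2) by simp
  qed
  then have adj_k: "adjacent l (X (Suc i)) (X (Suc k))"
    using lXi(2) lXSk less increasing[of k "Suc k"] next_k by (simp add: adjacent_def)
  \<comment> \<open>Around \<open>F = X k\<close> the quotients run \<open>X (k - 2)\<close>,
    \<open>X (k - 1)\<close>, \<open>X (k + 1)\<close>. The common recurrence thus computes both
    \<open>X k\<close> and \<open>X (k + 1)\<close> from the same two predecessors.\<close>
  have "X (Suc k) = V * X (Suc i) + W * X i"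
    using VW[OF _ adj_i adj_k] pos[of i] k i by simp
  then have "X (Suc k) = X k" using rec[of i] i \<open>V = a\<close> \<open>W = b\<close> by simp
  then show False using increasing[of k "Suc k"] next_k by simp
qed

text \<open>\<open>no_small_prime_power\<close> needs a prime \<open>l\<close> above
  \<open>X 3\<close> whose exact power is small compared with \<open>N\<close>. With
  \<open>p^2\<close> at index \<open>R\<close> and \<open>p * q\<close> at \<open>2 R\<close>, the
  list supplies three primes above \<open>p^2\<close>, and the one with the least exact power
  qualifies.\<close>

lemma contradiction: False
proof -
  note pp = p_squared_dvd
  note rpp = r_less[OF pp]
  have ppS: "p * p \<in> S" by (rule square_dvd_S[OF pp])
  have nzp: "\<And>i. \<not> (p dvd X i \<and> p dvd X (Suc i))" using no_common_prime p by blast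
  obtain R where R: "R < m" "X R = p * p" using index[OF ppS] .
  have "X 2 < X R" using X_2 R rpp by simp
  then have R3: "3 \<le> R" using X_less_iff[OF X_2(1) R(1)] by simp
  have adj1: "adjacent p 1 p" "adjacent p p q"
    using adjacent_0[OF pS ppS] adjacent_1[OF ppS pqS] by blast+
  have p2R: "2 * R < m" "X (2 * R) = p * q"
  proof -
    have "X 0 = p * 1" "0 + R < m" "X (0 + R) = p * p" "1 \<le> p" using X_0 R p1 by simp_all
    note gap = adjacent_gap[OF p nzp adj1(1) X_0(1) this(1-3) adj1(2) R this(4)]
    then show "2 * R < m" "X (2 * R) = p * q" by (simp_all add: mult_2)
  qed
  have between: "prime (X i) \<and> p * p < X i \<and> X i < p * q" if i: "R < i" "i < 2 * R" for i
  proof -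
    have 1: "X R < X i" "X i < X (2 * R)" using increasing[of R i] increasing[of i "2 * R"] i p2R by auto
    have "X i \<in> S" using X_in i p2R by simp
    then have "X i = p \<or> X i = p * p \<or> prime (X i) \<and> q \<le> X i" using below_pq[of "X i"] 1 p2R by simp
    moreover have "p < p * p" using p1 by simp
    ultimately show ?thesis using 1 R p2R by auto
  qed
  \<comment> \<open>From \<open>R \<ge> 3\<close> only two indices strictly between \<open>R\<close>
    and \<open>2 R\<close> are guaranteed, so the third prime is taken right after
    \<open>p * q\<close>.\<close>
  define s1 s2 s3 where "s1 = X (Suc R)" and "s2 = X (Suc (Suc R))" and "s3 = X (Suc (2 * R))"
  have s1: "prime s1" "p * p < s1" "s1 < p * q" and s2: "prime s2" "p * p < s2" "s2 < p * q"
    using between[of "Suc R"] between[of "Suc (Suc R)"] R3 by (simp_all add: s1_def s2_def)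
  have s12: "s1 < s2" "s1 \<in> S" "s2 \<in> S"
    using increasing[of "Suc R" "Suc (Suc R)"] X_in R3 p2R by (simp_all add: s1_def s2_def)
  have c4: "coprime (p * p * q * r * s1) s2" "coprime (p * p * q * r) s1" "coprime (p * p * q) r" "coprime (p * p) q"
    using coprime_pqr primes_coprime[OF p s1(1)] primes_coprime[OF q s1(1)] primes_coprime[OF r(1) s1(1)]
      primes_coprime[OF p s2(1)] primes_coprime[OF q s2(1)] primes_coprime[OF r(1) s2(1)]
      primes_coprime[OF s1(1) s2(1)] s1 s2 s12 rpp r pq by auto
  have "p * p * q dvd N" using divides_mult[OF pp dvds(3) c4(4)] .
  then have ppqrN: "p * p * q * r dvd N" using divides_mult[OF _ r(2) c4(3)] by simp
  have s12N: "s1 dvd N" "s2 dvd N" using s12 by (simp_all add: small_divisors_iff)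
  have "p * p * q * r * s1 * s2 dvd N"
    using divides_mult[OF divides_mult[OF ppqrN s12N(1) c4(2)] s12N(2) c4(1)] .
  then have N_ge: "p * p * q * r * s1 * s2 \<le> N" using N1 zdvd_imp_le by simp
  have prS: "p * r \<in> S"
  proof -
    have "r * 1 < s1 * s2" using rpp s1 s2 r1 prime_gt_1_int[OF s2(1)] by (intro mult_strict_mono) auto
    also have "\<dots> * 1 < s1 * s2 * q" using q1 prime_gt_1_int[OF s2(1)] prime_gt_1_int[OF s1(1)]
      by (intro mult_strict_left_mono) auto
    finally have "p * p * r * r < p * p * r * (s1 * s2 * q)" using p1 r1 by simp
    then have "p * r * (p * r) < N" using N_ge by (simp add: mult_ac)
    moreover have "p * r dvd N" using dvd_mult_left[OF pqr_dvd[unfolded mult.commute[of p q] mult.assoc]]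
      dvd_mult_right[OF pqr_dvd[unfolded mult.commute[of p q] mult.assoc]] by simp
    ultimately show ?thesis using less_1_mult[OF p1 r1] by (simp add: small_divisors_iff)
  qed
  have "X (2 * R) < p * r" using p2R r p1 by simp
  then have SR: "Suc (2 * R) < m" "s3 \<le> p * r" using next_le[OF prS p2R(1)] by (auto simp: s3_def)
  note s3' = X_Suc_gt[OF p2R SR(1), folded s3_def]
  have s3S: "s3 \<in> S" using X_in[OF SR(1)] by (simp add: s3_def)
  then have s3N: "s3 dvd N" "1 < s3" by (auto simp: small_divisors_iff)
  have prrr: "p * r < r * r" using p_less_r r1 by simp
  have "s3 < r * r" using SR(2) prrr by simp
  then have s3: "prime s3" using next_prime_le(1)[OF least_r s3N _ s3'(1,2) r1] by blast
  have s3_gt: "s2 < s3" using s2 s3' by simp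
  have pr_qr: "p * r < q * r" using pq r1 by simp
  have X3: "X 3 < s1"
    using increasing[of 3 "Suc R"] R3 R p2R by (simp add: s1_def)
  define T where "T = {s1, s2, s3}"
  have T: "prime s" "s dvd N" "s1 \<le> s" "s < q * r" "s \<in> S" if "s \<in> T" for s
  proof -
    have "s1 < q * r" "s2 < q * r" "s3 < q * r" using s12(1) s3_gt SR(2) pr_qr by linarith+
    then show "prime s" "s dvd N" "s1 \<le> s" "s < q * r" "s \<in> S"
      using that s1 s2 s3 s12 s12N s3N s3S s3_gt by (auto simp: T_def)
  qed
  \<comment> \<open>The exact power of \<open>s\<close> in \<open>N\<close>. For the prime with the
    least such power, \<open>N\<close> is at least \<open>p^2 * q * r\<close> times the cube of that
    power.\<close>
  define f where "f = (\<lambda>s. s ^ multiplicity s N)"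
  have "\<exists>l\<in>T. \<forall>s\<in>T. f l \<le> f s"
  proof -
    have "Min (f ` T) \<in> f ` T" by (rule Min_in) (auto simp: T_def)
    then obtain l where l: "l \<in> T" "f l = Min (f ` T)" by auto
    moreover have "finite (f ` T)" by (simp add: T_def)
    ultimately have "f l \<le> f s" if "s \<in> T" for s using that Min_le[of "f ` T" "f s"] by simp
    then show ?thesis using l by blast
  qed
  then obtain l where l: "l \<in> T" "\<And>s. s \<in> T \<Longrightarrow> f l \<le> f s" by blast
  note l1 = prime_gt_1_int[OF T(1)[OF l(1)]]
  have fN: "f s dvd N" for s by (simp add: f_def multiplicity_dvd)
  have cf: "coprime (p * p * q * r) (f s)" if "s \<in> T" for s
    using T[OF that] s1 rpp p_less_r r pq primes_coprime[OF p T(1)[OF that]]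
      primes_coprime[OF q T(1)[OF that]] primes_coprime[OF r(1) T(1)[OF that]] by (auto simp: f_def)
  have cT: "coprime (f s) (f s')" if "s \<in> T" "s' \<in> T" "s \<noteq> s'" for s s'
    using primes_coprime[OF T(1)[OF that(1)] T(1)[OF that(2)] that(3)] by (simp add: f_def)
  have inT: "s1 \<in> T" "s2 \<in> T" "s3 \<in> T" by (auto simp: T_def)
  have cc: "coprime (p * p * q * r) (f s1)" "coprime (p * p * q * r * f s1) (f s2)"
    "coprime (p * p * q * r * f s1 * f s2) (f s3)"
    using cf[OF inT(1)] cf[OF inT(2)] cf[OF inT(3)] cT[OF inT(1,2)] cT[OF inT(1,3)] cT[OF inT(2,3)]
      s12 s3_gt by (simp_all only: coprime_mult_left_iff)
  have "p * p * q * r * f s1 * f s2 * f s3 dvd N"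
    using divides_mult[OF divides_mult[OF divides_mult[OF ppqrN fN cc(1)] fN cc(2)] fN cc(3)] .
  then have "p * p * q * r * f s1 * f s2 * f s3 \<le> N" using N1 zdvd_imp_le by simp
  moreover have f0: "0 < f l" using l1 by (simp add: f_def)
  have "p * p * q * r * f l * f l * f l \<le> p * p * q * r * f s1 * f s2 * f s3"
    using l(2)[OF inT(1)] l(2)[OF inT(2)] l(2)[OF inT(3)] f0 p1 q1 r1
    by (intro mult_mono mult_nonneg_nonneg) auto
  ultimately have big: "p * p * q * r * f l * f l * f l \<le> N" by simp
  define e where "e = multiplicity l N"
  have "N \<noteq> 0" "\<not> is_unit l" using N1 l1 by auto
  then have e: "1 \<le> e" using T(2)[OF l(1)] by (simp add: e_def Suc_le_eq multiplicity_gt_zero_iff)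
  obtain M where M: "N = l ^ e * M" "\<not> l dvd M"
    using multiplicity_decompose'[OF \<open>N \<noteq> 0\<close> \<open>\<not> is_unit l\<close>] unfolding e_def by blast
  have fl: "f l = l ^ e" by (simp add: f_def e_def)
  have "l \<le> f l" using power_increasing[OF e, of l] l1 by (simp add: fl)
  have "coprime p (f l)" using cf[OF l(1)] by simp
  then have plN: "p * l ^ e dvd N" using divides_mult[OF dvds(2) fN[of l]] unfolding fl by blast
  \<comment> \<open>Two of the three factors \<open>f l\<close> match the square of
    \<open>l^e\<close>; the third, together with \<open>q * r\<close>, pays for the extra
    \<open>l * l\<close>.\<close>
  have "l * l < q * r * f l" using T(4)[OF l(1)] \<open>l \<le> f l\<close> l1 by (intro mult_less_le_imp_less) auto
  then have "(p * p * f l * f l) * (l * l) < (p * p * f l * f l) * (q * r * f l)"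
    using f0 p1 by simp
  also have "\<dots> \<le> N" using big by (simp add: mult_ac)
  finally have "(p * l ^ e * l) * (p * l ^ e * l) < N" by (simp add: fl mult_ac)
  moreover have "X 3 < l" using X3 T(3)[OF l(1)] by simp
  ultimately show False using no_small_prime_power[OF T(1)[OF l(1)] _ M e plN] by blast
qed

end

section \<open>Classification\<close>

lemma (in two_small_primes) listed: "listed N"
proof (cases "\<exists>r. prime r \<and> r dvd N \<and> q < r \<and> r < p * q")
  case False
  then have nr: "\<And>r. prime r \<Longrightarrow> r dvd N \<Longrightarrow> q < r \<Longrightarrow> \<not> r < p * q" by blast
  show ?thesis
  proof (cases "p * p dvd N")
    case True
    then show ?thesis using listed_if_X_3_eq_pq nr by blast
  next
    case False
    then show ?thesis using listed_if_X_2_eq_pq nr by blast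
  qed
next
  case True
  let ?R = "{r. prime r \<and> r dvd N \<and> q < r \<and> r < p * q}"
  have fin: "finite ?R" by (rule finite_subset[of _ "{q..p * q}"]) auto
  have "?R \<noteq> {}" using True by blast
  define r where "r = Min ?R"
  have "r \<in> ?R" unfolding r_def by (rule Min_in[OF fin \<open>?R \<noteq> {}\<close>])
  then have r: "prime r" "r dvd N" "q < r" "r < p * q" by auto
  have least_r: "r \<le> l" if "prime l" "l dvd N" "q < l" for l
  proof (cases "l < p * q")
    case True
    then show ?thesis unfolding r_def using that fin by (intro Min_le) auto
  qed (use r in simp)
  show ?thesis
  \<comment> \<open>Whether \<open>p^2\<close> precedes \<open>r\<close> separates lists
    \<open>p, q, p^2, r\<close> from lists \<open>p, q, r\<close>.\<close>
  proof (cases "p * p dvd N \<and> \<not> r < p * p")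
    case True
    have "r \<noteq> p * p"
    proof
      assume "r = p * p"
      then have "p dvd r" by simp
      then show False using primes_dvd_imp_eq[OF p r(1)] pq r by simp
    qed
    then have "p * p < r" using True by simp
    then show ?thesis using listed_if_X_3_eq_prime[of r] True r least_r by blast
  next
    case False
    interpret third_small_prime N a b X m p q r
      by unfold_locales (fact r | use False least_r in blast)+
    show ?thesis using contradiction ..
  qed
qed

text \<open>Covers the case that \<open>p * q\<close> is not small. The cofactor
  \<open>t \<le> p * q\<close> is so short that its factorization can be enumerated, leaving forms
  2, 7 and 8.\<close>

lemma listed_if_bounded:
  fixes p q N :: int
  assumes p: "prime p" and q: "prime q" and pq: "p < q" and N: "N = p * q * t" "0 < t" "t \<le> p * q"
    and least: "\<And>l. prime l \<Longrightarrow> l dvd N \<Longrightarrow> l \<noteq> p \<Longrightarrow> q \<le> l"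
    and p2: "p * p dvd N \<Longrightarrow> q < p * p"
  shows "listed N"
proof (cases "t = 1")
  case True
  then have "form2 N p q 1" using N p q pq by (simp add: form2_def)
  then show ?thesis by (rule listedI(2))
next
  case t1: False
  note p1 = prime_gt_1_int[OF p] and q1 = prime_gt_1_int[OF q]
  have tN: "t dvd N" using N by simp
  show ?thesis
  proof (cases "p dvd t")
    case True
    then obtain u where u: "t = p * u" by blast
    then have N': "N = p * p * q * u" using N by simp
    then have q2: "q < p * p" using p2 by simp
    have "0 < u" using u N(2) p1 by (simp add: zero_less_mult_iff)
    have "u \<le> q" using u N(3) p1 by simp
    show ?thesis
    proof (cases "u = 1")
      case True
      then have "form2 N p q 2" using N' p q pq by (simp add: form2_def power2_eq_square)
      then show ?thesis by (rule listedI(2))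
    next
      case False
      have "prime u"
      proof (rule prime_if_less_square[of u p])
        fix l assume l: "prime l" "l dvd u"
        then have "l dvd N" using N' by simp
        then show "p \<le> l" using least[OF l(1)] pq by (cases "l = p") auto
      qed (use \<open>0 < u\<close> False \<open>u \<le> q\<close> q2 p1 in auto)
      moreover have "u dvd N" using N' by simp
      ultimately have "u = p \<or> u = q" using least[of u] \<open>u \<le> q\<close> by (cases "u = p") simp_all
      then show ?thesis
      proof
        assume "u = p"
        then have "form2 N p q 3" using N' p q pq q2
          by (simp add: form2_def power2_eq_square power3_eq_cube)
        then show ?thesis by (rule listedI(2))
      next
        assume "u = q"
        then have "form7 N p q" using N' p q pq q2 by (simp add: form7_def power2_eq_square)
        then show ?thesis by (rule listedI(7))
      qed
    qed
  next
    case False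
    have ge: "q \<le> l" if l: "prime l" "l dvd t" for l
      using least[OF l(1) dvd_trans[OF l(2) tN]] l False by auto
    have "p * q < q * q" using pq q1 by simp
    then have "t < q * q" using N(3) by simp
    then have "prime t"
      using prime_if_less_square[of t q] ge N(2) t1 q1 by simp
    then have "q \<le> t" using ge by simp
    show ?thesis
    proof (cases "t = q")
      case True
      then have "form2 N p q 2" using N p q pq by (simp add: form2_def power2_eq_square)
      then show ?thesis by (rule listedI(2))
    next
      case False
      then have "form8 N p q t" using N p q pq \<open>prime t\<close> \<open>q \<le> t\<close> by (simp add: form8_def)
      then show ?thesis by (rule listedI(8))
    qed
  qed
qed

lemma least_prime_factor:
  fixes M :: int
  assumes "1 < M"
  obtains p where "prime p" "p dvd M" "\<And>l. prime l \<Longrightarrow> l dvd M \<Longrightarrow> p \<le> l"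
proof -
  let ?P = "{l. prime l \<and> l dvd M}"
  have fin: "finite ?P"
    by (rule finite_subset[of _ "{0..M}"]) (use assms zdvd_imp_le prime_ge_0_int in auto)
  moreover have "?P \<noteq> {}" using assms prime_factor_int[of M] by auto
  ultimately have "Min ?P \<in> ?P" by (rule Min_in)
  moreover have "Min ?P \<le> l" if "prime l" "l dvd M" for l using fin that by (intro Min_le) auto
  ultimately show thesis using that by blast
qed

lemma (in recurrent_small_divisors) listed: "listed N"
proof -
  obtain p where p: "prime p" "p dvd N" "\<And>l. prime l \<Longrightarrow> l dvd N \<Longrightarrow> p \<le> l"
    using least_prime_factor[OF N1] by blast
  note p1 = prime_gt_1_int[OF p(1)]
  have "N > 0" using N1 by simp
  obtain k M where M: "N = p ^ k * M" "\<not> p dvd M" "M > 0"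
    using prime_power_decompose[OF p(1) \<open>N > 0\<close>] by blast
  have k: "1 \<le> k" using M p(2) by (cases k) auto
  have pk: "p \<le> p ^ k" using power_increasing[OF k, of p] p1 by simp
  show ?thesis
  proof (cases "M = 1")
    case True
    then have "form1 N p k" using M p k by (simp add: form1_def)
    then show ?thesis by (rule listedI(1))
  next
    case False
    then have "1 < M" using M by simp
    obtain q where q: "prime q" "q dvd M" "\<And>l. prime l \<Longrightarrow> l dvd M \<Longrightarrow> q \<le> l"
      using least_prime_factor[OF \<open>1 < M\<close>] by blast
    note q1 = prime_gt_1_int[OF q(1)]
    have qN: "q dvd N" using q M by simp
    have "p \<noteq> q" using q M by auto
    then have pq: "p < q" using p(3)[OF q(1) qN] by simp
    have least: "q \<le> l" if l: "prime l" "l dvd N" "l \<noteq> p" for l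
    proof -
      have "\<not> l dvd p ^ k" using l p(1) prime_dvd_power primes_dvd_imp_eq by blast
      then have "l dvd M" using l M prime_dvd_mult_iff by blast
      then show ?thesis using q(3) l by blast
    qed
    have pqN: "p * q dvd N"
      using divides_mult[OF p(2) qN primes_coprime[OF p(1) q(1) \<open>p \<noteq> q\<close>]] .
    show ?thesis
    \<comment> \<open>If \<open>q\<close> is not small, every prime factor of \<open>M\<close> has
      square at least \<open>N\<close>, so \<open>M\<close> is a single prime above
      \<open>p^k\<close>.\<close>
    proof (cases "q * q < N")
      case False
      have "\<not> M dvd p ^ k"
      proof
        assume "M dvd p ^ k"
        then have "q dvd p" using q dvd_trans prime_dvd_power by blast
        then show False using primes_dvd_imp_eq[OF q(1) p(1)] pq by simp
      qed
      moreover have "N \<le> l * l" if "prime l" "l dvd M" for l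
        using False mult_mono[of q l q l] q(3)[OF that] q1 by simp
      moreover have "1 < p ^ k" using pk p1 by simp
      ultimately have *: "prime M" "p ^ k < M"
        using large_cofactor_prime[OF M(1) _ \<open>1 < M\<close>] by blast+
      show ?thesis
      proof (cases "k \<le> 3")
        case True
        then have "form2 N p M k" using * M(1) p(1) k pk by (cases "k = 3") (simp_all add: form2_def)
        then show ?thesis by (rule listedI(2))
      next
        case False
        then have "form3 N p M k" using * M(1) p(1) pk by (simp add: form3_def)
        then show ?thesis by (rule listedI(3))
      qed
    next
      case True
      then have qS: "q \<in> S" using qN q1 by (simp add: small_divisors_iff)
      then have pS: "p \<in> S" using S_downward[OF qS p1] pq p(2) by simp
      have ge: "p \<le> e" if e: "e dvd N" "1 < e" for e
      proof -
        obtain l where l: "prime l" "l dvd e" using e(2) prime_factor_int[of e] by auto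
        then have "l \<le> e" using e(2) zdvd_imp_le by simp
        then show ?thesis using p(3)[OF l(1) dvd_trans[OF l(2) e(1)]] by simp
      qed
      \<comment> \<open>Otherwise the list starts with \<open>p, p^2\<close>, and \<open>p\<close>
        divides every element, including \<open>q\<close>.\<close>
      have p2: "q < p * p" if pp: "p * p dvd N"
      proof (rule ccontr)
        assume "\<not> q < p * p"
        moreover have "q \<noteq> p * p"
        proof
          assume "q = p * p"
          then have "p dvd q" by simp
          then show False using primes_dvd_imp_eq[OF p(1) q(1)] pq by simp
        qed
        ultimately have less: "p * p < q" by simp
        have X0: "0 < m" "X 0 = p" using first_eq[OF pS] ge by (auto simp: small_divisors_iff)
        have ppS: "p * p \<in> S" using S_downward[OF qS _ _ pp] less_1_mult[OF p1 p1] less by simp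
        have *: "p * p \<le> e" if e: "e \<in> S" "X 0 < e" for e
        proof -
          have eN: "e dvd N" "1 < e" using e by (auto simp: small_divisors_iff)
          show ?thesis
          proof (cases "p dvd e")
            case True
            then obtain f where f: "e = p * f" by blast
            have "1 < f" using e(2) X0 f p1 by simp
            moreover have "f dvd N" using eN f dvd_mult_right by blast
            ultimately have "p \<le> f" using ge by simp
            then show ?thesis using f p1 by simp
          next
            case False
            obtain l where l: "prime l" "l dvd e" using eN(2) prime_factor_int[of e] by auto
            then have "l \<noteq> p" "l \<le> e" using False eN(2) zdvd_imp_le by auto
            then have "q \<le> e" using least[OF l(1) dvd_trans[OF l(2) eN(1)]] by simp
            then show ?thesis using less by simp
          qed
        qed
        have "X 0 < p * p" using X0 p1 by simp
        then have "X (Suc 0) = p * p" using next_eq(2)[OF ppS X0(1)] * by blast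
        then have all: "p dvd X i" for i using dvd_from[of p 0 i] X0 by simp
        obtain i where "X i = q" using index[OF qS] by blast
        then have "p dvd q" using all[of i] by simp
        then show False using primes_dvd_imp_eq[OF p(1) q(1)] pq by simp
      qed
      show ?thesis
      proof (cases "p * q \<in> S")
        case True
        interpret two_small_primes N a b X m p q
          by unfold_locales (fact p q pq True | use least p2 in blast)+
        show ?thesis by (rule listed)
      next
        case False
        then have "N \<le> p * q * (p * q)"
          using pqN less_1_mult[OF p1 q1] by (auto simp: small_divisors_iff)
        moreover obtain t where t: "N = p * q * t" using pqN by blast
        moreover have pq0: "0 < p * q" using p1 q1 by simp
        ultimately have "t \<le> p * q" by (simp only: mult_le_cancel_left_pos)
        moreover have "0 < t" using t \<open>N > 0\<close> pq0 by (simp only: zero_less_mult_pos)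
        ultimately show ?thesis using listed_if_bounded[OF p(1) q(1) pq t] least p2 by blast
      qed
    qed
  qed
qed

lemma listed_of_small_recurrent:
  assumes "1 < N" "small_recurrent N"
  shows "listed N"
proof -
  define xs where "xs = sorted_list_of_set (small_divisors N)"
  obtain a b where ab: "\<And>j. 2 \<le> j \<Longrightarrow> j < length xs \<Longrightarrow> xs ! j = a * xs ! (j - 1) + b * xs ! (j - 2)"
    using assms(2) by (auto simp: small_recurrent_def xs_def Let_def)
  \<comment> \<open>If \<open>xs\<close> has fewer than two entries, \<open>xs ! 0\<close> or
    \<open>xs ! 1\<close> is an unspecified value; \<open>X\<close> is compared with
    \<open>xs\<close> only at indices below \<open>length xs\<close>.\<close>
  define X where "X = rec_seq (xs ! 0) (xs ! 1) a b"
  have X: "i < length xs \<longrightarrow> X i = xs ! i" for i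
  proof (induction i rule: induct_nat_012)
    case (ge2 i)
    then show ?case using ab[of "Suc (Suc i)"] by (simp add: X_def)
  qed (simp_all add: X_def)
  have sorted: "sorted_wrt (<) xs" by (simp add: xs_def)
  interpret recurrent_small_divisors N a b X "length xs"
  proof
    have "small_divisors N = set xs" by (simp add: xs_def finite_small_divisors)
    also have "\<dots> = (!) xs ` {..<length xs}" by (auto simp: in_set_conv_nth)
    also have "\<dots> = X ` {..<length xs}" using X by (intro image_cong) auto
    finally show "small_divisors N = X ` {..<length xs}" .
    show "X i < X j" if "i < j" "j < length xs" for i j
      using that X[of i] X[of j] sorted sorted_wrt_nth_less by fastforce
  qed (use assms in \<open>simp_all add: X_def\<close>)
  show ?thesis by (rule listed)
qed

theorem theorem1p2:
  fixes N :: int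
  assumes "N > 1"
  shows
    "(small_recurrent N \<longleftrightarrow>
        (\<exists>p k. form1 N p k) \<or>
        (\<exists>p q k. form2 N p q k) \<or>
        (\<exists>p q k. form3 N p q k) \<or>
        (\<exists>p q k. form4 N p q k) \<or>
        (\<exists>p q k. form5 N p q k) \<or>
        (\<exists>p q r k. form6 N p q r k) \<or>
        (\<exists>p q. form7 N p q) \<or>
        (\<exists>p q r. form8 N p q r) \<or>
        (\<exists>p q. form9 N p q) \<or>
        (\<exists>p q r. form10 N p q r)) \<and>
     (\<forall>p k. form1 N p k \<longrightarrow>
        small_divisors N = {p ^ i | i. 1 \<le> i \<and> i \<le> (k - 1) div 2} \<and>
        satisfies_U (small_divisors N) p (p\<^sup>2) p 0) \<and>
     (\<forall>p q k. form3 N p q k \<longrightarrow>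
        small_divisors N = {p ^ i | i. 1 \<le> i \<and> i \<le> k} \<and>
        satisfies_U (small_divisors N) p (p\<^sup>2) p 0) \<and>
     (\<forall>p q k. form4 N p q k \<longrightarrow>
        take 4 (sorted_list_of_set (small_divisors N)) = [p, q, p\<^sup>2, p * q] \<and>
        satisfies_U (small_divisors N) p q 0 p) \<and>
     (\<forall>p q k. form5 N p q k \<longrightarrow>
        take 4 (sorted_list_of_set (small_divisors N)) = [p, q, p * q, q\<^sup>2] \<and>
        satisfies_U (small_divisors N) p q 0 q) \<and>
     (\<forall>p q r k. form6 N p q r k \<longrightarrow>
        small_divisors N = {q ^ i | i. 1 \<le> i \<and> i \<le> k} \<union> {p * q ^ i | i. i \<le> k} \<and>
        satisfies_U (small_divisors N) p q 0 q) \<and>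
     (\<forall>p q. form7 N p q \<longrightarrow> small_divisors N = {p, q, p\<^sup>2}) \<and>
     (\<forall>p q r. form8 N p q r \<longrightarrow>
        (r < p * q \<longrightarrow> small_divisors N = {p, q, r}) \<and>
        (r > p * q \<longrightarrow> small_divisors N = {p, q, p * q})) \<and>
     (\<forall>p q. form9 N p q \<longrightarrow>
        small_divisors N = {p, q, p\<^sup>2, p * q, p ^ 3} \<and>
        satisfies_U (small_divisors N) p q 0 p) \<and>
     (\<forall>p q r. form10 N p q r \<longrightarrow>
        small_divisors N = {p, q, p\<^sup>2, r, p * q} \<and>
        satisfies_U (small_divisors N) p q
          ((p * (p * q - r)) div (q\<^sup>2 - p ^ 3)) ((r * q - p ^ 4) div (q\<^sup>2 - p ^ 3)))"
proof (intro conjI)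
  show "small_recurrent N \<longleftrightarrow>
        (\<exists>p k. form1 N p k) \<or>
        (\<exists>p q k. form2 N p q k) \<or>
        (\<exists>p q k. form3 N p q k) \<or>
        (\<exists>p q k. form4 N p q k) \<or>
        (\<exists>p q k. form5 N p q k) \<or>
        (\<exists>p q r k. form6 N p q r k) \<or>
        (\<exists>p q. form7 N p q) \<or>
        (\<exists>p q r. form8 N p q r) \<or>
        (\<exists>p q. form9 N p q) \<or>
        (\<exists>p q r. form10 N p q r)"
    unfolding listed_def [symmetric]
    using listed_of_small_recurrent[OF assms] small_recurrent_of_listed by (rule iffI)
qed (intro allI impI conjI form1_divisors form3_divisors form4_divisors form5_divisors
    form6_divisors form7_divisors form8_divisors form9_divisors form10_divisors
    satisfies_U_form10; assumption)+

end
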